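(* Let $A$ be a nontrivial finite group which is almost monomial, and let $C$ be a cyclic group of prime order $p>0$. Let $W=A\wr C$ be the wreath product of $A$ by $C$, and let $B\unlhd W$ be the base group of $W$. Assume that for any $\chi\in\mathrm{Irr}(W)$ with $\chi_B\in\mathrm{Irr}(B)$ and any nontrivial character $\beta$ of $W/B$, there exist a subgroup $H\leqslant W$ and a linear character $\lambda$ of $H$ such that $\chi\in\mathrm{Cons}(\lambda^W)$ and $\beta\chi\notin\mathrm{Cons}(\lambda^W)$. Then $W=A\wr C$ is almost monomial.
   Context: All groups are finite and all characters are characters of finite-dimensional complex representations. $\mathrm{Irr}(G)$ denotes the set of irreducible characters of $G$. A character $\lambda$ is linear if $\lambda(1)=1$. For a character $\chi$ of $G$, $\mathrm{Cons}(\chi)\subseteq\mathrm{Irr}(G)$ is the set of irreducible constituents of $\chi$ (those occurring in $\chi$ with positive multiplicity). For $H\leqslant G$, $\chi_H$ denotes the restriction of a character $\chi$ of $G$ to $H$, and $\theta^G$ denotes the character of $G$ induced by a character $\theta$ of $H$. A character $\beta$ of a quotient $W/B$ is viewed as a character of $W$ by inflation, and $\beta\chi$ is the pointwise product. A finite group $G$ is almost monomial if for any two irreducible characters $\chi\neq\phi$ of $G$ there exist a subgroup $H\leqslant G$ and a linear character $\lambda$ of $H$ such that $\chi\in\mathrm{Cons}(\lambda^G)$ and $\phi\notin\mathrm{Cons}(\lambda^G)$. Wreath product: let $A$ be a nontrivial finite group, $r\geq 1$ an integer, and $B=A\times A\times\cdots\times A$ ($r$ copies). Let $f:B\to B$ be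 the automorphism $f(a_1,\ldots,a_r)=(a_r,a_1,\ldots,a_{r-1})$ and $T=\langle f\rangle\leqslant\mathrm{Aut}(B)$, which is cyclic of order $r$. The wreath product $A\wr C$ of $A$ by a cyclic group $C$ of order $r$ is the semidirect product of $B$ by $T$ (with $T$ acting naturally on $B$); $B$ is its base group. *)

theory Defs
  imports
    "HOL-Algebra.Bij"
    "HOL-Algebra.Generated_Groups"
    "HOL-Algebra.Elementary_Groups"
    "HOL-Algebra.Product_Groups"
    "HOL-Library.Multiset"
    "Jordan_Normal_Form.VS_Connect"
begin

section \<open>Complex characters of a group\<close>

text \<open>
  A representation of degree \<open>n > 0\<close> is a homomorphism into \<open>GL(n, \<complex>)\<close>, the group of units of
  the matrix ring. Class functions on \<open>G\<close>, and characters in particular, are extensional on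
  \<open>carrier G\<close>, so that equality of characters is equality of functions.
\<close>

definition representation ::
    "('a, 'm) monoid_scheme \<Rightarrow> nat \<Rightarrow> ('a \<Rightarrow> complex mat) \<Rightarrow> bool" where
  "representation G n \<rho> \<longleftrightarrow> n > 0 \<and> \<rho> \<in> hom G (units_of (ring_mat TYPE(complex) n ()))"

definition irreducible_representation ::
    "('a, 'm) monoid_scheme \<Rightarrow> nat \<Rightarrow> ('a \<Rightarrow> complex mat) \<Rightarrow> bool" where
  "irreducible_representation G n \<rho> \<longleftrightarrow>
     representation G n \<rho> \<and>
     (\<forall>U. VectorSpace.subspace class_ring U (module_vec TYPE(complex) n) \<longrightarrow>
          (\<forall>g\<in>carrier G. \<forall>u\<in>U. \<rho> g *\<^sub>v u \<in> U) \<longrightarrow>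
          U = {0\<^sub>v n} \<or> U = carrier_vec n)"

definition character_of ::
    "('a, 'm) monoid_scheme \<Rightarrow> ('a \<Rightarrow> complex mat) \<Rightarrow> 'a \<Rightarrow> complex" where
  "character_of G \<rho> = (\<lambda>g\<in>carrier G. sum_list (diag_mat (\<rho> g)))"

definition characters :: "('a, 'm) monoid_scheme \<Rightarrow> ('a \<Rightarrow> complex) set" where
  "characters G = {character_of G \<rho> | n \<rho>. representation G n \<rho>}"

definition Irr :: "('a, 'm) monoid_scheme \<Rightarrow> ('a \<Rightarrow> complex) set" where
  "Irr G = {character_of G \<rho> | n \<rho>. irreducible_representation G n \<rho>}"

definition linear_characters :: "('a, 'm) monoid_scheme \<Rightarrow> ('a \<Rightarrow> complex) set" where
  "linear_characters G = {\<mu>. \<mu> \<in> characters G \<and> \<mu> \<one>\<^bsub>G\<^esub> = 1}"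

definition principal_character :: "('a, 'm) monoid_scheme \<Rightarrow> 'a \<Rightarrow> complex" where
  "principal_character G = (\<lambda>g\<in>carrier G. 1)"

text \<open>
  The multiset \<open>M\<close> is the decomposition of \<open>\<chi>\<close> as a sum of irreducible characters; \<open>count M \<phi>\<close> is
  the multiplicity of \<open>\<phi>\<close>.
\<close>

definition constituents :: "('a, 'm) monoid_scheme \<Rightarrow> ('a \<Rightarrow> complex) \<Rightarrow> ('a \<Rightarrow> complex) set" where
  "constituents G \<chi> = {\<phi>. \<exists>M. set_mset M \<subseteq> Irr G \<and>
                              \<chi> = (\<lambda>g\<in>carrier G. \<Sum>\<psi>\<in>#M. \<psi> g) \<and> count M \<phi> > 0}"

definition induced ::
    "('a, 'm) monoid_scheme \<Rightarrow> 'a set \<Rightarrow> ('a \<Rightarrow> complex) \<Rightarrow> 'a \<Rightarrow> complex" where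
  "induced G H \<theta> = (\<lambda>g\<in>carrier G.
     (\<Sum>x\<in>carrier G. if x \<otimes>\<^bsub>G\<^esub> g \<otimes>\<^bsub>G\<^esub> inv\<^bsub>G\<^esub> x \<in> H
                    then \<theta> (x \<otimes>\<^bsub>G\<^esub> g \<otimes>\<^bsub>G\<^esub> inv\<^bsub>G\<^esub> x) else 0) / of_nat (card H))"

definition inflation ::
    "('a, 'm) monoid_scheme \<Rightarrow> 'a set \<Rightarrow> ('a set \<Rightarrow> complex) \<Rightarrow> 'a \<Rightarrow> complex" where
  "inflation G N \<beta> = (\<lambda>g\<in>carrier G. \<beta> (N #>\<^bsub>G\<^esub> g))"

definition char_mult ::
    "('a, 'm) monoid_scheme \<Rightarrow> ('a \<Rightarrow> complex) \<Rightarrow> ('a \<Rightarrow> complex) \<Rightarrow> 'a \<Rightarrow> complex" where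
  "char_mult G \<chi> \<psi> = (\<lambda>g\<in>carrier G. \<chi> g * \<psi> g)"

definition almost_monomial :: "('a, 'm) monoid_scheme \<Rightarrow> bool" where
  "almost_monomial G \<longleftrightarrow>
     Group.group G \<and> finite (carrier G) \<and>
     (\<forall>\<chi>\<in>Irr G. \<forall>\<phi>\<in>Irr G. \<chi> \<noteq> \<phi> \<longrightarrow>
        (\<exists>H \<mu>. subgroup H G \<and> \<mu> \<in> linear_characters (G\<lparr>carrier := H\<rparr>) \<and>
               \<chi> \<in> constituents G (induced G H \<mu>) \<and> \<phi> \<notin> constituents G (induced G H \<mu>)))"


section \<open>Wreath products with a cyclic group\<close>

definition direct_power :: "('a, 'm) monoid_scheme \<Rightarrow> nat \<Rightarrow> (nat \<Rightarrow> 'a) monoid" where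
  "direct_power A r = product_group {..<r} (\<lambda>_. A)"

text \<open>
  Coordinates are numbered from \<open>0\<close> to \<open>r - 1\<close>, so the map
  \<open>(a\<^sub>1, \<dots>, a\<^sub>r) \<mapsto> (a\<^sub>r, a\<^sub>1, \<dots>, a\<^sub>r\<^sub>-\<^sub>1)\<close> puts \<open>a (i - 1 mod r)\<close> at position \<open>i\<close>.
\<close>

definition cyclic_shift ::
    "('a, 'm) monoid_scheme \<Rightarrow> nat \<Rightarrow> (nat \<Rightarrow> 'a) \<Rightarrow> (nat \<Rightarrow> 'a)" where
  "cyclic_shift A r =
     (\<lambda>a\<in>carrier (direct_power A r). \<lambda>i\<in>{..<r}. a ((i + r - 1) mod r))"

text \<open>The semidirect product of \<open>B\<close> by a subgroup \<open>T\<close> of \<open>Aut(B)\<close>, acting naturally on \<open>B\<close>.\<close>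

definition semidirect_Aut ::
    "('b, 'm) monoid_scheme \<Rightarrow> ('b \<Rightarrow> 'b) set \<Rightarrow> ('b \<times> ('b \<Rightarrow> 'b)) monoid" where
  "semidirect_Aut B T =
     \<lparr>carrier = carrier B \<times> T,
      monoid.mult = (\<lambda>(b, s) (c, t). (b \<otimes>\<^bsub>B\<^esub> s c, s \<otimes>\<^bsub>AutoGroup B\<^esub> t)),
      one = (\<one>\<^bsub>B\<^esub>, \<one>\<^bsub>AutoGroup B\<^esub>)\<rparr>"

text \<open>Only the order of the cyclic group \<open>C\<close> enters the construction.\<close>

definition wreath_product ::
    "('a, 'm) monoid_scheme \<Rightarrow> ('c, 'k) monoid_scheme \<Rightarrow>
       ((nat \<Rightarrow> 'a) \<times> ((nat \<Rightarrow> 'a) \<Rightarrow> (nat \<Rightarrow> 'a))) monoid" where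
  "wreath_product A C =
     (let r = Coset.order C; B = direct_power A r
      in semidirect_Aut B (generate (AutoGroup B) {cyclic_shift A r}))"

definition base_group ::
    "('a, 'm) monoid_scheme \<Rightarrow> ('c, 'k) monoid_scheme \<Rightarrow>
       ((nat \<Rightarrow> 'a) \<times> ((nat \<Rightarrow> 'a) \<Rightarrow> (nat \<Rightarrow> 'a))) set" where
  "base_group A C =
     (let B = direct_power A (Coset.order C) in carrier B \<times> {\<one>\<^bsub>AutoGroup B\<^esub>})"

end

theory Submission
  imports Defs
    "Jordan_Normal_Form.DL_Rank"
    "Jordan_Normal_Form.Spectral_Radius"
    "HOL-Number_Theory.Cong"
begin

text \<open>
  The set-up uses the bilinear form \<open>\<langle>f, h\<rangle> = 1/|G| \<Sum> f(g) h(g\<^sup>-\<^sup>1)\<close>, for which the irreducible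
  characters are orthonormal; by Frobenius reciprocity \<open>\<phi>\<close> is a constituent of \<open>\<lambda>\<^sup>G\<close> if and only if
  \<open>\<langle>\<lambda>, \<phi>\<rangle> \<noteq> 0\<close> on \<open>H\<close>. Let \<open>\<chi> \<noteq> \<phi>\<close> be irreducible characters of \<open>W\<close>.

  If their restrictions to \<open>B\<close> share a constituent, then summing over the \<open>p\<close> characters \<open>\<beta>\<^sup>j\<close> of the
  quotient shows \<open>\<phi> = \<beta>\<^sup>j \<chi>\<close> for some \<open>j\<close>. If the restriction of \<open>\<chi>\<close> were reducible, the same sum
  would give \<open>\<beta>\<^sup>i \<chi> = \<chi>\<close> for some \<open>i \<noteq> 0\<close>, so \<open>\<chi>\<close> would vanish off \<open>B\<close> and \<open>\<phi> = \<chi>\<close>. Hence the hypothesis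
  on extensions applies.

  Otherwise choose constituents \<open>\<theta>\<close> and \<open>\<eta>\<close> of the two restrictions. Both are, up to a scalar, products
  of irreducible characters \<open>\<theta>\<^sub>i\<close>, \<open>\<eta>\<^sub>i\<close> of \<open>A\<close>, all constituents of \<open>\<phi>\<close> on \<open>B\<close> are cyclic shifts of \<open>\<eta>\<close>, and
  \<open>\<theta>\<close> is none of them. For prime \<open>p\<close> one can choose in each coordinate one character to be separated
  from \<open>\<theta>\<^sub>i\<close> so that every shift of \<open>\<eta>\<close> meets one of these choices; the product of the separating linear
  characters then separates \<open>\<chi>\<close> from \<open>\<phi>\<close>.
\<close>

section \<open>Subspaces and traces of matrices\<close>

text \<open>Almost monomiality of \<open>A\<close> separates one pair of characters at a time, and a
  linear character of a product of subgroups offers one such pair per coordinate. With a single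
  target character in each of p coordinates, all p shifts of \<eta> have to be defeated at once;
  this is the obstacle behind the combinatorial choice.

  Representations are decomposed along invariant flags: in block-triangular form the trace sees only
  the diagonal blocks. One fact about these blocks is carried along: an element of the group algebra
  that acts as a scalar on the whole space acts by the same scalar on each block. It yields both the
  conjugacy of constituents on a normal subgroup and the factorization of the irreducible characters
  of \<open>B\<close>. The factorization is kept up to a nonzero constant, because separation only
  asks whether a form vanishes.

  For \<phi>, every constituent on \<open>B\<close> has to be killed separately. For \<chi>, one
  surviving constituent is enough: multiplicities on a subgroup are natural numbers and cannot
  cancel.\<close>

lemma subspace_vecI:
  fixes U :: "complex vec set"
  assumes "U \<subseteq> carrier_vec n" and "0\<^sub>v n \<in> U"
    and "\<And>u v. u \<in> U \<Longrightarrow> v \<in> U \<Longrightarrow> u + v \<in> U"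
    and "\<And>c u. u \<in> U \<Longrightarrow> c \<cdot>\<^sub>v u \<in> U"
  shows "VectorSpace.subspace class_ring U (module_vec TYPE(complex) n)"
proof -
  interpret vec_space "TYPE(complex)" n .
  have "submodule class_ring U V"
    using assms by unfold_locales (auto simp: module_vec_simps class_ring_simps)
  then show ?thesis
    using vec_vs by (simp add: VectorSpace.subspace_def)
qed

text \<open>Extends a basis of \<open>U\<close> to a basis of the whole space. Conjugation by
  \<open>S\<close> then brings every matrix that preserves \<open>U\<close> into block-triangular
  form, with a block of proper size \<open>k\<close>.\<close>

lemma subspace_adapted_basis:
  fixes U :: "complex vec set"
  assumes U: "VectorSpace.subspace class_ring U (module_vec TYPE(complex) n)"
    and ne: "U \<noteq> {0\<^sub>v n}" and nU: "U \<noteq> carrier_vec n"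
  obtains k S T where "0 < k" "k < n" "S \<in> carrier_mat n n" "T \<in> carrier_mat n n"
    "S * T = 1\<^sub>m n" "T * S = 1\<^sub>m n"
    "\<And>j. j < k \<Longrightarrow> col S j \<in> U"
    "\<And>u i. u \<in> U \<Longrightarrow> k \<le> i \<Longrightarrow> i < n \<Longrightarrow> (T *\<^sub>v u) $ i = 0"
proof -
  interpret vec_space "TYPE(complex)" n .
  have sm: "submodule class_ring U V" using U by (simp add: VectorSpace.subspace_def)
  have Uc: "U \<subseteq> carrier_vec n"
    using submodule.subset[OF sm] by (simp add: module_vec_simps)
  have bound: "finite A \<and> card A \<le> n" if "A \<subseteq> carrier_vec n \<and> lin_indpt A" for A
    using li_le_dim[of A] that fin_dim dim_is_n by (auto simp: module_vec_simps)
  have li_e: "lin_indpt {}" by (simp add: lin_dep_def)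
  obtain A where A: "finite A" "maximal A (\<lambda>A. A \<subseteq> U \<and> lin_indpt A)"
    using maximal_exists[of "\<lambda>A. A \<subseteq> U \<and> lin_indpt A" n "{}"] bound Uc li_e by blast
  have AU: "A \<subseteq> U" "lin_indpt A" using A(2) by (auto simp: maximal_def)
  have Ac: "A \<subseteq> carrier_vec n" using AU Uc by auto
  obtain B where B: "finite B" "maximal B (\<lambda>B. B \<subseteq> carrier_vec n \<and> lin_indpt B \<and> A \<subseteq> B)"
    using maximal_exists[of "\<lambda>B. B \<subseteq> carrier_vec n \<and> lin_indpt B \<and> A \<subseteq> B" n A] bound AU Ac by blast
  have Bp: "B \<subseteq> carrier_vec n" "lin_indpt B" "A \<subseteq> B" using B(2) by (auto simp: maximal_def)
  have maxB: "maximal B (\<lambda>S. S \<subseteq> carrier V \<and> lin_indpt S)"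
    unfolding maximal_def
  proof (intro conjI allI impI)
    show "B \<subseteq> carrier V" "lin_indpt B" using Bp by (simp_all add: module_vec_simps)
    fix B' assume "B \<subseteq> B' \<and> B' \<subseteq> carrier V \<and> lin_indpt B'"
    then have "B' \<supseteq> B \<and> (B' \<subseteq> carrier_vec n \<and> lin_indpt B' \<and> A \<subseteq> B')"
      using Bp(3) by (auto simp add: module_vec_simps)
    then show "B' = B" using B(2) unfolding maximal_def by meson
  qed
  have basB: "basis B"
    using max_li_is_basis[of B] maxB by (simp add: module_vec_simps)
  then have cB: "card B = n" using dim_basis[OF B(1)] dim_is_n by simp
  have UA: "U \<subseteq> span A"
  proof
    fix u assume u: "u \<in> U"
    show "u \<in> span A"
    proof (rule ccontr)
      assume nu: "u \<notin> span A"
      have uA: "u \<notin> A" using nu in_own_span[of A] Ac by (auto simp: module_vec_simps)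
      have "lin_indpt (A \<union> {u})"
        using lin_dep_iff_in_span[of A u] Ac AU(2) u Uc uA nu by (auto simp: module_vec_simps)
      then have "A \<union> {u} = A" using A(2) AU(1) u unfolding maximal_def by blast
      then show False using uA by auto
    qed
  qed
  have spA: "span A \<subseteq> U"
    using span_is_subset[OF _ sm] AU(1) by (simp)
  obtain as where as: "set as = A" "distinct as" using finite_distinct_list[OF A(1)] by blast
  obtain bs where bs: "set bs = B - A" "distinct bs"
    using finite_distinct_list[of "B - A"] B(1) by blast
  \<comment> \<open>The basis \<open>A\<close> of \<open>U\<close> is listed first, so that the
    first \<open>k\<close> columns of \<open>S\<close> are the ones in \<open>U\<close>.\<close>
  define ws where "ws = as @ bs"
  have ws: "set ws = B" "distinct ws" using as bs Bp(3) by (auto simp: ws_def)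
  have lw: "length ws = n" using ws cB distinct_card by fastforce
  define k where "k = length as"
  have kA: "k = card A" using as distinct_card by (fastforce simp: k_def)
  define S where "S = mat_of_cols n ws"
  have S: "S \<in> carrier_mat n n" using lw mat_of_cols_carrier(1)[of n ws] by (simp add: S_def)
  have colsS: "cols S = ws" using ws Bp by (simp add: S_def)
  have "det S \<noteq> 0"
  proof
    assume "det S = 0"
    then obtain v where v: "v \<in> carrier_vec n" "v \<noteq> 0\<^sub>v n" "S *\<^sub>v v = 0\<^sub>v n"
      using det_0_iff_vec_prod_zero_field[OF S] by blast
    from lin_depI[OF S v] show False using colsS ws Bp by simp
  qed
  then have "S \<in> Units (ring_mat TYPE(complex) n ())" by (rule det_non_zero_imp_unit[OF S])
  then obtain T where T: "T \<in> carrier_mat n n" "T * S = 1\<^sub>m n" "S * T = 1\<^sub>m n"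
    by (auto simp: Units_def ring_mat_simps)
  have "0 < k"
  proof (rule ccontr)
    assume "\<not> 0 < k"
    then have "A = {}" using kA A(1) by simp
    then have "span A = {0\<^sub>v n}" using span_empty by (simp add: module_vec_simps)
    then have "U = {0\<^sub>v n}" using UA spA by auto
    then show False using ne by simp
  qed
  moreover have "k < n"
  proof (rule ccontr)
    assume "\<not> k < n"
    then have "A = B" using kA cB card_subset_eq[OF B(1) Bp(3)] card_mono[OF B(1) Bp(3)] by simp
    then have "span A = carrier_vec n" using basB by (simp add: basis_def module_vec_simps)
    then show False using UA spA nU by simp
  qed
  moreover have "col S j \<in> U" if "j < k" for j
  proof -
    have jn: "j < length ws" using that by (simp add: ws_def k_def)
    have "ws ! j \<in> A" using that as by (auto simp: ws_def k_def nth_append)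
    moreover from this have "col S j = ws ! j" unfolding S_def
      using col_mat_of_cols[OF jn] Ac by blast
    ultimately show ?thesis using AU by auto
  qed
  moreover have "(T *\<^sub>v u) $ i = 0" if u: "u \<in> U" and i: "k \<le> i" "i < n" for u i
  proof -
    have "u \<in> span A" using u UA by auto
    then obtain a where a: "u = lincomb a A"
      using finite_span[OF A(1)] Ac by (auto simp: module_vec_simps)
    \<comment> \<open>The coordinate vector of \<open>u\<close> in the basis \<open>ws\<close>. As
      \<open>T\<close> inverts \<open>S\<close>, it equals \<open>T *\<^sub>v u\<close>, and its
      entries from \<open>k\<close> on belong to basis vectors outside \<open>A\<close>.\<close>
    define v where "v = vec n (\<lambda>j. if ws ! j \<in> A then a (ws ! j) else 0)"
    have "u = lincomb (\<lambda>x. if x \<in> A then a x else 0) B"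
    proof (rule eq_vecI)
      have d: "dim_vec (lincomb f X) = n" if "X \<subseteq> carrier_vec n" "finite X" for f X
        using lincomb_dim[OF that(2,1)] .
      show "dim_vec u = dim_vec (lincomb (\<lambda>x. if x \<in> A then a x else 0) B)"
        using d Ac Bp a A B by metis
      fix i assume "i < dim_vec (lincomb (\<lambda>x. if x \<in> A then a x else 0) B)"
      then have i: "i < n" using d Bp B by simp
      show "u $ i = lincomb (\<lambda>x. if x \<in> A then a x else 0) B $ i"
        unfolding a lincomb_index[OF i Ac] lincomb_index[OF i Bp(1)]
        by (rule sum.mono_neutral_cong_left) (use B Bp in auto)
    qed
    also have "\<dots> = S *\<^sub>v v"
    proof -
      have "vec n (\<lambda>i. (\<lambda>x. if x \<in> A then a x else 0) (col S i)) = v"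
        unfolding v_def
      proof (rule eq_vecI)
        fix i assume "i < dim_vec (vec n (\<lambda>j. if ws ! j \<in> A then a (ws ! j) else 0))"
        then have i: "i < length ws" using lw by simp
        then have "ws ! i \<in> carrier_vec n" using ws Bp by (metis nth_mem subsetD)
        then have "col S i = ws ! i" using i by (simp add: S_def)
        then show "vec n (\<lambda>i. if col S i \<in> A then a (col S i) else 0) $ i
            = vec n (\<lambda>j. if ws ! j \<in> A then a (ws ! j) else 0) $ i"
          using i lw by simp
      qed simp
      then show ?thesis
        using mat_mult_eq_lincomb[OF S, of "\<lambda>x. if x \<in> A then a x else 0"] colsS ws by simp
    qed
    finally have "T *\<^sub>v u = T *\<^sub>v (S *\<^sub>v v)" by simp
    also have "\<dots> = v" using T S by (simp add: v_def assoc_mult_mat_vec[symmetric])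
    finally have "(T *\<^sub>v u) $ i = v $ i" by simp
    moreover have "ws ! i \<notin> A"
    proof -
      have "ws ! i = bs ! (i - k)" using i by (simp add: ws_def k_def nth_append)
      moreover have "i - k < length bs" using i lw by (simp add: ws_def k_def)
      ultimately have "ws ! i \<in> B - A" using bs(1) nth_mem by metis
      then show ?thesis by simp
    qed
    then have "v $ i = 0" using i by (simp add: v_def)
    ultimately show ?thesis by simp
  qed
  ultimately show ?thesis using that S T by blast
qed

section \<open>Sums over a finite group\<close>

locale fin_group = Group.group G for G :: "('a, 'm) monoid_scheme" (structure) +
  assumes finite_carrier: "finite (carrier G)"
begin

lemma card_pos: "card (carrier G) > 0"
  using finite_carrier one_closed card_gt_0_iff by blast

lemma sum_left_mult:
  assumes "h \<in> carrier G"
  shows "(\<Sum>g\<in>carrier G. F (h \<otimes> g)) = (\<Sum>g\<in>carrier G. F g)"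
  by (rule sum.reindex_bij_witness[of _ "\<lambda>g. inv h \<otimes> g" "\<lambda>g. h \<otimes> g"])
    (use assms in \<open>auto simp: m_assoc[symmetric]\<close>)

lemma sum_inv: "(\<Sum>g\<in>carrier G. F (inv g)) = (\<Sum>g\<in>carrier G. F g)"
  by (rule sum.reindex_bij_witness[of _ "\<lambda>g. inv g" "\<lambda>g. inv g"]) auto

lemma inv_mult_cancel:
  assumes "h \<in> carrier G" "a \<in> carrier G"
  shows "inv h \<otimes> (h \<otimes> a) = a" "h \<otimes> (inv h \<otimes> a) = a"
  using assms by (simp_all add: m_assoc[symmetric])

lemma sum_conj:
  assumes "h \<in> carrier G"
  shows "(\<Sum>g\<in>carrier G. F (h \<otimes> g \<otimes> inv h)) = (\<Sum>g\<in>carrier G. F g)"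
  by (rule sum.reindex_bij_witness[of _ "\<lambda>g. inv h \<otimes> g \<otimes> h" "\<lambda>g. h \<otimes> g \<otimes> inv h"])
    (use assms in \<open>auto simp: m_assoc inv_mult_cancel\<close>)

lemma fin_group_subgroup: "subgroup H G \<Longrightarrow> fin_group (G\<lparr>carrier := H\<rparr>)"
  using subgroup_imp_group finite_subset[OF subgroup.subset finite_carrier]
  by (simp add: fin_group_def fin_group_axioms_def)

end

section \<open>Traces and entrywise sums of matrices\<close>

definition mtrace :: "complex mat \<Rightarrow> complex" where
  "mtrace A = (\<Sum>i<dim_row A. A $$ (i, i))"

lemma mtrace_mult_comm:
  assumes "A \<in> carrier_mat n m" "B \<in> carrier_mat m n"
  shows "mtrace (A * B) = mtrace (B * A)"
proof -
  have "mtrace (A * B) = (\<Sum>i<n. \<Sum>j<m. A $$ (i, j) * B $$ (j, i))"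
    using assms by (simp add: mtrace_def scalar_prod_def atLeast0LessThan)
  also have "\<dots> = (\<Sum>j<m. \<Sum>i<n. B $$ (j, i) * A $$ (i, j))"
    by (subst sum.swap) (simp add: mult.commute)
  also have "\<dots> = mtrace (B * A)"
    using assms by (simp add: mtrace_def scalar_prod_def atLeast0LessThan)
  finally show ?thesis .
qed

lemma mtrace_one: "mtrace (1\<^sub>m n) = of_nat n"
  by (simp add: mtrace_def)

text \<open>Cyclicity of the trace. The factors may be rectangular with a one-sided inverse, so the
  lemma covers changes of basis as well as intertwiners between spaces of formally different
  dimensions.\<close>

lemma mtrace_conj:
  assumes "A \<in> carrier_mat n n" "X \<in> carrier_mat m n" "Y \<in> carrier_mat n m"
    and "Y * X = 1\<^sub>m n"
  shows "mtrace (X * A * Y) = mtrace A"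
proof -
  have "mtrace (X * A * Y) = mtrace (Y * (X * A))"
    using assms by (intro mtrace_mult_comm[of _ m n]) auto
  also have "Y * (X * A) = A"
    using assms by (simp add: assoc_mult_mat[of Y n m X n A n, symmetric])
  finally show ?thesis .
qed

text \<open>Matrix dimensions are not part of the type, so they are passed explicitly; the empty sum
  is then a zero matrix of the right size.\<close>

definition msum :: "nat \<Rightarrow> nat \<Rightarrow> 'i set \<Rightarrow> ('i \<Rightarrow> complex mat) \<Rightarrow> complex mat" where
  "msum n m I F = mat n m (\<lambda>(i, j). \<Sum>x\<in>I. F x $$ (i, j))"

lemma msum_carrier [simp]: "msum n m I F \<in> carrier_mat n m"
  and msum_index: "i < n \<Longrightarrow> j < m \<Longrightarrow> msum n m I F $$ (i, j) = (\<Sum>x\<in>I. F x $$ (i, j))"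
  and msum_dim [simp]: "dim_row (msum n m I F) = n" "dim_col (msum n m I F) = m"
  by (simp_all add: msum_def)

lemma msum_cong: "(\<And>x. x \<in> I \<Longrightarrow> F x = F' x) \<Longrightarrow> msum n m I F = msum n m I F'"
  by (simp add: msum_def cong: sum.cong)

lemma mult_msum:
  assumes "A \<in> carrier_mat k n" "\<And>x. x \<in> I \<Longrightarrow> F x \<in> carrier_mat n m"
  shows "A * msum n m I F = msum k m I (\<lambda>x. A * F x)"
proof (rule eq_matI)
  fix i j assume "i < dim_row (msum k m I (\<lambda>x. A * F x))" "j < dim_col (msum k m I (\<lambda>x. A * F x))"
  then have ij: "i < k" "j < m" by auto
  have "(A * msum n m I F) $$ (i, j) = (\<Sum>l<n. \<Sum>x\<in>I. A $$ (i, l) * F x $$ (l, j))"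
    using ij assms(1) by (simp add: scalar_prod_def msum_index sum_distrib_left atLeast0LessThan)
  also have "\<dots> = (\<Sum>x\<in>I. \<Sum>l<n. A $$ (i, l) * F x $$ (l, j))" by (rule sum.swap)
  also have "\<dots> = (\<Sum>x\<in>I. (A * F x) $$ (i, j))"
    by (rule sum.cong[OF refl], frule assms(2)) (use ij assms(1) in \<open>simp add: scalar_prod_def atLeast0LessThan\<close>)
  finally show "(A * msum n m I F) $$ (i, j) = msum k m I (\<lambda>x. A * F x) $$ (i, j)"
    using ij by (simp add: msum_index)
qed (use assms in auto)

lemma msum_mult:
  assumes "A \<in> carrier_mat m k" "\<And>x. x \<in> I \<Longrightarrow> F x \<in> carrier_mat n m"
  shows "msum n m I F * A = msum n k I (\<lambda>x. F x * A)"
proof (rule eq_matI)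
  fix i j assume "i < dim_row (msum n k I (\<lambda>x. F x * A))" "j < dim_col (msum n k I (\<lambda>x. F x * A))"
  then have ij: "i < n" "j < k" by auto
  have "(msum n m I F * A) $$ (i, j) = (\<Sum>l<m. \<Sum>x\<in>I. F x $$ (i, l) * A $$ (l, j))"
    using ij assms(1) by (simp add: scalar_prod_def msum_index sum_distrib_right atLeast0LessThan)
  also have "\<dots> = (\<Sum>x\<in>I. \<Sum>l<m. F x $$ (i, l) * A $$ (l, j))" by (rule sum.swap)
  also have "\<dots> = (\<Sum>x\<in>I. (F x * A) $$ (i, j))"
    by (rule sum.cong[OF refl], frule assms(2)) (use ij assms(1) in \<open>simp add: scalar_prod_def atLeast0LessThan\<close>)
  finally show "(msum n m I F * A) $$ (i, j) = msum n k I (\<lambda>x. F x * A) $$ (i, j)"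
    using ij by (simp add: msum_index)
qed (use assms in auto)

lemma mtrace_msum:
  assumes "\<And>x. x \<in> I \<Longrightarrow> F x \<in> carrier_mat n n"
  shows "mtrace (msum n n I F) = (\<Sum>x\<in>I. mtrace (F x))"
proof -
  have "mtrace (msum n n I F) = (\<Sum>x\<in>I. \<Sum>i<n. F x $$ (i, i))"
    by (simp add: mtrace_def msum_index) (rule sum.swap)
  also have "\<dots> = (\<Sum>x\<in>I. mtrace (F x))"
    by (rule sum.cong[OF refl]) (use assms in \<open>auto simp: mtrace_def\<close>)
  finally show ?thesis .
qed

lemma mult_unit_vec_col:
  fixes A :: "complex mat"
  assumes "A \<in> carrier_mat n m" "j < m"
  shows "A *\<^sub>v unit_vec m j = col A j"
  by (rule eq_vecI) (use assms in auto)

lemma mat_eq_if_mult_vec_eq: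
  fixes A B :: "complex mat"
  assumes "A \<in> carrier_mat n m" "B \<in> carrier_mat n m"
    and "\<And>v. v \<in> carrier_vec m \<Longrightarrow> A *\<^sub>v v = B *\<^sub>v v"
  shows "A = B"
proof (rule mat_col_eqI)
  fix j assume "j < dim_col B"
  then have j: "j < m" using assms by simp
  have "A *\<^sub>v unit_vec m j = col A j" "B *\<^sub>v unit_vec m j = col B j"
    using assms(1,2) j by (simp_all add: mult_unit_vec_col)
  then show "col A j = col B j" using assms(3)[of "unit_vec m j"] by simp
qed (use assms in auto)

section \<open>Matrix representations and Schur's lemma\<close>

context Group.group begin

text \<open>The matrix \<open>\<rho> (inv g)\<close> inverts \<open>\<rho> g\<close>, so
  multiplicativity together with the value at the identity already places every
  \<open>\<rho> g\<close> in the group of units.\<close>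

lemma representation_iff:
  "representation G n \<rho> \<longleftrightarrow> n > 0 \<and> (\<forall>g\<in>carrier G. \<rho> g \<in> carrier_mat n n) \<and>
     (\<forall>g\<in>carrier G. \<forall>h\<in>carrier G. \<rho> (g \<otimes> h) = \<rho> g * \<rho> h) \<and> \<rho> \<one> = 1\<^sub>m n"
  (is "?L \<longleftrightarrow> ?R")
proof
  interpret R: ring "ring_mat TYPE(complex) n ()" by (rule ring_mat)
  assume L: ?L
  then have h: "\<rho> \<in> hom G (units_of (ring_mat TYPE(complex) n ()))" and n: "n > 0"
    by (auto simp: representation_def)
  have c: "\<rho> g \<in> Units (ring_mat TYPE(complex) n ())" if "g \<in> carrier G" for g
    using h that by (auto simp: hom_def units_of_def)
  have "group_hom G (units_of (ring_mat TYPE(complex) n ())) \<rho>"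
    using h R.units_group group_axioms by (simp add: group_hom_def group_hom_axioms_def)
  then have "\<rho> \<one> = 1\<^sub>m n" using group_hom.hom_one by (fastforce simp: units_of_def ring_mat_simps)
  then show ?R using n h c by (auto simp: hom_def units_of_def ring_mat_simps Units_def)
next
  assume R: ?R
  have "\<rho> g \<in> Units (ring_mat TYPE(complex) n ())" if g: "g \<in> carrier G" for g
  proof -
    have "\<rho> g * \<rho> (inv g) = 1\<^sub>m n" "\<rho> (inv g) * \<rho> g = 1\<^sub>m n"
      using R g by (metis inv_closed r_inv, metis inv_closed l_inv)
    then show ?thesis using R g unfolding Units_def by (auto simp: ring_mat_simps)
  qed
  then show ?L using R by (auto simp: representation_def hom_def units_of_def ring_mat_simps)
qed

lemma
  assumes "representation G n \<rho>"
  shows rep_dim_pos: "n > 0"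
    and rep_carrier: "g \<in> carrier G \<Longrightarrow> \<rho> g \<in> carrier_mat n n"
    and rep_mult: "g \<in> carrier G \<Longrightarrow> h \<in> carrier G \<Longrightarrow> \<rho> (g \<otimes> h) = \<rho> g * \<rho> h"
    and rep_one: "\<rho> \<one> = 1\<^sub>m n"
  using assms by (simp_all add: representation_iff)

lemma
  assumes "representation G n \<rho>" "g \<in> carrier G"
  shows rep_inv_right: "\<rho> g * \<rho> (inv g) = 1\<^sub>m n"
    and rep_inv_left: "\<rho> (inv g) * \<rho> g = 1\<^sub>m n"
  using assms by (metis inv_closed r_inv rep_mult rep_one, metis inv_closed l_inv rep_mult rep_one)

lemma character_of_eq:
  assumes "g \<in> carrier G"
  shows "character_of G \<rho> g = mtrace (\<rho> g)"
  using assms by (simp add: character_of_def diag_mat_def mtrace_def sum_list_distinct_conv_sum_set atLeast0LessThan)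

lemma character_of_one:
  assumes "representation G n \<rho>"
  shows "character_of G \<rho> \<one> = of_nat n"
  by (simp add: character_of_eq rep_one[OF assms] mtrace_one)

lemma character_of_conj:
  assumes "representation G n \<rho>" "g \<in> carrier G" "h \<in> carrier G"
  shows "character_of G \<rho> (h \<otimes> g \<otimes> inv h) = character_of G \<rho> g"
proof -
  have "mtrace (\<rho> h * \<rho> g * \<rho> (inv h)) = mtrace (\<rho> g)"
    using assms rep_carrier by (intro mtrace_conj[where n=n and m=n] rep_inv_left) auto
  then show ?thesis using assms by (simp add: character_of_eq rep_mult)
qed

text \<open>Kernel and image of an intertwiner are invariant subspaces. Irreducibility of the source
  makes a nonzero \<open>Y\<close> injective, that of the target makes it surjective.\<close>

lemma schur:
  assumes r: "irreducible_representation G n \<rho>" and s: "irreducible_representation G m \<sigma>"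
    and Y: "Y \<in> carrier_mat n m" "Y \<noteq> 0\<^sub>m n m"
    and com: "\<And>g. g \<in> carrier G \<Longrightarrow> \<rho> g * Y = Y * \<sigma> g"
  obtains X where "X \<in> carrier_mat m n" "Y * X = 1\<^sub>m n" "X * Y = 1\<^sub>m m"
proof -
  have R: "representation G n \<rho>" and S: "representation G m \<sigma>"
    using r s by (auto simp: irreducible_representation_def)
  define K where "K = {v \<in> carrier_vec m. Y *\<^sub>v v = 0\<^sub>v n}"
  have K: "K = {0\<^sub>v m} \<or> K = carrier_vec m"
  proof -
    have "VectorSpace.subspace class_ring K (module_vec TYPE(complex) m)"
      by (rule subspace_vecI)
        (use Y in \<open>auto simp: K_def mult_add_distrib_mat_vec mult_mat_vec\<close>)
    moreover have "\<sigma> g *\<^sub>v v \<in> K" if "g \<in> carrier G" "v \<in> K" for g v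
    proof -
      have v: "v \<in> carrier_vec m" "Y *\<^sub>v v = 0\<^sub>v n" using that by (auto simp: K_def)
      have "Y *\<^sub>v (\<sigma> g *\<^sub>v v) = (Y * \<sigma> g) *\<^sub>v v"
        using rep_carrier[OF S that(1)] Y v by (simp add: assoc_mult_mat_vec)
      also have "\<dots> = \<rho> g *\<^sub>v (Y *\<^sub>v v)"
        using com[OF that(1)] rep_carrier[OF R that(1)] Y v by (metis assoc_mult_mat_vec)
      also have "\<dots> = 0\<^sub>v n"
        using v(2) rep_carrier[OF R that(1)] by (auto intro!: eq_vecI)
      finally show ?thesis using v rep_carrier[OF S that(1)] by (simp add: K_def)
    qed
    ultimately show ?thesis using s by (auto simp: irreducible_representation_def)
  qed
  define J where "J = {Y *\<^sub>v v | v. v \<in> carrier_vec m}"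
  have J: "J = {0\<^sub>v n} \<or> J = carrier_vec n"
  proof -
    have "VectorSpace.subspace class_ring J (module_vec TYPE(complex) n)"
    proof (rule subspace_vecI)
      show "J \<subseteq> carrier_vec n" using Y by (auto simp: J_def)
      show "0\<^sub>v n \<in> J" unfolding J_def
        using Y by (auto intro!: exI[of _ "0\<^sub>v m"] eq_vecI)
      show "u + v \<in> J" if "u \<in> J" "v \<in> J" for u v
        using that Y unfolding J_def by (smt (verit) mem_Collect_eq mult_add_distrib_mat_vec add_carrier_vec)
      show "c \<cdot>\<^sub>v u \<in> J" if "u \<in> J" for c u
        using that Y unfolding J_def by (smt (verit) mem_Collect_eq mult_mat_vec smult_carrier_vec)
    qed
    moreover have "\<rho> g *\<^sub>v u \<in> J" if g: "g \<in> carrier G" and u: "u \<in> J" for g u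
    proof -
      obtain v where v: "v \<in> carrier_vec m" "u = Y *\<^sub>v v" using u by (auto simp: J_def)
      have "\<rho> g *\<^sub>v u = Y *\<^sub>v (\<sigma> g *\<^sub>v v)"
        unfolding v(2) assoc_mult_mat_vec[OF rep_carrier[OF R g] Y(1) v(1), symmetric]
          com[OF g] assoc_mult_mat_vec[OF Y(1) rep_carrier[OF S g] v(1)] ..
      moreover have "\<sigma> g *\<^sub>v v \<in> carrier_vec m" using rep_carrier[OF S g] v by simp
      ultimately show ?thesis by (auto simp: J_def)
    qed
    ultimately show ?thesis using r by (auto simp: irreducible_representation_def)
  qed
  have nz: False if "\<And>v. v \<in> carrier_vec m \<Longrightarrow> Y *\<^sub>v v = 0\<^sub>v n"
  proof -
    have "Y = 0\<^sub>m n m" by (rule mat_eq_if_mult_vec_eq[OF Y(1)]) (use that in \<open>auto intro!: eq_vecI\<close>)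
    then show False using Y by simp
  qed
  have K0: "K = {0\<^sub>v m}" using K nz by (auto simp: K_def)
  have J1: "J = carrier_vec n" using J nz by (auto simp: J_def)
  have "\<exists>x. \<forall>i<n. x i \<in> carrier_vec m \<and> Y *\<^sub>v x i = unit_vec n i"
  proof -
    have "\<exists>v. v \<in> carrier_vec m \<and> Y *\<^sub>v v = unit_vec n i" for i
    proof -
      have "unit_vec n i \<in> J" using J1 by simp
      then show ?thesis unfolding J_def by force
    qed
    then show ?thesis by metis
  qed
  then obtain x where x: "\<And>i. i < n \<Longrightarrow> x i \<in> carrier_vec m" "\<And>i. i < n \<Longrightarrow> Y *\<^sub>v x i = unit_vec n i"
    by blast
  \<comment> \<open>The columns are preimages of the unit vectors under the surjective
    \<open>Y\<close>, which gives a right inverse.\<close>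
  define X where "X = mat_of_cols m (map x [0..<n])"
  have X: "X \<in> carrier_mat m n" unfolding X_def using mat_of_cols_carrier(1)[of m "map x [0..<n]"] by simp
  have YX: "Y * X = 1\<^sub>m n"
  proof (rule mat_col_eqI)
    fix j assume "j < dim_col (1\<^sub>m n)"
    then have j: "j < n" by simp
    have "col X j = x j" using j x by (simp add: X_def)
    then show "col (Y * X) j = col (1\<^sub>m n) j" using j X Y x by (simp add: col_mult2[OF Y(1) X j])
  qed (use X Y in auto)
  \<comment> \<open>\<open>Y\<close> annihilates the difference of \<open>X * Y\<close> and the
    identity, and its kernel is zero.\<close>
  have "X * Y = 1\<^sub>m m"
  proof (rule mat_eq_if_mult_vec_eq[of _ m m])
    fix v :: "complex vec" assume v: "v \<in> carrier_vec m"
    define w where "w = (X * Y) *\<^sub>v v"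
    have w: "w \<in> carrier_vec m" using X Y v unfolding w_def by (metis mult_carrier_mat mult_mat_vec_carrier)
    have "Y *\<^sub>v w = (Y * (X * Y)) *\<^sub>v v" unfolding w_def using X Y v
      by (metis assoc_mult_mat_vec mult_carrier_mat)
    also have "Y * (X * Y) = Y" using YX X Y by (simp add: assoc_mult_mat[of Y n m X n Y m, symmetric])
    finally have "Y *\<^sub>v (w - v) = 0\<^sub>v n" using w v Y
      by (simp add: mult_minus_distrib_mat_vec)
    then have "w - v \<in> K" using w v by (simp add: K_def)
    then have "w - v = 0\<^sub>v m" using K0 by simp
    then have "(w - v) $ i = 0" if "i < m" for i using that by simp
    then have "w = v" using w v by (intro eq_vecI) auto
    then show "(X * Y) *\<^sub>v v = 1\<^sub>m m *\<^sub>v v" using v by (simp add: w_def)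
  qed (use X Y in auto)
  then show ?thesis using that X YX by blast
qed

text \<open>Subtracting an eigenvalue, which exists over the complex numbers, leaves an intertwiner
  with a nonzero kernel vector; being singular, it must vanish by \<open>schur\<close>.\<close>

lemma schur_scalar:
  assumes r: "irreducible_representation G n \<rho>"
    and Y: "Y \<in> carrier_mat n n"
    and com: "\<And>g. g \<in> carrier G \<Longrightarrow> \<rho> g * Y = Y * \<rho> g"
  obtains c where "Y = c \<cdot>\<^sub>m 1\<^sub>m n"
proof -
  have R: "representation G n \<rho>" using r by (auto simp: irreducible_representation_def)
  obtain c where "eigenvalue Y c"
    using spectrum_non_empty[OF Y rep_dim_pos[OF R]] by (auto simp: spectrum_def)
  then obtain v where v: "v \<in> carrier_vec n" "v \<noteq> 0\<^sub>v n" "Y *\<^sub>v v = c \<cdot>\<^sub>v v"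
    using Y by (auto simp: eigenvalue_def eigenvector_def)
  define Z where "Z = Y - c \<cdot>\<^sub>m 1\<^sub>m n"
  have Z: "Z \<in> carrier_mat n n" using Y unfolding Z_def by (intro minus_carrier_mat) auto
  have Zv: "Z *\<^sub>v v = 0\<^sub>v n"
  proof -
    have "Z *\<^sub>v v = Y *\<^sub>v v - (c \<cdot>\<^sub>m 1\<^sub>m n) *\<^sub>v v"
      unfolding Z_def using Y v by (intro minus_mult_distrib_mat_vec) auto
    also have "(c \<cdot>\<^sub>m 1\<^sub>m n) *\<^sub>v v = c \<cdot>\<^sub>v v"
      using v(1) by (intro eq_vecI) (auto simp: row_smult)
    finally show ?thesis using v by simp
  qed
  have "Z = 0\<^sub>m n n"
  proof (rule ccontr)
    assume "Z \<noteq> 0\<^sub>m n n"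
    moreover have "\<rho> g * Z = Z * \<rho> g" if g: "g \<in> carrier G" for g
    proof -
      have "\<rho> g * Z = \<rho> g * Y - c \<cdot>\<^sub>m \<rho> g"
        unfolding Z_def using rep_carrier[OF R g] Y
        by (simp add: mult_minus_distrib_mat[of _ n n _ n] mult_smult_distrib[of _ n n _ n])
      also have "\<dots> = Z * \<rho> g"
        unfolding Z_def using rep_carrier[OF R g] Y com[OF g]
        by (simp add: minus_mult_distrib_mat[of _ n n _ _ n] mult_smult_assoc_mat[of _ n n _ n])
      finally show ?thesis .
    qed
    ultimately obtain X where X: "X \<in> carrier_mat n n" "X * Z = 1\<^sub>m n"
      using schur[OF r r Z] by metis
    have "v = (X * Z) *\<^sub>v v" using v unfolding X(2) by simp
    also have "\<dots> = X *\<^sub>v (Z *\<^sub>v v)" by (rule assoc_mult_mat_vec[OF X(1) Z v(1)])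
    also have "\<dots> = 0\<^sub>v n" using Zv X by (auto intro!: eq_vecI)
    finally show False using v by simp
  qed
  have "Y = c \<cdot>\<^sub>m 1\<^sub>m n"
  proof (rule eq_matI)
    fix i j assume "i < dim_row (c \<cdot>\<^sub>m 1\<^sub>m n)" "j < dim_col (c \<cdot>\<^sub>m (1\<^sub>m n :: complex mat))"
    then have ij: "i < n" "j < n" by auto
    have "Z $$ (i, j) = Y $$ (i, j) - (c \<cdot>\<^sub>m 1\<^sub>m n) $$ (i, j)"
      using ij Y unfolding Z_def by simp
    then show "Y $$ (i, j) = (c \<cdot>\<^sub>m 1\<^sub>m n) $$ (i, j)" using \<open>Z = 0\<^sub>m n n\<close> ij by simp
  qed (use Y in auto)
  then show ?thesis by (rule that)
qed

end

section \<open>Decomposition and orthogonality of characters\<close>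

text \<open>Here \<open>f\<close> stands for the group algebra element with coefficients
  \<open>f g\<close>. Unlike a statement about subspaces, this condition passes directly to the
  diagonal blocks of a block-triangular form.\<close>

definition acts_as_scalar ::
    "('a, 'm) monoid_scheme \<Rightarrow> nat \<Rightarrow> ('a \<Rightarrow> complex mat) \<Rightarrow> ('a \<Rightarrow> complex) \<Rightarrow> complex \<Rightarrow> bool" where
  "acts_as_scalar G n \<rho> f c \<longleftrightarrow>
     msum n n (carrier G) (\<lambda>g. f g \<cdot>\<^sub>m \<rho> g) = c \<cdot>\<^sub>m 1\<^sub>m n"

text \<open>On characters the value at \<open>inv g\<close> is the complex conjugate, so this agrees
  with the usual inner product there, while remaining bilinear and symmetric on all
  functions.\<close>

definition ip :: "('a, 'm) monoid_scheme \<Rightarrow> ('a \<Rightarrow> complex) \<Rightarrow> ('a \<Rightarrow> complex) \<Rightarrow> complex" where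
  "ip G f h = (\<Sum>g\<in>carrier G. f g * h (inv\<^bsub>G\<^esub> g)) / of_nat (card (carrier G))"

context Group.group begin

lemma acts_as_scalar_iff:
  assumes "representation G n \<rho>"
  shows "acts_as_scalar G n \<rho> f c \<longleftrightarrow>
    (\<forall>i<n. \<forall>j<n. (\<Sum>g\<in>carrier G. f g * \<rho> g $$ (i, j)) = (if i = j then c else 0))"
proof -
  have *: "(\<Sum>g\<in>carrier G. (f g \<cdot>\<^sub>m \<rho> g) $$ (i, j)) = (\<Sum>g\<in>carrier G. f g * \<rho> g $$ (i, j))"
    if "i < n" "j < n" for i j
    by (rule sum.cong[OF refl], frule rep_carrier[OF assms]) (use that in simp)
  show ?thesis
  proof
    assume "acts_as_scalar G n \<rho> f c"
    then have eq: "msum n n (carrier G) (\<lambda>g. f g \<cdot>\<^sub>m \<rho> g) = c \<cdot>\<^sub>m 1\<^sub>m n"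
      by (simp add: acts_as_scalar_def)
    show "\<forall>i<n. \<forall>j<n. (\<Sum>g\<in>carrier G. f g * \<rho> g $$ (i, j)) = (if i = j then c else 0)"
    proof (intro allI impI)
      fix i j assume ij: "i < n" "j < n"
      have "(\<Sum>g\<in>carrier G. f g * \<rho> g $$ (i, j)) = (c \<cdot>\<^sub>m 1\<^sub>m n) $$ (i, j)"
        unfolding eq[symmetric] using ij * by (simp add: msum_index)
      then show "(\<Sum>g\<in>carrier G. f g * \<rho> g $$ (i, j)) = (if i = j then c else 0)"
        using ij by simp
    qed
  next
    assume R: "\<forall>i<n. \<forall>j<n. (\<Sum>g\<in>carrier G. f g * \<rho> g $$ (i, j)) = (if i = j then c else 0)"
    show "acts_as_scalar G n \<rho> f c"
      unfolding acts_as_scalar_def by (rule eq_matI) (use R * in \<open>auto simp: msum_index\<close>)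
  qed
qed

lemma representation_conj:
  assumes R: "representation G n \<rho>"
    and S: "S \<in> carrier_mat n n" and T: "T \<in> carrier_mat n n"
    and ST: "S * T = 1\<^sub>m n" and TS: "T * S = 1\<^sub>m n"
  shows "representation G n (\<lambda>g. T * \<rho> g * S)"
    and "character_of G (\<lambda>g. T * \<rho> g * S) = character_of G \<rho>"
    and "acts_as_scalar G n \<rho> f c \<Longrightarrow> acts_as_scalar G n (\<lambda>g. T * \<rho> g * S) f c"
proof -
  note c = rep_carrier[OF R]
  show "representation G n (\<lambda>g. T * \<rho> g * S)"
    unfolding representation_iff
  proof (intro conjI ballI)
    fix g h assume g: "g \<in> carrier G" and h: "h \<in> carrier G"
    have "T * \<rho> g * S * (T * \<rho> h * S) = T * \<rho> g * (S * (T * (\<rho> h * S)))"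
      using S T c[OF g] c[OF h] by (simp add: assoc_mult_mat[of _ n n _ n _ n])
    also have "S * (T * (\<rho> h * S)) = \<rho> h * S"
      using S T ST c[OF h] by (simp add: assoc_mult_mat[of S n n T n _ n, symmetric])
    also have "T * \<rho> g * (\<rho> h * S) = T * \<rho> (g \<otimes> h) * S"
      using S T c[OF g] c[OF h] by (simp add: rep_mult[OF R g h] assoc_mult_mat[of _ n n _ n _ n])
    finally show "T * \<rho> (g \<otimes> h) * S = T * \<rho> g * S * (T * \<rho> h * S)" by simp
  qed (use S T TS c rep_dim_pos[OF R] rep_one[OF R] in auto)
  show "character_of G (\<lambda>g. T * \<rho> g * S) = character_of G \<rho>"
  proof
    fix g show "character_of G (\<lambda>g. T * \<rho> g * S) g = character_of G \<rho> g"
    proof (cases "g \<in> carrier G")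
      case True
      then show ?thesis using mtrace_conj[OF c[OF True] T S ST] by (simp add: character_of_eq)
    qed (simp add: character_of_def)
  qed
  assume "acts_as_scalar G n \<rho> f c"
  then have eq: "msum n n (carrier G) (\<lambda>g. f g \<cdot>\<^sub>m \<rho> g) = c \<cdot>\<^sub>m 1\<^sub>m n"
    by (simp add: acts_as_scalar_def)
  have "msum n n (carrier G) (\<lambda>g. f g \<cdot>\<^sub>m (T * \<rho> g * S))
      = msum n n (carrier G) (\<lambda>g. T * (f g \<cdot>\<^sub>m \<rho> g) * S)"
    by (rule msum_cong, frule rep_carrier[OF R])
      (use S T in \<open>simp add: mult_smult_distrib[of _ n n _ n] mult_smult_assoc_mat[of _ n n _ n]\<close>)
  also have "\<dots> = T * msum n n (carrier G) (\<lambda>g. f g \<cdot>\<^sub>m \<rho> g) * S"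
    using T S c by (subst mult_msum[of _ n], simp, simp, subst msum_mult[of _ n n], auto)
  also have "\<dots> = c \<cdot>\<^sub>m 1\<^sub>m n"
    unfolding eq using S T TS
    by (simp add: mult_smult_distrib[of _ n n _ n] mult_smult_assoc_mat[of _ n n _ n])
  finally show "acts_as_scalar G n (\<lambda>g. T * \<rho> g * S) f c" by (simp add: acts_as_scalar_def)
qed

text \<open>Only the lower left block is zero; the upper right one is arbitrary. Products of such
  matrices multiply the diagonal blocks separately, so these carry the subrepresentation and the
  quotient, and traces add up.\<close>

lemma representation_blocks:
  assumes R: "representation G n \<rho>" and k: "0 < k" "k < n"
    and z: "\<And>g i j. g \<in> carrier G \<Longrightarrow> k \<le> i \<Longrightarrow> i < n \<Longrightarrow> j < k \<Longrightarrow> \<rho> g $$ (i, j) = 0"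
  defines "\<rho>1 \<equiv> \<lambda>g. mat k k (\<lambda>(i, j). \<rho> g $$ (i, j))"
    and "\<rho>2 \<equiv> \<lambda>g. mat (n - k) (n - k) (\<lambda>(i, j). \<rho> g $$ (i + k, j + k))"
  shows "representation G k \<rho>1" "representation G (n - k) \<rho>2"
    and "character_of G \<rho> = (\<lambda>g\<in>carrier G. character_of G \<rho>1 g + character_of G \<rho>2 g)"
    and "acts_as_scalar G n \<rho> f c \<Longrightarrow> acts_as_scalar G k \<rho>1 f c"
    and "acts_as_scalar G n \<rho> f c \<Longrightarrow> acts_as_scalar G (n - k) \<rho>2 f c"
proof -
  note c = rep_carrier[OF R]
  have entry: "\<rho> (g \<otimes> h) $$ (i, j) = (\<Sum>l<n. \<rho> g $$ (i, l) * \<rho> h $$ (l, j))"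
    if "g \<in> carrier G" "h \<in> carrier G" "i < n" "j < n" for g h i j
    using that c[OF that(1)] c[OF that(2)]
    by (simp add: rep_mult[OF R] scalar_prod_def atLeast0LessThan)
  have split: "(\<Sum>l<n. F l) = (\<Sum>l<k. F l) + (\<Sum>l<n - k. F (l + k))" for F :: "nat \<Rightarrow> complex"
  proof -
    have "(\<Sum>l<n. F l) = (\<Sum>l<k. F l) + (\<Sum>l=k..<n. F l)"
      using k by (metis atLeast0LessThan less_imp_le_nat sum.atLeastLessThan_concat zero_le)
    also have "(\<Sum>l=k..<n. F l) = (\<Sum>l<n - k. F (l + k))"
      using sum.shift_bounds_nat_ivl[of F 0 k "n - k"] k by (simp add: atLeast0LessThan)
    finally show ?thesis .
  qed
  show R1: "representation G k \<rho>1"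
    unfolding representation_iff
  proof (intro conjI ballI)
    fix g h assume g: "g \<in> carrier G" and h: "h \<in> carrier G"
    show "\<rho>1 (g \<otimes> h) = \<rho>1 g * \<rho>1 h"
    proof (rule eq_matI)
      fix i j assume "i < dim_row (\<rho>1 g * \<rho>1 h)" "j < dim_col (\<rho>1 g * \<rho>1 h)"
      then have ij: "i < k" "j < k" by (auto simp: \<rho>1_def)
      have "\<rho> (g \<otimes> h) $$ (i, j) = (\<Sum>l<k. \<rho> g $$ (i, l) * \<rho> h $$ (l, j))"
        using ij k z[OF h] by (subst entry[OF g h]) (auto simp: split)
      then show "\<rho>1 (g \<otimes> h) $$ (i, j) = (\<rho>1 g * \<rho>1 h) $$ (i, j)"
        using ij by (simp add: \<rho>1_def scalar_prod_def atLeast0LessThan)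
    qed (auto simp: \<rho>1_def)
  next
    show "\<rho>1 \<one> = 1\<^sub>m k" by (rule eq_matI) (use k in \<open>auto simp: \<rho>1_def rep_one[OF R]\<close>)
  qed (use k in \<open>auto simp: \<rho>1_def\<close>)
  show R2: "representation G (n - k) \<rho>2"
    unfolding representation_iff
  proof (intro conjI ballI)
    fix g h assume g: "g \<in> carrier G" and h: "h \<in> carrier G"
    show "\<rho>2 (g \<otimes> h) = \<rho>2 g * \<rho>2 h"
    proof (rule eq_matI)
      fix i j assume "i < dim_row (\<rho>2 g * \<rho>2 h)" "j < dim_col (\<rho>2 g * \<rho>2 h)"
      then have ij: "i < n - k" "j < n - k" by (auto simp: \<rho>2_def)
      have "\<rho> (g \<otimes> h) $$ (i + k, j + k) = (\<Sum>l<n - k. \<rho> g $$ (i + k, l + k) * \<rho> h $$ (l + k, j + k))"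
        using ij k z[OF g] by (subst entry[OF g h]) (auto simp: split)
      then show "\<rho>2 (g \<otimes> h) $$ (i, j) = (\<rho>2 g * \<rho>2 h) $$ (i, j)"
        using ij by (simp add: \<rho>2_def scalar_prod_def atLeast0LessThan)
    qed (auto simp: \<rho>2_def)
  next
    show "\<rho>2 \<one> = 1\<^sub>m (n - k)" by (rule eq_matI) (use k in \<open>auto simp: \<rho>2_def rep_one[OF R]\<close>)
  qed (use k in \<open>auto simp: \<rho>2_def\<close>)
  show "character_of G \<rho> = (\<lambda>g\<in>carrier G. character_of G \<rho>1 g + character_of G \<rho>2 g)"
  proof
    fix g show "character_of G \<rho> g = (\<lambda>g\<in>carrier G. character_of G \<rho>1 g + character_of G \<rho>2 g) g"
    proof (cases "g \<in> carrier G")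
      case True
      then show ?thesis using c[OF True]
        by (simp add: character_of_eq mtrace_def split) (simp add: \<rho>1_def \<rho>2_def)
    qed (simp add: character_of_def)
  qed
  show "acts_as_scalar G k \<rho>1 f c" if "acts_as_scalar G n \<rho> f c"
    using that k unfolding acts_as_scalar_iff[OF R] acts_as_scalar_iff[OF R1]
    by (auto simp: \<rho>1_def)
  show "acts_as_scalar G (n - k) \<rho>2 f c" if "acts_as_scalar G n \<rho> f c"
    using that k unfolding acts_as_scalar_iff[OF R] acts_as_scalar_iff[OF R2]
    by (auto simp: \<rho>2_def)
qed

lemma acts_as_scalar_trace:
  assumes "representation G n \<rho>" "acts_as_scalar G n \<rho> f c"
  shows "(\<Sum>g\<in>carrier G. f g * character_of G \<rho> g) = c * of_nat n"
proof -
  have "(\<Sum>g\<in>carrier G. f g * character_of G \<rho> g) = (\<Sum>g\<in>carrier G. \<Sum>i<n. f g * \<rho> g $$ (i, i))"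
    by (rule sum.cong[OF refl], frule rep_carrier[OF assms(1)])
      (simp add: character_of_eq mtrace_def sum_distrib_left)
  also have "\<dots> = (\<Sum>i<n. \<Sum>g\<in>carrier G. f g * \<rho> g $$ (i, i))" by (rule sum.swap)
  also have "\<dots> = (\<Sum>i<n. c)"
    using assms(2) unfolding acts_as_scalar_iff[OF assms(1)] by (intro sum.cong) auto
  finally show ?thesis by simp
qed

text \<open>Induction on the degree: a reducible representation is made block triangular and
  replaced by its two smaller diagonal blocks. The last clause is the trace, on a constituent, of an
  operator that is scalar on the whole space; it is the only link kept between the representation
  and its constituents.\<close>

lemma decomposition:
  assumes "representation G n \<rho>"
  obtains M where "set_mset M \<subseteq> Irr G" "M \<noteq> {#}"
    "character_of G \<rho> = (\<lambda>g\<in>carrier G. \<Sum>\<psi>\<in>#M. \<psi> g)"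
    "\<And>f c \<psi>. acts_as_scalar G n \<rho> f c \<Longrightarrow> \<psi> \<in># M \<Longrightarrow>
       (\<Sum>g\<in>carrier G. f g * \<psi> g) = c * \<psi> \<one>"
  using assms
proof (induction n arbitrary: \<rho> thesis rule: less_induct)
  case (less n)
  note R = less.prems(2)
  show ?case
  proof (cases "irreducible_representation G n \<rho>")
    case True
    show ?thesis
    proof (rule less.prems(1)[of "{#character_of G \<rho>#}"])
      show "set_mset {#character_of G \<rho>#} \<subseteq> Irr G" using True by (auto simp: Irr_def)
      show "character_of G \<rho> = (\<lambda>g\<in>carrier G. \<Sum>\<psi>\<in>#{#character_of G \<rho>#}. \<psi> g)"
        by (auto simp: character_of_def)
    qed (auto simp: acts_as_scalar_trace[OF R] character_of_one[OF R])
  next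
    case False
    then obtain U where U: "VectorSpace.subspace class_ring U (module_vec TYPE(complex) n)"
        "\<And>g u. g \<in> carrier G \<Longrightarrow> u \<in> U \<Longrightarrow> \<rho> g *\<^sub>v u \<in> U" "U \<noteq> {0\<^sub>v n}" "U \<noteq> carrier_vec n"
      using R by (auto simp: irreducible_representation_def)
    obtain k S T where k: "0 < k" "k < n" and S: "S \<in> carrier_mat n n" and T: "T \<in> carrier_mat n n"
      and ST: "S * T = 1\<^sub>m n" "T * S = 1\<^sub>m n"
      and colS: "\<And>j. j < k \<Longrightarrow> col S j \<in> U"
      and TU: "\<And>u i. u \<in> U \<Longrightarrow> k \<le> i \<Longrightarrow> i < n \<Longrightarrow> (T *\<^sub>v u) $ i = 0"
      using subspace_adapted_basis[OF U(1,3,4)] by metis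
    define \<sigma> where "\<sigma> = (\<lambda>g. T * \<rho> g * S)"
    note conj = representation_conj[OF R S T ST, folded \<sigma>_def]
    \<comment> \<open>Column \<open>j < k\<close> of \<open>S\<close> lies in the invariant
      \<open>U\<close>, and \<open>T\<close> maps \<open>U\<close> to vectors supported on the first
      \<open>k\<close> coordinates.\<close>
    have z: "\<sigma> g $$ (i, j) = 0" if "g \<in> carrier G" "k \<le> i" "i < n" "j < k" for g i j
    proof -
      note cg = rep_carrier[OF R that(1)]
      have jn: "j < n" using that k by simp
      have "col (\<sigma> g) j = T *\<^sub>v (\<rho> g *\<^sub>v col S j)"
        unfolding \<sigma>_def assoc_mult_mat[OF T cg S] col_mult2[OF T mult_carrier_mat[OF cg S] jn]
          col_mult2[OF cg S jn] ..
      moreover have "\<rho> g *\<^sub>v col S j \<in> U" using U(2) that(1,4) colS by blast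
      ultimately have "col (\<sigma> g) j $ i = 0" using TU that by simp
      then show ?thesis using rep_carrier[OF conj(1) that(1)] jn that by simp
    qed
    define \<sigma>1 where "\<sigma>1 = (\<lambda>g. mat k k (\<lambda>(i, j). \<sigma> g $$ (i, j)))"
    define \<sigma>2 where "\<sigma>2 = (\<lambda>g. mat (n - k) (n - k) (\<lambda>(i, j). \<sigma> g $$ (i + k, j + k)))"
    note bl = representation_blocks[OF conj(1) k z, folded \<sigma>1_def \<sigma>2_def]
    obtain M1 where M1: "set_mset M1 \<subseteq> Irr G" "M1 \<noteq> {#}"
        "character_of G \<sigma>1 = (\<lambda>g\<in>carrier G. \<Sum>\<psi>\<in>#M1. \<psi> g)"
        "\<And>f c \<psi>. acts_as_scalar G k \<sigma>1 f c \<Longrightarrow> \<psi> \<in># M1 \<Longrightarrow>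
           (\<Sum>g\<in>carrier G. f g * \<psi> g) = c * \<psi> \<one>"
      using less.IH[OF k(2) _ bl(1)] by blast
    have nk: "n - k < n" using k by simp
    obtain M2 where M2: "set_mset M2 \<subseteq> Irr G" "M2 \<noteq> {#}"
        "character_of G \<sigma>2 = (\<lambda>g\<in>carrier G. \<Sum>\<psi>\<in>#M2. \<psi> g)"
        "\<And>f c \<psi>. acts_as_scalar G (n - k) \<sigma>2 f c \<Longrightarrow> \<psi> \<in># M2 \<Longrightarrow>
           (\<Sum>g\<in>carrier G. f g * \<psi> g) = c * \<psi> \<one>"
      using less.IH[OF nk _ bl(2)] by blast
    show ?thesis
    proof (rule less.prems(1)[of "M1 + M2"])
      show "character_of G \<rho> = (\<lambda>g\<in>carrier G. \<Sum>\<psi>\<in>#M1 + M2. \<psi> g)"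
        using bl(3) conj(2) M1(3) M2(3) by (auto simp: restrict_def fun_eq_iff)
      show "(\<Sum>g\<in>carrier G. f g * \<psi> g) = c * \<psi> \<one>"
        if "acts_as_scalar G n \<rho> f c" "\<psi> \<in># M1 + M2" for f c \<psi>
      proof -
        have sc: "acts_as_scalar G k \<sigma>1 f c" "acts_as_scalar G (n - k) \<sigma>2 f c"
          using bl(4,5) conj(3)[OF that(1)] by simp_all
        from that(2) consider "\<psi> \<in># M1" | "\<psi> \<in># M2" by auto
        then show ?thesis using M1(4)[OF sc(1)] M2(4)[OF sc(2)] by cases
      qed
    qed (use M1 M2 in auto)
  qed
qed

lemma Irr_obtain:
  assumes "\<chi> \<in> Irr G"
  obtains n \<rho> where "\<chi> = character_of G \<rho>" "irreducible_representation G n \<rho>" "representation G n \<rho>"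
  using assms by (auto simp: Irr_def irreducible_representation_def)

lemma Irr_subset_characters: "Irr G \<subseteq> characters G"
  by (auto simp: Irr_def characters_def irreducible_representation_def)

lemma characters_conj:
  assumes "\<chi> \<in> characters G" "g \<in> carrier G" "h \<in> carrier G"
  shows "\<chi> (h \<otimes> g \<otimes> inv h) = \<chi> g"
  using assms character_of_conj by (auto simp: characters_def)

lemma characters_extensional: "\<chi> \<in> characters G \<Longrightarrow> \<chi> \<in> extensional (carrier G)"
  by (auto simp: characters_def character_of_def)

lemma characters_one_nonzero: "\<chi> \<in> characters G \<Longrightarrow> \<chi> \<one> \<noteq> 0"
  using character_of_one rep_dim_pos by (fastforce simp: characters_def)

lemma characters_decomposition:
  assumes "\<chi> \<in> characters G"
  obtains M where "set_mset M \<subseteq> Irr G" "M \<noteq> {#}" "\<chi> = (\<lambda>g\<in>carrier G. \<Sum>\<psi>\<in>#M. \<psi> g)"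
proof -
  obtain n \<rho> where r: "\<chi> = character_of G \<rho>" "representation G n \<rho>"
    using assms by (auto simp: characters_def)
  show ?thesis
    by (rule decomposition[OF r(2)], rule that) (simp_all add: r(1))
qed

end

section \<open>Orthogonality of irreducible characters\<close>

context fin_group begin

lemma ip_commute: "ip G f h = ip G h f"
proof -
  have "(\<Sum>g\<in>carrier G. f g * h (inv g)) = (\<Sum>g\<in>carrier G. f (inv g) * h (inv (inv g)))"
    by (rule sum_inv[symmetric])
  also have "\<dots> = (\<Sum>g\<in>carrier G. h g * f (inv g))"
    by (rule sum.cong) auto
  finally show ?thesis by (simp add: ip_def)
qed

lemma ip_cong:
  assumes "\<And>g. g \<in> carrier G \<Longrightarrow> f g = f' g" "\<And>g. g \<in> carrier G \<Longrightarrow> h g = h' g"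
  shows "ip G f h = ip G f' h'"
  using assms by (auto simp: ip_def intro!: sum.cong)

lemma ip_scale_right: "ip G f (\<lambda>g. c * h g) = c * ip G f h"
  by (simp add: ip_def sum_distrib_left mult.assoc mult.left_commute)

lemma ip_sum_mset_left: "ip G (\<lambda>g. \<Sum>\<psi>\<in>#M. \<psi> g) h = (\<Sum>\<psi>\<in>#M. ip G \<psi> h)"
  by (induction M) (simp_all add: ip_def distrib_right sum.distrib add_divide_distrib)

lemma ip_restrict_left: "ip G (\<lambda>g\<in>carrier G. f g) h = ip G f h"
  by (rule ip_cong) auto

text \<open>Averaging any \<open>X\<close> over the group produces an intertwiner: left
  multiplication by \<open>h\<close> only permutes the summands, up to a right factor
  \<open>\<sigma> h\<close>.\<close>

lemma schur_average:
  assumes R: "representation G n \<rho>" and S: "representation G m \<sigma>"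
    and X: "X \<in> carrier_mat n m" and h: "h \<in> carrier G"
  defines "Y \<equiv> msum n m (carrier G) (\<lambda>g. \<rho> g * X * \<sigma> (inv g))"
  shows "\<rho> h * Y = Y * \<sigma> h"
proof -
  have c: "\<rho> g * X * \<sigma> (inv g) \<in> carrier_mat n m" if "g \<in> carrier G" for g
    using rep_carrier[OF R that] rep_carrier[OF S inv_closed[OF that]] X by simp
  have "\<rho> h * Y = msum n m (carrier G) (\<lambda>g. \<rho> h * (\<rho> g * X * \<sigma> (inv g)))"
    unfolding Y_def by (rule mult_msum[OF rep_carrier[OF R h] c])
  also have "\<dots> = msum n m (carrier G) (\<lambda>g. \<rho> (h \<otimes> g) * X * \<sigma> (inv (h \<otimes> g)) * \<sigma> h)"
  proof (rule msum_cong)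
    fix g assume g: "g \<in> carrier G"
    note cs = rep_carrier[OF R g] rep_carrier[OF R h] rep_carrier[OF S h]
      rep_carrier[OF S inv_closed[OF g]] rep_carrier[OF S inv_closed[OF h]]
    have "\<sigma> (inv (h \<otimes> g)) * \<sigma> h = \<sigma> (inv (h \<otimes> g) \<otimes> h)"
      using g h by (simp add: rep_mult[OF S])
    also have "inv (h \<otimes> g) \<otimes> h = inv g"
      using g h by (simp add: inv_mult_group m_assoc)
    finally have 1: "\<sigma> (inv (h \<otimes> g)) * \<sigma> h = \<sigma> (inv g)" .
    have "\<rho> (h \<otimes> g) * X * \<sigma> (inv (h \<otimes> g)) * \<sigma> h = \<rho> (h \<otimes> g) * X * (\<sigma> (inv (h \<otimes> g)) * \<sigma> h)"
      using g h X rep_carrier[OF R m_closed[OF h g]] rep_carrier[OF S h]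
        rep_carrier[OF S inv_closed[OF m_closed[OF h g]]]
      by (intro assoc_mult_mat[of _ n m _ m _ m]) auto
    also have "\<dots> = \<rho> h * (\<rho> g * X * \<sigma> (inv g))"
      unfolding 1 rep_mult[OF R h g] using cs X
      by (simp add: assoc_mult_mat[of _ n n _ n _ m] assoc_mult_mat[of _ n n _ m _ m])
    finally show "\<rho> h * (\<rho> g * X * \<sigma> (inv g)) = \<rho> (h \<otimes> g) * X * \<sigma> (inv (h \<otimes> g)) * \<sigma> h" by simp
  qed
  also have "\<dots> = msum n m (carrier G) (\<lambda>g. \<rho> g * X * \<sigma> (inv g) * \<sigma> h)"
  proof -
    have "(\<Sum>g\<in>carrier G. (\<rho> (h \<otimes> g) * X * \<sigma> (inv (h \<otimes> g)) * \<sigma> h) $$ (i, j))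
        = (\<Sum>g\<in>carrier G. (\<rho> g * X * \<sigma> (inv g) * \<sigma> h) $$ (i, j))" for i j
      by (rule sum_left_mult[OF h, of "\<lambda>g. (\<rho> g * X * \<sigma> (inv g) * \<sigma> h) $$ (i, j)"])
    then show ?thesis by (simp add: msum_def)
  qed
  also have "\<dots> = Y * \<sigma> h"
    unfolding Y_def by (rule msum_mult[OF rep_carrier[OF S h] c, symmetric])
  finally show ?thesis .
qed

text \<open>The matrix unit \<open>E_ab\<close>. Sandwiched between two matrices it isolates the
  product of one entry from each.\<close>

definition (in -) elem_mat :: "nat \<Rightarrow> nat \<Rightarrow> nat \<Rightarrow> nat \<Rightarrow> complex mat" where
  "elem_mat n m a b = mat n m (\<lambda>(i, j). if i = a \<and> j = b then 1 else 0)"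

lemma (in -) elem_mat_sandwich:
  assumes "P \<in> carrier_mat n n" "Q \<in> carrier_mat m m" "i < n" "j < m" "a < n" "b < m"
  shows "(P * elem_mat n m a b * Q) $$ (i, j) = P $$ (i, a) * Q $$ (b, j)"
proof -
  have 1: "(P * elem_mat n m a b) $$ (i, l) = (if l = b then P $$ (i, a) else 0)" if "l < m" for l
  proof -
    have "(P * elem_mat n m a b) $$ (i, l) = (\<Sum>t<n. P $$ (i, t) * (if t = a \<and> l = b then 1 else 0))"
      using assms that by (simp add: elem_mat_def scalar_prod_def atLeast0LessThan)
    also have "\<dots> = (\<Sum>t<n. if t = a then (if l = b then P $$ (i, a) else 0) else 0)"
      by (rule sum.cong) auto
    finally show ?thesis using assms by simp
  qed
  have "(P * elem_mat n m a b * Q) $$ (i, j) = (\<Sum>l<m. (P * elem_mat n m a b) $$ (i, l) * Q $$ (l, j))"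
    using assms by (simp add: elem_mat_def scalar_prod_def atLeast0LessThan)
  also have "\<dots> = (\<Sum>l<m. if l = b then P $$ (i, a) * Q $$ (b, j) else 0)"
    using 1 by (intro sum.cong) auto
  finally show ?thesis using assms by simp
qed

text \<open>The product of the diagonal entries \<open>(i, i)\<close> of \<open>\<rho> g\<close> and
  \<open>(j, j)\<close> of \<open>\<sigma> (inv g)\<close> is an entry of a sandwiched matrix unit.
  This turns the form into entries of averages, to which Schur's lemma applies.\<close>

lemma ip_characters_entries:
  assumes R: "representation G n \<rho>" and S: "representation G m \<sigma>"
  shows "ip G (character_of G \<rho>) (character_of G \<sigma>) = (\<Sum>i<n. \<Sum>j<m.
     msum n m (carrier G) (\<lambda>g. \<rho> g * elem_mat n m i j * \<sigma> (inv g)) $$ (i, j)) / of_nat (card (carrier G))"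
proof -
  have "(\<Sum>g\<in>carrier G. character_of G \<rho> g * character_of G \<sigma> (inv g))
      = (\<Sum>g\<in>carrier G. \<Sum>i<n. \<Sum>j<m. \<rho> g $$ (i, i) * \<sigma> (inv g) $$ (j, j))"
  proof (rule sum.cong[OF refl])
    fix g assume g: "g \<in> carrier G"
    then show "character_of G \<rho> g * character_of G \<sigma> (inv g)
        = (\<Sum>i<n. \<Sum>j<m. \<rho> g $$ (i, i) * \<sigma> (inv g) $$ (j, j))"
      using rep_carrier[OF R g] rep_carrier[OF S inv_closed[OF g]]
      by (simp add: character_of_eq mtrace_def sum_product)
  qed
  also have "\<dots> = (\<Sum>i<n. \<Sum>g\<in>carrier G. \<Sum>j<m. \<rho> g $$ (i, i) * \<sigma> (inv g) $$ (j, j))"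
    by (rule sum.swap)
  also have "\<dots> = (\<Sum>i<n. \<Sum>j<m. \<Sum>g\<in>carrier G. \<rho> g $$ (i, i) * \<sigma> (inv g) $$ (j, j))"
    by (rule sum.cong[OF refl]) (rule sum.swap)
  also have "\<dots> = (\<Sum>i<n. \<Sum>j<m.
     msum n m (carrier G) (\<lambda>g. \<rho> g * elem_mat n m i j * \<sigma> (inv g)) $$ (i, j))"
  proof (intro sum.cong[OF refl])
    fix i j assume ij: "i \<in> {..<n}" "j \<in> {..<m}"
    have "\<rho> g $$ (i, i) * \<sigma> (inv g) $$ (j, j) = (\<rho> g * elem_mat n m i j * \<sigma> (inv g)) $$ (i, j)"
      if "g \<in> carrier G" for g
      using elem_mat_sandwich[OF rep_carrier[OF R that] rep_carrier[OF S inv_closed[OF that]]] ij by simp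
    then show "(\<Sum>g\<in>carrier G. \<rho> g $$ (i, i) * \<sigma> (inv g) $$ (j, j))
        = msum n m (carrier G) (\<lambda>g. \<rho> g * elem_mat n m i j * \<sigma> (inv g)) $$ (i, j)"
      using ij by (simp add: msum_index cong: sum.cong)
  qed
  finally show ?thesis by (simp add: ip_def)
qed

text \<open>For different characters all averages vanish. For equal ones the average of a matrix
  unit is a scalar fixed by its trace: \<open>card (carrier G) / n\<close> on the diagonal units and
  0 otherwise, and the \<open>n\<close> diagonal units add up to 1 after normalization.\<close>

theorem Irr_orthonormal:
  assumes "\<chi> \<in> Irr G" "\<phi> \<in> Irr G"
  shows "ip G \<chi> \<phi> = (if \<chi> = \<phi> then 1 else 0)"
proof -
  obtain n \<rho> where r: "\<chi> = character_of G \<rho>" "irreducible_representation G n \<rho>" "representation G n \<rho>"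
    using assms(1) by (rule Irr_obtain)
  show ?thesis
  proof (cases "\<chi> = \<phi>")
    case False
    obtain m \<sigma> where s: "\<phi> = character_of G \<sigma>" "irreducible_representation G m \<sigma>" "representation G m \<sigma>"
      using assms(2) by (rule Irr_obtain)
    \<comment> \<open>A nonzero average would be invertible by \<open>schur\<close> and would
      conjugate \<rho> into \<sigma>, forcing equal traces.\<close>
    have "msum n m (carrier G) (\<lambda>g. \<rho> g * X * \<sigma> (inv g)) = 0\<^sub>m n m" (is "?Y = _")
      if X: "X \<in> carrier_mat n m" for X
    proof (rule ccontr)
      assume nz: "?Y \<noteq> 0\<^sub>m n m"
      obtain Z where Z: "Z \<in> carrier_mat m n" "?Y * Z = 1\<^sub>m n" "Z * ?Y = 1\<^sub>m m"
        using schur[OF r(2) s(2) msum_carrier nz] schur_average[OF r(3) s(3) X] by blast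
      have "character_of G \<rho> g = character_of G \<sigma> g" for g
      proof (cases "g \<in> carrier G")
        case True
        note cg = rep_carrier[OF r(3) True] rep_carrier[OF s(3) True]
        have Y: "?Y \<in> carrier_mat n m" by simp
        have "mtrace (\<rho> g) = mtrace (Z * \<rho> g * ?Y)"
          by (rule mtrace_conj[OF cg(1) Z(1) Y Z(2), symmetric])
        also have "Z * \<rho> g * ?Y = Z * (?Y * \<sigma> g)"
          using cg Z Y by (simp add: assoc_mult_mat[OF Z(1) cg(1) Y] schur_average[OF r(3) s(3) X True])
        also have "\<dots> = \<sigma> g"
          using cg Z Y by (simp add: assoc_mult_mat[OF Z(1) Y cg(2), symmetric])
        finally show ?thesis using True by (simp add: character_of_eq)
      qed (simp add: character_of_def)
      then show False using False r(1) s(1) by auto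
    qed
    then have "msum n m (carrier G) (\<lambda>g. \<rho> g * elem_mat n m i j * \<sigma> (inv g)) = 0\<^sub>m n m" for i j
      by (simp add: elem_mat_def)
    then show ?thesis using False unfolding r(1) s(1) ip_characters_entries[OF r(3) s(3)] by simp
  next
    case True
    have n: "n > 0" by (rule rep_dim_pos[OF r(3)])
    have e: "msum n n (carrier G) (\<lambda>g. \<rho> g * elem_mat n n i j * \<rho> (inv g)) $$ (i, j)
        = (if i = j then of_nat (card (carrier G)) / of_nat n else 0)" (is "?Y $$ _ = _")
      if ij: "i < n" "j < n" for i j
    proof -
      have X: "elem_mat n n i j \<in> carrier_mat n n" by (simp add: elem_mat_def)
      obtain c where c: "?Y = c \<cdot>\<^sub>m 1\<^sub>m n"
        using schur_scalar[OF r(2) msum_carrier schur_average[OF r(3) r(3) X]] by metis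
      have cc: "\<rho> g * elem_mat n n i j * \<rho> (inv g) \<in> carrier_mat n n" if "g \<in> carrier G" for g
        using rep_carrier[OF r(3) that] rep_carrier[OF r(3) inv_closed[OF that]] X by simp
      \<comment> \<open>The trace determines \<open>c\<close>: each summand is conjugate to the
        matrix unit, whose trace is 1 or 0.\<close>
      have "c * of_nat n = mtrace ?Y" unfolding c by (simp add: mtrace_def)
      also have "\<dots> = (\<Sum>g\<in>carrier G. mtrace (\<rho> g * elem_mat n n i j * \<rho> (inv g)))"
        by (rule mtrace_msum) (rule cc)
      also have "\<dots> = (\<Sum>g\<in>carrier G. mtrace (elem_mat n n i j))"
        by (rule sum.cong[OF refl], rule mtrace_conj[OF X])
          (auto intro: rep_carrier[OF r(3)] rep_inv_left[OF r(3)])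
      also have "mtrace (elem_mat n n i j) = (if i = j then 1 else 0)"
        using ij by (auto simp: mtrace_def elem_mat_def if_distrib intro: sum.neutral)
      finally have "c * of_nat n = (if i = j then of_nat (card (carrier G)) else 0)" by simp
      then have "c = (if i = j then of_nat (card (carrier G)) / of_nat n else 0)"
        using n by (auto simp: field_simps split: if_splits)
      then show ?thesis unfolding c using ij by auto
    qed
    have "ip G \<chi> \<chi> = (\<Sum>i<n. \<Sum>j<n. if i = j then of_nat (card (carrier G)) / of_nat n else 0)
        / of_nat (card (carrier G))"
      unfolding r(1) ip_characters_entries[OF r(3) r(3)]
      by (intro arg_cong2[of _ _ _ _ "(/)"] sum.cong refl e) auto
    also have "\<dots> = 1" using n card_pos by simp
    finally show ?thesis using True by simp
  qed
qed

lemma ip_sum_mset_Irr: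
  assumes "set_mset M \<subseteq> Irr G" "\<phi> \<in> Irr G"
  shows "ip G (\<lambda>g\<in>carrier G. \<Sum>\<psi>\<in>#M. \<psi> g) \<phi> = of_nat (count M \<phi>)"
proof -
  have "(\<Sum>\<psi>\<in>#M. ip G \<psi> \<phi>) = of_nat (count M \<phi>)"
    using assms(1) by (induction M) (auto simp: Irr_orthonormal assms(2))
  then show ?thesis by (simp add: ip_restrict_left ip_sum_mset_left)
qed

text \<open>By orthonormality the multiplicity of \<phi> is \<open>ip G \<chi> \<phi>\<close> for
  every decomposition \<open>M\<close>, so the existential quantifier in \<open>constituents\<close>
  leaves no ambiguity.\<close>

lemma constituents_iff:
  assumes "\<chi> \<in> characters G"
  shows "\<phi> \<in> constituents G \<chi> \<longleftrightarrow> \<phi> \<in> Irr G \<and> ip G \<chi> \<phi> \<noteq> 0"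
proof
  assume "\<phi> \<in> constituents G \<chi>"
  then obtain M where M: "set_mset M \<subseteq> Irr G" "\<chi> = (\<lambda>g\<in>carrier G. \<Sum>\<psi>\<in>#M. \<psi> g)" "count M \<phi> > 0"
    by (auto simp: constituents_def)
  then have "\<phi> \<in> Irr G" by (auto simp: count_greater_zero_iff)
  with M show "\<phi> \<in> Irr G \<and> ip G \<chi> \<phi> \<noteq> 0" using ip_sum_mset_Irr[OF M(1)] by simp
next
  assume R: "\<phi> \<in> Irr G \<and> ip G \<chi> \<phi> \<noteq> 0"
  obtain M where M: "set_mset M \<subseteq> Irr G" "\<chi> = (\<lambda>g\<in>carrier G. \<Sum>\<psi>\<in>#M. \<psi> g)"
    using characters_decomposition[OF assms] by metis
  then have "count M \<phi> > 0" using ip_sum_mset_Irr[OF M(1)] R by (metis of_nat_0 gr0I)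
  with M show "\<phi> \<in> constituents G \<chi>" by (auto simp: constituents_def)
qed

text \<open>Supplies nonnegativity: contributions of several constituents to a form cannot
  cancel.\<close>

lemma ip_characters_Nats:
  assumes "\<chi> \<in> characters G" "\<phi> \<in> Irr G"
  shows "ip G \<chi> \<phi> \<in> \<nat>"
  using characters_decomposition[OF assms(1)] ip_sum_mset_Irr[OF _ assms(2)] by (metis of_nat_in_Nats)

end

section \<open>Induced linear characters and restriction to normal subgroups\<close>

context Group.group begin

text \<open>The value at the identity is the degree, so it forces matrices of size 1, which multiply
  like their single entries.\<close>

lemma linear_characters_iff:
  "\<mu> \<in> linear_characters G \<longleftrightarrow> \<mu> \<in> extensional (carrier G) \<and> \<mu> \<one> = 1 \<and>
     (\<forall>g\<in>carrier G. \<forall>h\<in>carrier G. \<mu> (g \<otimes> h) = \<mu> g * \<mu> h)" (is "?L \<longleftrightarrow> ?R")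
proof
  assume ?L
  then obtain n \<rho> where r: "\<mu> = character_of G \<rho>" "representation G n \<rho>" "\<mu> \<one> = 1"
    by (auto simp: linear_characters_def characters_def)
  have n: "n = 1" using r character_of_one[OF r(2)] by (metis of_nat_eq_1_iff)
  have 1: "\<mu> g = \<rho> g $$ (0, 0)" if "g \<in> carrier G" for g
    using rep_carrier[OF r(2) that] that unfolding r(1) n by (simp add: character_of_eq mtrace_def)
  have "\<mu> (g \<otimes> h) = \<mu> g * \<mu> h" if "g \<in> carrier G" "h \<in> carrier G" for g h
    using that rep_carrier[OF r(2) that(1)] rep_carrier[OF r(2) that(2)] unfolding n
    by (simp add: 1 rep_mult[OF r(2)] scalar_prod_def)
  moreover have "\<mu> \<in> extensional (carrier G)" using r by (simp add: character_of_def)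
  ultimately show ?R using r(3) by simp
next
  assume R: ?R
  define \<rho> where "\<rho> = (\<lambda>g. mat 1 1 (\<lambda>_. \<mu> g))"
  have "representation G 1 \<rho>"
    unfolding representation_iff
  proof (intro conjI ballI)
    show "\<rho> (g \<otimes> h) = \<rho> g * \<rho> h" if "g \<in> carrier G" "h \<in> carrier G" for g h
      by (rule eq_matI) (use R that in \<open>auto simp: \<rho>_def scalar_prod_def\<close>)
    show "\<rho> \<one> = 1\<^sub>m 1" by (rule eq_matI) (use R in \<open>auto simp: \<rho>_def\<close>)
  qed (auto simp: \<rho>_def)
  moreover have "\<mu> = character_of G \<rho>"
  proof
    fix g show "\<mu> g = character_of G \<rho> g"
    proof (cases "g \<in> carrier G")
      case True
      then show ?thesis by (simp add: character_of_eq mtrace_def \<rho>_def)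
    next
      case False
      then show ?thesis using R by (auto simp: character_of_def extensional_def)
    qed
  qed
  ultimately show ?L using R by (auto simp: linear_characters_def characters_def)
qed

lemma irreducible_representation_dim_1:
  assumes "representation G 1 \<rho>"
  shows "irreducible_representation G 1 \<rho>"
  unfolding irreducible_representation_def
proof (intro conjI allI impI)
  fix U :: "complex vec set"
  assume U: "VectorSpace.subspace class_ring U (module_vec TYPE(complex) 1)"
  show "U = {0\<^sub>v 1} \<or> U = carrier_vec 1"
  proof (rule ccontr)
    assume "\<not> ?thesis"
    then obtain k where "0 < k" "k < (1::nat)" using subspace_adapted_basis[OF U] by metis
    then show False by simp
  qed
qed (rule assms)

lemma linear_characters_Irr: "linear_characters G \<subseteq> Irr G"
proof
  fix \<mu> assume "\<mu> \<in> linear_characters G"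
  then obtain n \<rho> where r: "\<mu> = character_of G \<rho>" "representation G n \<rho>" "\<mu> \<one> = 1"
    by (auto simp: linear_characters_def characters_def)
  have "n = 1" using r character_of_one[OF r(2)] by (metis of_nat_eq_1_iff)
  with r irreducible_representation_dim_1 show "\<mu> \<in> Irr G" by (auto simp: Irr_def)
qed

lemma linear_character_inv:
  assumes "\<mu> \<in> linear_characters G" "g \<in> carrier G"
  shows "\<mu> g * \<mu> (inv g) = 1" "\<mu> g \<noteq> 0"
proof -
  have "\<mu> g * \<mu> (inv g) = \<mu> (g \<otimes> inv g)"
    using assms linear_characters_iff by (metis inv_closed)
  then show "\<mu> g * \<mu> (inv g) = 1" using assms by (simp add: linear_characters_def)
  then show "\<mu> g \<noteq> 0" by auto
qed

lemma characters_restrict: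
  assumes \<chi>: "\<chi> \<in> characters G" and H: "subgroup H G"
  shows "restrict \<chi> H \<in> characters (G\<lparr>carrier := H\<rparr>)"
proof -
  interpret H: group "G\<lparr>carrier := H\<rparr>" by (rule subgroup_imp_group[OF H])
  have HG: "H \<subseteq> carrier G" by (rule subgroup.subset[OF H])
  obtain n \<rho> where r: "\<chi> = character_of G \<rho>" "representation G n \<rho>"
    using \<chi> by (auto simp: characters_def)
  have "representation (G\<lparr>carrier := H\<rparr>) n \<rho>"
    using r(2) HG unfolding H.representation_iff representation_iff by auto
  moreover have "restrict \<chi> H = character_of (G\<lparr>carrier := H\<rparr>) \<rho>"
    using HG unfolding r(1) by (auto simp: character_of_def fun_eq_iff)
  ultimately show ?thesis by (auto simp: characters_def)
qed

end

section \<open>Induction, Frobenius reciprocity and the action of normal subgroups\<close>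

context fin_group begin

text \<open>Representatives of the right cosets, numbered so that they can index the rows and
  columns of the induced matrices.\<close>

lemma transversal:
  assumes H: "subgroup H G"
  obtains n :: nat and t where "n > 0" "\<And>i. i < n \<Longrightarrow> t i \<in> carrier G"
    "\<And>x. x \<in> carrier G \<Longrightarrow> \<exists>!i. i < n \<and> x \<otimes> inv (t i) \<in> H"
proof -
  have fin: "finite (rcosets H)" using finite_carrier by (simp add: RCOSETS_def)
  obtain f where f: "bij_betw f {..<card (rcosets H)} (rcosets H)"
    using ex_bij_betw_nat_finite[OF fin] by (auto simp: atLeast0LessThan)
  define t where "t i = (SOME x. x \<in> carrier G \<and> f i = H #> x)" for i
  have t: "t i \<in> carrier G \<and> f i = H #> t i" if "i < card (rcosets H)" for i
  proof -
    have "f i \<in> rcosets H" using f that by (auto simp: bij_betw_def)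
    then have "\<exists>x. x \<in> carrier G \<and> f i = H #> x" by (auto simp: RCOSETS_def)
    then show ?thesis unfolding t_def by (rule someI_ex)
  qed
  have mem: "x \<otimes> inv (t i) \<in> H \<longleftrightarrow> f i = H #> x" if "i < card (rcosets H)" "x \<in> carrier G" for i x
  proof -
    have ti: "t i \<in> carrier G" "f i = H #> t i" using t[OF that(1)] by auto
    have "x \<otimes> inv (t i) \<in> H \<longleftrightarrow> x \<in> H #> t i"
      using subgroup.rcos_module[OF H is_group ti(1) that(2)] by simp
    also have "\<dots> \<longleftrightarrow> f i = H #> x"
      unfolding ti(2) using repr_independence[OF _ ti(1) H, of x] rcos_self[OF that(2) H] by auto
    finally show ?thesis .
  qed
  have ex: "\<exists>!i. i < card (rcosets H) \<and> x \<otimes> inv (t i) \<in> H" if x: "x \<in> carrier G" for x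
  proof -
    have "H #> x \<in> rcosets H" using x by (auto simp: RCOSETS_def)
    then obtain i where "i < card (rcosets H)" "f i = H #> x"
      using bij_betw_imp_surj_on[OF f] by (metis imageE lessThan_iff)
    moreover have "j = i" if "j < card (rcosets H)" "f j = H #> x" "i < card (rcosets H)" "f i = H #> x" for j i
      using inj_onD[OF bij_betw_imp_inj_on[OF f], of j i] that by simp
    ultimately have "\<exists>!i. i < card (rcosets H) \<and> f i = H #> x" by blast
    then show ?thesis using mem[OF _ x] by metis
  qed
  have "card (rcosets H) > 0" using ex[OF one_closed] by auto
  with that t ex show ?thesis by blast
qed

text \<open>Realized by monomial matrices: the coset representatives are permuted by right
  multiplication, and \<mu> supplies the nonzero entries.\<close>

theorem induced_linear_character:
  assumes H: "subgroup H G" and \<mu>: "\<mu> \<in> linear_characters (G\<lparr>carrier := H\<rparr>)"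
  shows "induced G H \<mu> \<in> characters G"
proof -
  interpret H: group "G\<lparr>carrier := H\<rparr>" by (rule subgroup_imp_group[OF H])
  have HG: "H \<subseteq> carrier G" by (rule subgroup.subset[OF H])
  have \<mu>1: "\<mu> \<one> = 1" and \<mu>m: "\<And>g h. g \<in> H \<Longrightarrow> h \<in> H \<Longrightarrow> \<mu> (g \<otimes> h) = \<mu> g * \<mu> h"
    using \<mu> unfolding H.linear_characters_iff by auto
  obtain n :: nat and t where n: "n > 0" and t: "\<And>i. i < n \<Longrightarrow> t i \<in> carrier G"
    and ex: "\<And>x. x \<in> carrier G \<Longrightarrow> \<exists>!i. i < n \<and> x \<otimes> inv (t i) \<in> H"
    using transversal[OF H] by metis
  \<comment> \<open>\<mu> extended by zero; a factor from \<open>H\<close> on either side does not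
    affect membership in \<open>H\<close>, so it can be pulled out.\<close>
  define \<nu> where "\<nu> x = (if x \<in> H then \<mu> x else 0)" for x
  have \<nu>_mult: "\<nu> (x \<otimes> y) = \<mu> x * \<nu> y" "\<nu> (y \<otimes> x) = \<mu> x * \<nu> y" if "x \<in> H" "y \<in> carrier G" for x y
  proof -
    have "x \<otimes> y \<in> H \<longleftrightarrow> y \<in> H" "y \<otimes> x \<in> H \<longleftrightarrow> y \<in> H"
      using that H HG subgroup.m_closed[OF H] subgroup.m_inv_closed[OF H]
      by (metis inv_solve_left subsetD subgroup.mem_carrier m_closed, metis inv_solve_right subsetD m_closed)
    then show "\<nu> (x \<otimes> y) = \<mu> x * \<nu> y" "\<nu> (y \<otimes> x) = \<mu> x * \<nu> y"
      using that \<mu>m by (auto simp: \<nu>_def)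
  qed
  define \<rho> where "\<rho> g = mat n n (\<lambda>(i, j). \<nu> (t i \<otimes> g \<otimes> inv (t j)))" for g
  have R: "representation G n \<rho>"
    unfolding representation_iff
  proof (intro conjI ballI)
    fix g h assume g: "g \<in> carrier G" and h: "h \<in> carrier G"
    show "\<rho> (g \<otimes> h) = \<rho> g * \<rho> h"
    proof (rule eq_matI)
      fix i k assume "i < dim_row (\<rho> g * \<rho> h)" "k < dim_col (\<rho> g * \<rho> h)"
      then have ik: "i < n" "k < n" by (auto simp: \<rho>_def)
      \<comment> \<open>Row \<open>i\<close> of \<open>\<rho> g\<close> is nonzero only in the
        column of the coset containing \<open>t i \<otimes> g\<close>, so the matrix product
        collapses to one term.\<close>
      obtain j where j: "j < n" "t i \<otimes> g \<otimes> inv (t j) \<in> H"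
        and uniq: "\<And>l. l < n \<Longrightarrow> t i \<otimes> g \<otimes> inv (t l) \<in> H \<Longrightarrow> l = j"
      proof -
        show thesis
          by (rule ex1E[OF ex[OF m_closed[OF t[OF ik(1)] g]]], elim conjE, rule that, assumption+)
            (drule spec, erule mp, rule conjI)
      qed
      have "(\<rho> g * \<rho> h) $$ (i, k) = (\<Sum>l<n. \<nu> (t i \<otimes> g \<otimes> inv (t l)) * \<nu> (t l \<otimes> h \<otimes> inv (t k)))"
        using ik by (simp add: \<rho>_def scalar_prod_def atLeast0LessThan)
      also have "\<dots> = (\<Sum>l<n. if l = j then \<mu> (t i \<otimes> g \<otimes> inv (t j)) * \<nu> (t j \<otimes> h \<otimes> inv (t k)) else 0)"
      proof (rule sum.cong[OF refl])
        fix l assume "l \<in> {..<n}"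
        then have l: "l < n" by simp
        show "\<nu> (t i \<otimes> g \<otimes> inv (t l)) * \<nu> (t l \<otimes> h \<otimes> inv (t k))
            = (if l = j then \<mu> (t i \<otimes> g \<otimes> inv (t j)) * \<nu> (t j \<otimes> h \<otimes> inv (t k)) else 0)"
        proof (cases "l = j")
          case True
          then show ?thesis using j(2) by (simp add: \<nu>_def)
        next
          case False
          then have "t i \<otimes> g \<otimes> inv (t l) \<notin> H" using uniq[OF l] by blast
          then show ?thesis using False by (simp add: \<nu>_def)
        qed
      qed
      also have "\<dots> = \<mu> (t i \<otimes> g \<otimes> inv (t j)) * \<nu> (t j \<otimes> h \<otimes> inv (t k))" using j by simp
      also have "\<dots> = \<nu> ((t i \<otimes> g \<otimes> inv (t j)) \<otimes> (t j \<otimes> h \<otimes> inv (t k)))"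
        using j ik t g h by (intro \<nu>_mult(1)[symmetric]) auto
      also have "(t i \<otimes> g \<otimes> inv (t j)) \<otimes> (t j \<otimes> h \<otimes> inv (t k)) = t i \<otimes> (g \<otimes> h) \<otimes> inv (t k)"
        using j(1) ik t g h by (simp add: m_assoc inv_mult_cancel)
      finally show "\<rho> (g \<otimes> h) $$ (i, k) = (\<rho> g * \<rho> h) $$ (i, k)" using ik by (simp add: \<rho>_def)
    qed (auto simp: \<rho>_def)
  next
    show "\<rho> \<one> = 1\<^sub>m n"
    proof (rule eq_matI)
      fix i j assume "i < dim_row (1\<^sub>m n)" "j < dim_col (1\<^sub>m n)"
      then have ij: "i < n" "j < n" by auto
      have "t i \<otimes> inv (t i) \<in> H" using t[OF ij(1)] subgroup.one_closed[OF H] by simp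
      then have "t i \<otimes> inv (t j) \<in> H \<longleftrightarrow> i = j" using ex[OF t[OF ij(1)]] ij by metis
      then show "\<rho> \<one> $$ (i, j) = 1\<^sub>m n $$ (i, j)"
        using ij t \<mu>1 by (auto simp: \<rho>_def \<nu>_def)
    qed (auto simp: \<rho>_def)
  qed (use n in \<open>auto simp: \<rho>_def\<close>)
  have "character_of G \<rho> = induced G H \<mu>"
  proof
    fix g
    show "character_of G \<rho> g = induced G H \<mu> g"
    proof (cases "g \<in> carrier G")
      case g: True
      define F where "F x = \<nu> (x \<otimes> g \<otimes> inv x)" for x
      have Fh: "F (h \<otimes> t i) = F (t i)" if "h \<in> H" "i < n" for h i
      proof -
        have h: "h \<in> carrier G" "inv h \<in> H" using that HG subgroup.m_inv_closed[OF H] by auto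
        have "F (h \<otimes> t i) = \<nu> (h \<otimes> (t i \<otimes> g \<otimes> inv (t i) \<otimes> inv h))"
          unfolding F_def using h t[OF that(2)] g by (simp add: inv_mult_group m_assoc)
        also have "\<dots> = \<mu> h * (\<mu> (inv h) * F (t i))"
          using h that t[OF that(2)] g by (simp add: \<nu>_mult F_def)
        also have "\<dots> = \<mu> (h \<otimes> inv h) * F (t i)"
          unfolding \<mu>m[OF that(1) h(2)] by simp
        finally show ?thesis using h \<mu>1 by simp
      qed
      \<comment> \<open>Every \<open>x\<close> lies in exactly one coset, and \<open>F\<close> is
        constant on cosets. The sum over the group is therefore \<open>card H\<close> times the
        trace, which cancels the denominator of \<open>induced\<close>.\<close>
      have "(\<Sum>x\<in>carrier G. F x) = (\<Sum>x\<in>carrier G. \<Sum>i<n. if x \<otimes> inv (t i) \<in> H then F x else 0)"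
      proof (rule sum.cong[OF refl])
        fix x assume "x \<in> carrier G"
        then obtain j where j: "j < n" "\<And>l. l < n \<Longrightarrow> x \<otimes> inv (t l) \<in> H \<longleftrightarrow> l = j" using ex by metis
        then have "(\<Sum>i<n. if x \<otimes> inv (t i) \<in> H then F x else 0) = (\<Sum>i<n. if i = j then F x else 0)"
          by (intro sum.cong) auto
        then show "F x = (\<Sum>i<n. if x \<otimes> inv (t i) \<in> H then F x else 0)" using j(1) by simp
      qed
      also have "\<dots> = (\<Sum>i<n. \<Sum>x\<in>carrier G. if x \<otimes> inv (t i) \<in> H then F x else 0)" by (rule sum.swap)
      also have "\<dots> = (\<Sum>i<n. of_nat (card H) * F (t i))"
      proof (rule sum.cong[OF refl])
        fix i assume "i \<in> {..<n}"
        then have i: "i < n" by simp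
        have "(\<Sum>x\<in>carrier G. if x \<otimes> inv (t i) \<in> H then F x else 0)
            = (\<Sum>x\<in>{x\<in>carrier G. x \<otimes> inv (t i) \<in> H}. F x)"
          using finite_carrier by (simp add: sum.inter_filter)
        also have "\<dots> = (\<Sum>h\<in>H. F (h \<otimes> t i))"
          by (rule sum.reindex_bij_witness[of _ "\<lambda>h. h \<otimes> t i" "\<lambda>x. x \<otimes> inv (t i)"])
            (use HG t[OF i] in \<open>auto simp: m_assoc\<close>)
        also have "\<dots> = of_nat (card H) * F (t i)" using Fh i by simp
        finally show "(\<Sum>x\<in>carrier G. if x \<otimes> inv (t i) \<in> H then F x else 0) = of_nat (card H) * F (t i)" .
      qed
      finally have "(\<Sum>x\<in>carrier G. F x) = of_nat (card H) * (\<Sum>i<n. F (t i))"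
        by (simp add: sum_distrib_left)
      moreover have "card H > 0"
        using finite_subset[OF HG finite_carrier] subgroup.one_closed[OF H] card_gt_0_iff by blast
      moreover have "(\<Sum>i<n. F (t i)) = character_of G \<rho> g"
        using g by (simp add: character_of_eq mtrace_def \<rho>_def F_def)
      ultimately show ?thesis using g by (simp add: induced_def F_def \<nu>_def)
    qed (auto simp: induced_def character_of_def)
  qed
  with R show ?thesis unfolding characters_def by (intro CollectI exI[of _ n] exI[of _ \<rho>]) simp
qed

text \<open>Since \<phi> is a class function, it can be conjugated along with the argument of
  \<open>f\<close>. Each \<open>x\<close> in the induction sum then contributes the same sum over
  \<open>H\<close>.\<close>

theorem frobenius_reciprocity:
  assumes H: "subgroup H G" and \<phi>: "\<And>g h. g \<in> carrier G \<Longrightarrow> h \<in> carrier G \<Longrightarrow> \<phi> (h \<otimes> g \<otimes> inv h) = \<phi> g"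
  shows "ip G (induced G H f) \<phi> = ip (G\<lparr>carrier := H\<rparr>) f \<phi>"
proof -
  have HG: "H \<subseteq> carrier G" by (rule subgroup.subset[OF H])
  let ?F = "\<lambda>y. if y \<in> H then f y else 0"
  have "(\<Sum>g\<in>carrier G. (\<Sum>x\<in>carrier G. ?F (x \<otimes> g \<otimes> inv x)) * \<phi> (inv g))
      = (\<Sum>x\<in>carrier G. \<Sum>g\<in>carrier G. ?F (x \<otimes> g \<otimes> inv x) * \<phi> (inv g))"
    by (subst sum.swap) (simp add: sum_distrib_right)
  also have "\<dots> = (\<Sum>x\<in>carrier G. \<Sum>g\<in>carrier G. ?F (x \<otimes> g \<otimes> inv x) * \<phi> (inv (x \<otimes> g \<otimes> inv x)))"
  proof (intro sum.cong[OF refl] arg_cong2[of _ _ _ _ "(*)"])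
    fix x g assume x: "x \<in> carrier G" and g: "g \<in> carrier G"
    have "inv (x \<otimes> g \<otimes> inv x) = x \<otimes> inv g \<otimes> inv x" using x g by (simp add: inv_mult_group m_assoc)
    then show "\<phi> (inv g) = \<phi> (inv (x \<otimes> g \<otimes> inv x))" using \<phi>[of "inv g" x] x g by simp
  qed simp
  also have "\<dots> = (\<Sum>x\<in>carrier G. \<Sum>g\<in>carrier G. ?F g * \<phi> (inv g))"
    by (rule sum.cong[OF refl]) (rule sum_conj)
  also have "\<dots> = of_nat (card (carrier G)) * (\<Sum>g\<in>H. f g * \<phi> (inv g))"
  proof -
    have "(\<Sum>g\<in>carrier G. ?F g * \<phi> (inv g)) = (\<Sum>g\<in>H. f g * \<phi> (inv g))"
      by (rule sum.mono_neutral_cong_right) (use HG finite_carrier in auto)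
    then show ?thesis by simp
  qed
  finally have "(\<Sum>g\<in>carrier G. (\<Sum>x\<in>carrier G. ?F (x \<otimes> g \<otimes> inv x)) * \<phi> (inv g))
      = of_nat (card (carrier G)) * (\<Sum>g\<in>H. f g * \<phi> (inv g))" .
  moreover have "(\<Sum>g\<in>H. f g * \<phi> (inv\<^bsub>G\<lparr>carrier := H\<rparr>\<^esub> g)) = (\<Sum>g\<in>H. f g * \<phi> (inv g))"
    by (rule sum.cong) (simp_all add: m_inv_consistent[OF H])
  moreover have "(\<Sum>g\<in>carrier G. induced G H f g * \<phi> (inv g))
      = (\<Sum>g\<in>carrier G. (\<Sum>x\<in>carrier G. ?F (x \<otimes> g \<otimes> inv x)) * \<phi> (inv g)) / of_nat (card H)"
    by (subst sum_divide_distrib) (auto simp: induced_def intro!: sum.cong)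
  ultimately show ?thesis using card_pos by (simp add: ip_def)
qed

lemma constituents_induced_iff:
  assumes "subgroup H G" "\<mu> \<in> linear_characters (G\<lparr>carrier := H\<rparr>)"
  shows "\<phi> \<in> constituents G (induced G H \<mu>) \<longleftrightarrow> \<phi> \<in> Irr G \<and> ip (G\<lparr>carrier := H\<rparr>) \<mu> \<phi> \<noteq> 0"
proof -
  have "ip G (induced G H \<mu>) \<phi> = ip (G\<lparr>carrier := H\<rparr>) \<mu> \<phi>" if "\<phi> \<in> Irr G"
    by (rule frobenius_reciprocity[OF assms(1)
        characters_conj[OF subsetD[OF Irr_subset_characters that]]])
  then show ?thesis
    unfolding constituents_iff[OF induced_linear_character[OF assms]] by (cases "\<phi> \<in> Irr G") simp_all
qed

text \<open>If conjugation by \<open>g\<close> permutes the image of \<open>A\<close> and preserves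
  \<open>f\<close>, the operator of \<open>f\<close> commutes with \<open>\<rho> g\<close>; Schur's
  lemma finishes. It serves the inclusion of a normal subgroup as well as the embedding of one
  coordinate.\<close>

lemma acts_as_scalar_of_equivariant:
  assumes r: "irreducible_representation G n \<rho>"
    and A: "fin_group A" and \<iota>: "\<iota> \<in> hom A G"
    and eq: "\<And>g. g \<in> carrier G \<Longrightarrow> \<exists>\<pi>. bij_betw \<pi> (carrier A) (carrier A) \<and>
      (\<forall>a\<in>carrier A. g \<otimes> \<iota> a = \<iota> (\<pi> a) \<otimes> g \<and> f (\<pi> a) = f a)"
  obtains c where "acts_as_scalar A n (\<rho> \<circ> \<iota>) f c"
proof -
  interpret A: fin_group A by (rule A)
  have R: "representation G n \<rho>" using r by (simp add: irreducible_representation_def)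
  have \<iota>c: "\<iota> a \<in> carrier G" if "a \<in> carrier A" for a using \<iota> that by (auto simp: hom_def)
  define Y where "Y = msum n n (carrier A) (\<lambda>a. f a \<cdot>\<^sub>m (\<rho> \<circ> \<iota>) a)"
  have "\<rho> g * Y = Y * \<rho> g" if g: "g \<in> carrier G" for g
  proof -
    obtain \<pi> where \<pi>: "bij_betw \<pi> (carrier A) (carrier A)"
      "\<And>a. a \<in> carrier A \<Longrightarrow> g \<otimes> \<iota> a = \<iota> (\<pi> a) \<otimes> g"
      "\<And>a. a \<in> carrier A \<Longrightarrow> f (\<pi> a) = f a" using eq[OF g] by blast
    have \<pi>c: "\<pi> a \<in> carrier A" if "a \<in> carrier A" for a using \<pi>(1) that by (auto simp: bij_betw_def)
    have c: "f a \<cdot>\<^sub>m (\<rho> \<circ> \<iota>) a \<in> carrier_mat n n" if "a \<in> carrier A" for a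
      using rep_carrier[OF R \<iota>c[OF that]] by simp
    have "\<rho> g * Y = msum n n (carrier A) (\<lambda>a. \<rho> g * (f a \<cdot>\<^sub>m (\<rho> \<circ> \<iota>) a))"
      unfolding Y_def by (rule mult_msum[OF rep_carrier[OF R g] c])
    also have "\<dots> = msum n n (carrier A) (\<lambda>a. (f (\<pi> a) \<cdot>\<^sub>m (\<rho> \<circ> \<iota>) (\<pi> a)) * \<rho> g)"
    proof (rule msum_cong)
      fix a assume a: "a \<in> carrier A"
      have "\<rho> g * (f a \<cdot>\<^sub>m (\<rho> \<circ> \<iota>) a) = f a \<cdot>\<^sub>m \<rho> (g \<otimes> \<iota> a)"
        using rep_carrier[OF R g] rep_carrier[OF R \<iota>c[OF a]]
        by (simp add: rep_mult[OF R g \<iota>c[OF a]] mult_smult_distrib[of _ n n _ n])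
      also have "\<dots> = (f (\<pi> a) \<cdot>\<^sub>m (\<rho> \<circ> \<iota>) (\<pi> a)) * \<rho> g"
        using rep_carrier[OF R g] rep_carrier[OF R \<iota>c[OF \<pi>c[OF a]]]
        by (simp add: \<pi>(2,3)[OF a] rep_mult[OF R \<iota>c[OF \<pi>c[OF a]] g] mult_smult_assoc_mat[of _ n n _ n])
      finally show "\<rho> g * (f a \<cdot>\<^sub>m (\<rho> \<circ> \<iota>) a) = (f (\<pi> a) \<cdot>\<^sub>m (\<rho> \<circ> \<iota>) (\<pi> a)) * \<rho> g" .
    qed
    also have "\<dots> = msum n n (carrier A) (\<lambda>a. (f a \<cdot>\<^sub>m (\<rho> \<circ> \<iota>) a) * \<rho> g)"
    proof -
      have "(\<Sum>a\<in>carrier A. ((f (\<pi> a) \<cdot>\<^sub>m (\<rho> \<circ> \<iota>) (\<pi> a)) * \<rho> g) $$ (i, j))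
          = (\<Sum>a\<in>carrier A. ((f a \<cdot>\<^sub>m (\<rho> \<circ> \<iota>) a) * \<rho> g) $$ (i, j))" for i j
        by (rule sum.reindex_bij_betw[OF \<pi>(1), of "\<lambda>a. ((f a \<cdot>\<^sub>m (\<rho> \<circ> \<iota>) a) * \<rho> g) $$ (i, j)"])
      then show ?thesis by (simp add: msum_def)
    qed
    also have "\<dots> = Y * \<rho> g" unfolding Y_def by (rule msum_mult[OF rep_carrier[OF R g] c, symmetric])
    finally show ?thesis .
  qed
  moreover have "Y \<in> carrier_mat n n" by (simp add: Y_def)
  ultimately obtain c where "Y = c \<cdot>\<^sub>m 1\<^sub>m n" using schur_scalar[OF r] by metis
  then show ?thesis using that by (simp add: acts_as_scalar_def Y_def)
qed

lemma representation_comp_hom: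
  assumes R: "representation G n \<rho>" and "Group.group A" and \<iota>: "\<iota> \<in> hom A G"
  shows "representation A n (\<rho> \<circ> \<iota>)"
proof -
  interpret A: group A by (rule assms(2))
  have "\<iota> \<one>\<^bsub>A\<^esub> = \<one>" using hom_one[OF \<iota> assms(2) is_group] .
  then show ?thesis using R \<iota> unfolding A.representation_iff representation_iff
    by (auto simp: hom_def Pi_iff)
qed

text \<open>The class sums of the normal subgroup act as scalars; comparing their traces on two
  constituents of the restriction shows that these are conjugate.\<close>

theorem clifford:
  assumes \<phi>: "\<phi> \<in> Irr G" and N: "N \<lhd> G"
  obtains M where "set_mset M \<subseteq> Irr (G\<lparr>carrier := N\<rparr>)" "M \<noteq> {#}"
    "restrict \<phi> N = (\<lambda>b\<in>N. \<Sum>\<psi>\<in>#M. \<psi> b)"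
    "\<And>\<eta> \<psi>. \<eta> \<in># M \<Longrightarrow> \<psi> \<in># M \<Longrightarrow>
       \<exists>w\<in>carrier G. ip (G\<lparr>carrier := N\<rparr>) \<psi> (\<lambda>b. \<eta> (w \<otimes> b \<otimes> inv w)) \<noteq> 0"
proof -
  interpret N: normal N G by (rule N)
  have sN: "subgroup N G" by (rule N.subgroup_axioms)
  let ?N = "G\<lparr>carrier := N\<rparr>"
  interpret GN: fin_group ?N by (rule fin_group_subgroup[OF sN])
  have NG: "N \<subseteq> carrier G" by (rule N.subset)
  obtain n \<rho> where r: "\<phi> = character_of G \<rho>" "irreducible_representation G n \<rho>" "representation G n \<rho>"
    using \<phi> by (rule Irr_obtain)
  have id: "(\<lambda>x. x) \<in> hom ?N G" using NG by (auto simp: hom_def)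
  have RN: "representation ?N n \<rho>"
    using representation_comp_hom[OF r(3) GN.is_group id] by (simp add: comp_def)
  obtain M where M: "set_mset M \<subseteq> Irr ?N" "M \<noteq> {#}"
      "character_of ?N \<rho> = (\<lambda>b\<in>N. \<Sum>\<psi>\<in>#M. \<psi> b)"
      "\<And>f c \<psi>. acts_as_scalar ?N n \<rho> f c \<Longrightarrow> \<psi> \<in># M \<Longrightarrow> (\<Sum>b\<in>N. f b * \<psi> b) = c * \<psi> \<one>"
    using GN.decomposition[OF RN] by auto
  have res: "restrict \<phi> N = character_of ?N \<rho>"
    using NG unfolding r(1) by (auto simp: character_of_def fun_eq_iff)
  have conjN: "w \<otimes> b \<otimes> inv w \<in> N" if "w \<in> carrier G" "b \<in> N" for w b
    using N.inv_op_closed2 that by blast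
  have sumN: "(\<Sum>b\<in>N. F (w \<otimes> b \<otimes> inv w)) = (\<Sum>b\<in>N. F b)" if "w \<in> carrier G"
    for w and F :: "'a \<Rightarrow> complex"
    by (rule sum.reindex_bij_witness[of _ "\<lambda>b. inv w \<otimes> b \<otimes> w" "\<lambda>b. w \<otimes> b \<otimes> inv w"])
      (use that NG N.inv_op_closed1[OF that] conjN[OF that] in
        \<open>auto simp: m_assoc inv_mult_cancel subset_iff\<close>)
  show ?thesis
  proof (rule that[OF M(1,2)])
    show "restrict \<phi> N = (\<lambda>b\<in>N. \<Sum>\<psi>\<in>#M. \<psi> b)" using res M(3) by simp
  next
    fix \<eta> \<psi> assume \<eta>: "\<eta> \<in># M" and \<psi>: "\<psi> \<in># M"
    \<comment> \<open>The sum of all conjugates of \<eta>, taken at the inverse. It is invariant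
      under conjugation, hence acts as a scalar, and pairing it with \<psi> adds up the forms of
      \<psi> with the conjugates of \<eta>.\<close>
    define f where "f b = (\<Sum>w\<in>carrier G. \<eta> (w \<otimes> inv b \<otimes> inv w))" for b
    have f_conj: "f (w \<otimes> b \<otimes> inv w) = f b" if w: "w \<in> carrier G" and b: "b \<in> N" for w b
    proof -
      have bG: "b \<in> carrier G" using b NG by auto
      have "f (w \<otimes> b \<otimes> inv w) = (\<Sum>v\<in>carrier G. \<eta> ((v \<otimes> w) \<otimes> inv b \<otimes> inv (v \<otimes> w)))"
        unfolding f_def using w bG by (intro sum.cong) (auto simp: inv_mult_group m_assoc)
      also have "\<dots> = f b" unfolding f_def
        by (rule sum.reindex_bij_witness[of _ "\<lambda>v. v \<otimes> inv w" "\<lambda>v. v \<otimes> w"])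
          (use w in \<open>auto simp: m_assoc\<close>)
      finally show ?thesis .
    qed
    obtain c where c: "acts_as_scalar ?N n \<rho> f c"
    proof -
      have "\<exists>\<pi>. bij_betw \<pi> N N \<and> (\<forall>a\<in>N. g \<otimes> a = \<pi> a \<otimes> g \<and> f (\<pi> a) = f a)" if g: "g \<in> carrier G" for g
      proof (intro exI conjI)
        show "bij_betw (\<lambda>b. g \<otimes> b \<otimes> inv g) N N"
          by (rule bij_betw_byWitness[of _ "\<lambda>b. inv g \<otimes> b \<otimes> g"])
            (use g NG N.inv_op_closed1[OF g] conjN[OF g] in
              \<open>auto simp: m_assoc inv_mult_cancel subset_iff\<close>)
        show "\<forall>a\<in>N. g \<otimes> a = g \<otimes> a \<otimes> inv g \<otimes> g \<and> f (g \<otimes> a \<otimes> inv g) = f a"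
          using g NG f_conj by (auto simp: m_assoc subset_iff)
      qed
      then show ?thesis
        using acts_as_scalar_of_equivariant[OF r(2) GN.fin_group_axioms id, of f] that
        by (auto simp: comp_def)
    qed
    have \<eta>I: "\<eta> \<in> Irr ?N" using \<eta> M(1) by auto
    \<comment> \<open>The trace on the whole space computes \<open>c\<close>: each conjugate of
      \<eta> pairs with \<phi> as \<eta> does, so the result is a positive multiple of
      \<open>count M \<eta>\<close>.\<close>
    have "(\<Sum>b\<in>N. f b * \<phi> b) = (\<Sum>b\<in>N. f b * character_of ?N \<rho> b)"
      by (rule sum.cong) (simp_all add: res[symmetric])
    also have "\<dots> = c * of_nat n"
      using GN.acts_as_scalar_trace[OF RN c] by simp
    finally have "c * of_nat n = (\<Sum>b\<in>N. \<Sum>w\<in>carrier G. \<eta> (w \<otimes> inv b \<otimes> inv w) * \<phi> b)"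
      by (simp add: f_def sum_distrib_right)
    also have "\<dots> = (\<Sum>w\<in>carrier G. \<Sum>b\<in>N. \<eta> (w \<otimes> inv b \<otimes> inv w) * \<phi> b)" by (rule sum.swap)
    also have "\<dots> = (\<Sum>w\<in>carrier G. \<Sum>b\<in>N. \<eta> (inv b) * \<phi> b)"
    proof (rule sum.cong[OF refl])
      fix w assume w: "w \<in> carrier G"
      have "(\<Sum>b\<in>N. \<eta> (w \<otimes> inv b \<otimes> inv w) * \<phi> b)
          = (\<Sum>b\<in>N. \<eta> (inv (w \<otimes> b \<otimes> inv w)) * \<phi> (w \<otimes> b \<otimes> inv w))"
      proof (intro sum.cong[OF refl] arg_cong2[of _ _ _ _ "(*)"])
        fix b assume b: "b \<in> N"
        then have bG: "b \<in> carrier G" using NG by auto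
        show "\<eta> (w \<otimes> inv b \<otimes> inv w) = \<eta> (inv (w \<otimes> b \<otimes> inv w))"
          using w bG by (simp add: inv_mult_group m_assoc)
        show "\<phi> b = \<phi> (w \<otimes> b \<otimes> inv w)"
          using characters_conj[OF subsetD[OF Irr_subset_characters \<phi>] bG w] by simp
      qed
      also have "\<dots> = (\<Sum>b\<in>N. \<eta> (inv b) * \<phi> b)" by (rule sumN[OF w])
      finally show "(\<Sum>b\<in>N. \<eta> (w \<otimes> inv b \<otimes> inv w) * \<phi> b) = (\<Sum>b\<in>N. \<eta> (inv b) * \<phi> b)" .
    qed
    also have "\<dots> = of_nat (card (carrier G)) * (of_nat (card N) * ip ?N (restrict \<phi> N) \<eta>)"
    proof -
      have "(\<Sum>b\<in>N. \<eta> (inv b) * \<phi> b) = (\<Sum>b\<in>N. restrict \<phi> N b * \<eta> (inv\<^bsub>?N\<^esub> b))"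
        by (rule sum.cong) (simp_all add: m_inv_consistent[OF sN])
      then show ?thesis using GN.card_pos by (simp add: ip_def)
    qed
    also have "ip ?N (restrict \<phi> N) \<eta> = of_nat (count M \<eta>)"
      unfolding res M(3) using GN.ip_sum_mset_Irr[OF M(1) \<eta>I] by simp
    finally have cn: "c * of_nat n = of_nat (card (carrier G)) * (of_nat (card N) * of_nat (count M \<eta>))" .
    have "c * of_nat n \<noteq> 0"
      unfolding cn using card_pos GN.card_pos \<eta> by (simp add: count_eq_zero_iff)
    then have "c \<noteq> 0" by auto
    moreover have "\<psi> \<one> \<noteq> 0"
      using GN.characters_one_nonzero[of \<psi>] \<psi> M(1) GN.Irr_subset_characters by auto
    \<comment> \<open>The same nonzero scalar is seen by every constituent \<psi>, so some conjugate
      of \<eta> must have a nonzero form with it.\<close>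
    ultimately have "(\<Sum>b\<in>N. f b * \<psi> b) \<noteq> 0" using M(4)[OF c \<psi>] by simp
    moreover have "(\<Sum>b\<in>N. f b * \<psi> b)
        = (\<Sum>w\<in>carrier G. \<Sum>b\<in>N. \<psi> b * \<eta> (w \<otimes> inv b \<otimes> inv w))"
      by (subst sum.swap) (simp add: f_def sum_distrib_left mult.commute)
    ultimately have "\<exists>w\<in>carrier G. (\<Sum>b\<in>N. \<psi> b * \<eta> (w \<otimes> inv b \<otimes> inv w)) \<noteq> 0"
      by (metis (no_types, lifting) sum.neutral)
    then obtain w where w: "w \<in> carrier G" "(\<Sum>b\<in>N. \<psi> b * \<eta> (w \<otimes> inv b \<otimes> inv w)) \<noteq> 0"
      by blast
    have "(\<Sum>b\<in>N. \<psi> b * \<eta> (w \<otimes> inv\<^bsub>?N\<^esub> b \<otimes> inv w)) = (\<Sum>b\<in>N. \<psi> b * \<eta> (w \<otimes> inv b \<otimes> inv w))"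
      by (rule sum.cong) (simp_all add: m_inv_consistent[OF sN])
    then show "\<exists>w\<in>carrier G. ip ?N \<psi> (\<lambda>b. \<eta> (w \<otimes> b \<otimes> inv w)) \<noteq> 0"
      using w GN.card_pos by (auto simp: ip_def intro!: bexI[of _ w])
  qed
qed

text \<open>Every element of \<open>G\<close> acts on the image of \<open>A\<close> like an inner
  automorphism, so a class sum of \<open>A\<close> acts as a scalar. Its value is computed once on a
  constituent \<nu> of the pulled back representation and once from the trace after multiplying by a
  centralizing element; comparing the two gives the quotient.\<close>

theorem central_factor:
  assumes \<theta>: "\<theta> \<in> Irr G" and A: "fin_group A" and \<iota>: "\<iota> \<in> hom A G"
    and gen: "\<And>g. g \<in> carrier G \<Longrightarrow> \<exists>a\<in>carrier A. \<exists>c\<in>carrier G. g = \<iota> a \<otimes> c \<and>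
      (\<forall>x\<in>carrier A. \<iota> x \<otimes> c = c \<otimes> \<iota> x)"
  obtains \<nu> where "\<nu> \<in> Irr A"
    "\<And>a c. a \<in> carrier A \<Longrightarrow> c \<in> carrier G \<Longrightarrow> (\<And>x. x \<in> carrier A \<Longrightarrow> \<iota> x \<otimes> c = c \<otimes> \<iota> x) \<Longrightarrow>
       \<theta> (\<iota> a \<otimes> c) = \<nu> a / \<nu> \<one>\<^bsub>A\<^esub> * \<theta> c"
proof -
  interpret A: fin_group A by (rule A)
  interpret I: group_hom A G \<iota>
    using \<iota> by (simp add: group_hom_def group_hom_axioms_def A.is_group is_group)
  obtain n \<rho> where r: "\<theta> = character_of G \<rho>" "irreducible_representation G n \<rho>" "representation G n \<rho>"
    using \<theta> by (rule Irr_obtain)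
  have RA: "representation A n (\<rho> \<circ> \<iota>)" by (rule representation_comp_hom[OF r(3) A.is_group \<iota>])
  obtain M where M: "set_mset M \<subseteq> Irr A" "M \<noteq> {#}"
      "\<And>f c \<psi>. acts_as_scalar A n (\<rho> \<circ> \<iota>) f c \<Longrightarrow> \<psi> \<in># M \<Longrightarrow>
        (\<Sum>a\<in>carrier A. f a * \<psi> a) = c * \<psi> \<one>\<^bsub>A\<^esub>"
    by (rule A.decomposition[OF RA]) blast
  \<comment> \<open>Any constituent will do, since all of them see the same scalars.\<close>
  obtain \<nu> where \<nu>: "\<nu> \<in># M" using M(2) by blast
  show ?thesis
  proof (rule that)
    show \<nu>I: "\<nu> \<in> Irr A" using \<nu> M(1) by auto
    fix a z assume a: "a \<in> carrier A" and z: "z \<in> carrier G"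
      and cz: "\<And>x. x \<in> carrier A \<Longrightarrow> \<iota> x \<otimes> z = z \<otimes> \<iota> x"
    \<comment> \<open>The class sum of \<open>a\<close>, with each conjugate weighted by the order
      of the centralizer of \<open>a\<close>; the weights thus add up to
      \<open>card (carrier A)\<close>.\<close>
    define f :: "_ \<Rightarrow> complex" where
      "f y = (\<Sum>x\<in>carrier A. if x \<otimes>\<^bsub>A\<^esub> a \<otimes>\<^bsub>A\<^esub> inv\<^bsub>A\<^esub> x = y then 1 else 0)" for y
    have f_sum: "(\<Sum>y\<in>carrier A. f y * F y) = (\<Sum>x\<in>carrier A. F (x \<otimes>\<^bsub>A\<^esub> a \<otimes>\<^bsub>A\<^esub> inv\<^bsub>A\<^esub> x))" for F
    proof -
      have "(\<Sum>y\<in>carrier A. f y * F y)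
          = (\<Sum>x\<in>carrier A. \<Sum>y\<in>carrier A. if x \<otimes>\<^bsub>A\<^esub> a \<otimes>\<^bsub>A\<^esub> inv\<^bsub>A\<^esub> x = y then F y else 0)"
        by (subst sum.swap) (auto simp: f_def sum_distrib_right intro!: sum.cong)
      also have "\<dots> = (\<Sum>x\<in>carrier A. F (x \<otimes>\<^bsub>A\<^esub> a \<otimes>\<^bsub>A\<^esub> inv\<^bsub>A\<^esub> x))"
        using a A.finite_carrier by (intro sum.cong) (auto simp: sum.delta)
      finally show ?thesis .
    qed
    have f_conj: "f (v \<otimes>\<^bsub>A\<^esub> y \<otimes>\<^bsub>A\<^esub> inv\<^bsub>A\<^esub> v) = f y" if v: "v \<in> carrier A" and y: "y \<in> carrier A" for v y
    proof -
      have *: "v \<otimes>\<^bsub>A\<^esub> x \<otimes>\<^bsub>A\<^esub> a \<otimes>\<^bsub>A\<^esub> inv\<^bsub>A\<^esub> (v \<otimes>\<^bsub>A\<^esub> x) = v \<otimes>\<^bsub>A\<^esub> y \<otimes>\<^bsub>A\<^esub> inv\<^bsub>A\<^esub> v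
          \<longleftrightarrow> x \<otimes>\<^bsub>A\<^esub> a \<otimes>\<^bsub>A\<^esub> inv\<^bsub>A\<^esub> x = y" if x: "x \<in> carrier A" for x
      proof -
        have "v \<otimes>\<^bsub>A\<^esub> x \<otimes>\<^bsub>A\<^esub> a \<otimes>\<^bsub>A\<^esub> inv\<^bsub>A\<^esub> (v \<otimes>\<^bsub>A\<^esub> x) = v \<otimes>\<^bsub>A\<^esub> (x \<otimes>\<^bsub>A\<^esub> a \<otimes>\<^bsub>A\<^esub> inv\<^bsub>A\<^esub> x) \<otimes>\<^bsub>A\<^esub> inv\<^bsub>A\<^esub> v"
          using v x a by (simp add: A.inv_mult_group A.m_assoc)
        then show ?thesis using v x y a by simp
      qed
      have "f (v \<otimes>\<^bsub>A\<^esub> y \<otimes>\<^bsub>A\<^esub> inv\<^bsub>A\<^esub> v) = (\<Sum>x\<in>carrier A.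
          if v \<otimes>\<^bsub>A\<^esub> x \<otimes>\<^bsub>A\<^esub> a \<otimes>\<^bsub>A\<^esub> inv\<^bsub>A\<^esub> (v \<otimes>\<^bsub>A\<^esub> x) = v \<otimes>\<^bsub>A\<^esub> y \<otimes>\<^bsub>A\<^esub> inv\<^bsub>A\<^esub> v then 1 else 0)"
        unfolding f_def by (rule A.sum_left_mult[OF v, symmetric])
      also have "\<dots> = f y" unfolding f_def by (rule sum.cong) (simp_all add: *)
      finally show ?thesis .
    qed
    have eq: "\<exists>\<pi>. bij_betw \<pi> (carrier A) (carrier A) \<and>
        (\<forall>y\<in>carrier A. g \<otimes> \<iota> y = \<iota> (\<pi> y) \<otimes> g \<and> f (\<pi> y) = f y)" if g: "g \<in> carrier G" for g
    proof -
      obtain b d where bd: "b \<in> carrier A" "d \<in> carrier G" "g = \<iota> b \<otimes> d"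
        "\<And>x. x \<in> carrier A \<Longrightarrow> \<iota> x \<otimes> d = d \<otimes> \<iota> x" using gen[OF g] by blast
      show ?thesis
      proof (intro exI conjI ballI)
        show "bij_betw (\<lambda>y. b \<otimes>\<^bsub>A\<^esub> y \<otimes>\<^bsub>A\<^esub> inv\<^bsub>A\<^esub> b) (carrier A) (carrier A)"
          by (rule bij_betw_byWitness[of _ "\<lambda>y. inv\<^bsub>A\<^esub> b \<otimes>\<^bsub>A\<^esub> y \<otimes>\<^bsub>A\<^esub> b"])
            (use bd in \<open>auto simp: A.m_assoc A.inv_mult_cancel\<close>)
        fix y assume y: "y \<in> carrier A"
        have "\<iota> (b \<otimes>\<^bsub>A\<^esub> y \<otimes>\<^bsub>A\<^esub> inv\<^bsub>A\<^esub> b) \<otimes> g = \<iota> b \<otimes> (\<iota> y \<otimes> d)"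
          unfolding bd(3) using bd(1,2) y by (simp add: m_assoc inv_mult_cancel)
        also have "\<dots> = g \<otimes> \<iota> y"
          unfolding bd(3) bd(4)[OF y] using bd(1,2) y by (simp add: m_assoc)
        finally show "g \<otimes> \<iota> y = \<iota> (b \<otimes>\<^bsub>A\<^esub> y \<otimes>\<^bsub>A\<^esub> inv\<^bsub>A\<^esub> b) \<otimes> g" by simp
        show "f (b \<otimes>\<^bsub>A\<^esub> y \<otimes>\<^bsub>A\<^esub> inv\<^bsub>A\<^esub> b) = f y" by (rule f_conj[OF bd(1) y])
      qed
    qed
    obtain c where c: "acts_as_scalar A n (\<rho> \<circ> \<iota>) f c"
      using acts_as_scalar_of_equivariant[OF r(2) A \<iota> eq] by blast
    have "c * \<nu> \<one>\<^bsub>A\<^esub> = (\<Sum>x\<in>carrier A. \<nu> (x \<otimes>\<^bsub>A\<^esub> a \<otimes>\<^bsub>A\<^esub> inv\<^bsub>A\<^esub> x))"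
      using M(3)[OF c \<nu>] f_sum by simp
    also have "\<dots> = of_nat (card (carrier A)) * \<nu> a"
      using A.characters_conj[OF subsetD[OF A.Irr_subset_characters \<nu>I] a] by simp
    finally have 1: "c * \<nu> \<one>\<^bsub>A\<^esub> = of_nat (card (carrier A)) * \<nu> a" .
    \<comment> \<open>Expanded over the conjugates of \<open>a\<close>, all terms agree: conjugation
      by \<open>\<iota> x\<close> fixes \<open>z\<close>, so each one is
      \<open>\<theta> (\<iota> a \<otimes> z)\<close>.\<close>
    have "c * \<theta> z = mtrace (c \<cdot>\<^sub>m \<rho> z)"
      using z rep_carrier[OF r(3) z] by (simp add: r(1) character_of_eq mtrace_def sum_distrib_left)
    also have "c \<cdot>\<^sub>m \<rho> z = (c \<cdot>\<^sub>m 1\<^sub>m n) * \<rho> z"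
      using rep_carrier[OF r(3) z] by (simp add: mult_smult_assoc_mat[of _ n n _ n])
    also have "c \<cdot>\<^sub>m 1\<^sub>m n = msum n n (carrier A) (\<lambda>y. f y \<cdot>\<^sub>m (\<rho> \<circ> \<iota>) y)"
      using c by (simp add: acts_as_scalar_def)
    also have "\<dots> * \<rho> z = msum n n (carrier A) (\<lambda>y. f y \<cdot>\<^sub>m (\<rho> \<circ> \<iota>) y * \<rho> z)"
      by (rule msum_mult[OF rep_carrier[OF r(3) z]]) (simp add: rep_carrier[OF r(3)])
    also have "\<dots> = msum n n (carrier A) (\<lambda>y. f y \<cdot>\<^sub>m \<rho> (\<iota> y \<otimes> z))"
    proof (rule msum_cong)
      fix y assume y: "y \<in> carrier A"
      then show "f y \<cdot>\<^sub>m (\<rho> \<circ> \<iota>) y * \<rho> z = f y \<cdot>\<^sub>m \<rho> (\<iota> y \<otimes> z)"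
        using rep_carrier[OF r(3) z] rep_carrier[OF r(3) I.hom_closed[OF y]]
        by (simp add: rep_mult[OF r(3) I.hom_closed[OF y] z] mult_smult_assoc_mat[of _ n n _ n])
    qed
    also have "mtrace \<dots> = (\<Sum>y\<in>carrier A. mtrace (f y \<cdot>\<^sub>m \<rho> (\<iota> y \<otimes> z)))"
      by (rule mtrace_msum) (use rep_carrier[OF r(3)] z in auto)
    also have "\<dots> = (\<Sum>y\<in>carrier A. f y * \<theta> (\<iota> y \<otimes> z))"
    proof (rule sum.cong[OF refl])
      fix y assume y: "y \<in> carrier A"
      then have yz: "\<iota> y \<otimes> z \<in> carrier G" using z by simp
      show "mtrace (f y \<cdot>\<^sub>m \<rho> (\<iota> y \<otimes> z)) = f y * \<theta> (\<iota> y \<otimes> z)"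
        using yz rep_carrier[OF r(3) yz] by (simp add: r(1) character_of_eq mtrace_def sum_distrib_left)
    qed
    also have "\<dots> = (\<Sum>x\<in>carrier A. \<theta> (\<iota> (x \<otimes>\<^bsub>A\<^esub> a \<otimes>\<^bsub>A\<^esub> inv\<^bsub>A\<^esub> x) \<otimes> z))"
      by (rule f_sum)
    also have "\<dots> = (\<Sum>x\<in>carrier A. \<theta> (\<iota> a \<otimes> z))"
    proof (rule sum.cong[OF refl])
      fix x assume x: "x \<in> carrier A"
      have "\<iota> (x \<otimes>\<^bsub>A\<^esub> a \<otimes>\<^bsub>A\<^esub> inv\<^bsub>A\<^esub> x) \<otimes> z = \<iota> x \<otimes> \<iota> a \<otimes> (\<iota> (inv\<^bsub>A\<^esub> x) \<otimes> z)"
        using x a z by (simp add: m_assoc)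
      also have "\<dots> = \<iota> x \<otimes> (\<iota> a \<otimes> z) \<otimes> inv (\<iota> x)"
        unfolding cz[OF A.inv_closed[OF x]] using x a z by (simp add: m_assoc)
      finally show "\<theta> (\<iota> (x \<otimes>\<^bsub>A\<^esub> a \<otimes>\<^bsub>A\<^esub> inv\<^bsub>A\<^esub> x) \<otimes> z) = \<theta> (\<iota> a \<otimes> z)"
        using characters_conj[OF subsetD[OF Irr_subset_characters \<theta>]] x a z by simp
    qed
    finally have 2: "c * \<theta> z = of_nat (card (carrier A)) * \<theta> (\<iota> a \<otimes> z)" by simp
    have nz: "\<nu> \<one>\<^bsub>A\<^esub> \<noteq> 0"
      by (rule A.characters_one_nonzero[OF subsetD[OF A.Irr_subset_characters \<nu>I]])
    have "of_nat (card (carrier A)) * (\<theta> (\<iota> a \<otimes> z) * \<nu> \<one>\<^bsub>A\<^esub>) = of_nat (card (carrier A)) * (\<nu> a * \<theta> z)"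
      using 1 2 by (metis (no_types, opaque_lifting) mult.assoc mult.commute)
    then show "\<theta> (\<iota> a \<otimes> z) = \<nu> a / \<nu> \<one>\<^bsub>A\<^esub> * \<theta> z"
      using nz A.card_pos by (simp add: field_simps)
  qed
qed

end

section \<open>Separating a cyclic word from all shifts of another\<close>

lemma shift_bij:
  fixes p k :: nat
  assumes "p > 0"
  shows "bij_betw (\<lambda>i. (i + k) mod p) {..<p} {..<p}"
proof (rule bij_betw_byWitness[of _ "\<lambda>i. (i + (p - k mod p)) mod p"])
  \<comment> \<open>The offset \<open>p - k mod p\<close> undoes a shift by \<open>k\<close>. For
    \<open>k\<close> divisible by \<open>p\<close> it is \<open>p\<close> instead of 0, which the
    outer \<open>mod p\<close> absorbs.\<close>
  have *: "(i + k + (p - k mod p)) mod p = i mod p" for i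
  proof -
    have "k + (p - k mod p) = p * (k div p) + p"
      using assms mod_less_divisor[of p k] mult_div_mod_eq[of p k] by linarith
    then have "i + k + (p - k mod p) = i + (k div p + 1) * p" by (simp add: algebra_simps)
    then show ?thesis by (metis mod_mult_self1)
  qed
  show "\<forall>i\<in>{..<p}. ((i + k) mod p + (p - k mod p)) mod p = i"
  proof
    fix i assume i: "i \<in> {..<p}"
    have "((i + k) mod p + (p - k mod p)) mod p = (i + k + (p - k mod p)) mod p"
      by (rule mod_add_left_eq)
    then show "((i + k) mod p + (p - k mod p)) mod p = i" using *[of i] i by (simp only: lessThan_iff mod_less)
  qed
  show "\<forall>i\<in>{..<p}. ((i + (p - k mod p)) mod p + k) mod p = i"
  proof
    fix i assume i: "i \<in> {..<p}"
    have "((i + (p - k mod p)) mod p + k) mod p = (i + (p - k mod p) + k) mod p"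
      by (rule mod_add_left_eq)
    also have "i + (p - k mod p) + k = i + k + (p - k mod p)" by simp
    finally show "((i + (p - k mod p)) mod p + k) mod p = i" using *[of i] i by (simp only: lessThan_iff mod_less)
  qed
qed (use assms in auto)

text \<open>A nonzero \<open>d\<close> is invertible modulo the prime \<open>p\<close>, so its
  multiples lead from any position to every other. Consequently a proper nonempty set of positions
  has \<open>p\<close> different rotations.\<close>

lemma shift_invariant_full:
  fixes p d :: nat
  assumes p: "Factorial_Ring.prime p" and d: "0 < d" "d < p"
    and T: "T \<subseteq> {..<p}" "T \<noteq> {}" and inv: "\<And>i. i \<in> T \<Longrightarrow> (i + d) mod p \<in> T"
  shows "T = {..<p}"
proof -
  obtain i where i: "i \<in> T" "i < p" using T by auto
  have iter: "(i + m * d) mod p \<in> T" for m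
  proof (induction m)
    case (Suc m)
    have "(i + Suc m * d) mod p = ((i + m * d) mod p + d) mod p"
      unfolding mod_add_left_eq by (simp add: algebra_simps)
    then show ?case using inv[OF Suc] by simp
  qed (use i in simp)
  have "coprime d p"
    using p d by (metis coprime_commute nat_dvd_not_less prime_imp_coprime)
  then obtain x where x: "[d * x = 1] (mod p)" using cong_solve_coprime_nat[of d p] by auto
  have "j \<in> T" if "j < p" for j
  proof -
    \<comment> \<open>\<open>x\<close> inverts \<open>d\<close>, and the difference from
      \<open>i\<close> to \<open>j\<close> is written \<open>j + p - i\<close> to stay in the
      natural numbers.\<close>
    have "[i + (x * (j + p - i)) * d = i + 1 * (j + p - i)] (mod p)"
      using cong_scalar_right[OF x, of "j + p - i"]
      by (intro cong_add) (simp_all add: mult_ac)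
    then have "(i + (x * (j + p - i)) * d) mod p = j"
      using that i by (simp add: cong_def)
    then show ?thesis using iter by metis
  qed
  then show ?thesis using T by auto
qed

text \<open>Each position \<open>i\<close> offers one value \<open>e i \<noteq> \<theta> i\<close>. If some value \<open>c\<close> of \<open>\<eta>\<close> is separated from
  \<open>\<theta>\<close> by every shift, the constant choice \<open>c\<close> works. Otherwise every value is taken equally often by
  \<open>\<theta>\<close> and \<open>\<eta>\<close>; then \<open>c = \<eta> 0\<close> fails for one shift only, which is repaired at a position \<open>i0\<close>. The
  shifts that were covered by \<open>i0\<close> alone are recovered from positions with \<open>\<theta> y = c\<close>, each
  of which serves at most one such shift because \<open>p\<close> is prime.\<close>

lemma separating_choice:
  fixes p :: nat and \<theta> \<eta> :: "nat \<Rightarrow> 'x"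
  assumes p: "Factorial_Ring.prime p"
    and ne: "\<And>k. k < p \<Longrightarrow> \<exists>i<p. \<theta> i \<noteq> \<eta> ((i + k) mod p)"
  obtains e where "\<And>k. k < p \<Longrightarrow> \<exists>i<p. e i \<noteq> \<theta> i \<and> \<eta> ((i + k) mod p) = e i"
proof -
  have p0: "p > 0" using p prime_gt_0_nat by blast
  \<comment> \<open>The constant choice \<open>c\<close> handles shift \<open>k\<close> exactly when
    \<open>P c k\<close> is not contained in \<open>T c\<close>.\<close>
  define P where "P c k = {i. i < p \<and> \<eta> ((i + k) mod p) = c}" for c k
  define T where "T c = {i. i < p \<and> \<theta> i = c}" for c
  have fin: "finite (P c k)" "finite (T c)" for c k by (simp_all add: P_def T_def)
  have cardP: "card (P c k) = card (P c 0)" for c k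
  proof -
    have "bij_betw (\<lambda>i. (i + k) mod p) (P c k) (P c 0)"
    proof (rule bij_betw_imageI)
      show "inj_on (\<lambda>i. (i + k) mod p) (P c k)"
        by (rule inj_on_subset[OF bij_betw_imp_inj_on[OF shift_bij[OF p0]]]) (auto simp: P_def)
      show "(\<lambda>i. (i + k) mod p) ` P c k = P c 0"
      proof
        show "(\<lambda>i. (i + k) mod p) ` P c k \<subseteq> P c 0" using p0 by (auto simp: P_def)
        show "P c 0 \<subseteq> (\<lambda>i. (i + k) mod p) ` P c k"
        proof
          fix j assume j: "j \<in> P c 0"
          then have "j \<in> (\<lambda>i. (i + k) mod p) ` {..<p}"
            using bij_betw_imp_surj_on[OF shift_bij[OF p0, of k]] by (simp add: P_def)
          then obtain i where "i < p" "j = (i + k) mod p" by auto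
          then show "j \<in> (\<lambda>i. (i + k) mod p) ` P c k" using j by (auto simp: P_def)
        qed
      qed
    qed
    then show ?thesis by (rule bij_betw_same_card)
  qed
  show ?thesis
  proof (cases "\<exists>c. \<forall>k<p. \<not> P c k \<subseteq> T c")
    case True
    then obtain c where c: "\<And>k. k < p \<Longrightarrow> \<not> P c k \<subseteq> T c" by blast
    show ?thesis
    proof (rule that[of "\<lambda>_. c"])
      fix k assume "k < p"
      then obtain i where "i \<in> P c k" "i \<notin> T c" using c by blast
      then show "\<exists>i<p. c \<noteq> \<theta> i \<and> \<eta> ((i + k) mod p) = c" by (auto simp: P_def T_def)
    qed
  next
    case False
    then have sub: "\<exists>k<p. P c k \<subseteq> T c" for c by blast
    have le: "card (P c 0) \<le> card (T c)" for c
      using sub[of c] card_mono[OF fin(2)] cardP by metis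
    \<comment> \<open>As \<open>c\<close> varies, both families partition the \<open>p\<close>
      positions; sizes that are bounded termwise and have equal totals coincide.\<close>
    have eqc: "card (P c 0) = card (T c)" for c
    proof -
      define I where "I = insert c (\<eta> ` {..<p} \<union> \<theta> ` {..<p})"
      have finI: "finite I" by (simp add: I_def)
      have "(\<Sum>c\<in>I. card (P c 0)) = card (\<Union>c\<in>I. P c 0)"
        by (subst card_UN_disjoint) (auto simp: finI fin, auto simp: P_def)
      also have "(\<Union>c\<in>I. P c 0) = {..<p}" by (auto simp: P_def I_def)
      also have "{..<p} = (\<Union>c\<in>I. T c)" by (auto simp: T_def I_def)
      also have "card \<dots> = (\<Sum>c\<in>I. card (T c))"
        by (subst card_UN_disjoint) (auto simp: finI fin, auto simp: T_def)
      finally show ?thesis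
        by (rule sum_mono_inv) (use le finI in \<open>auto simp: I_def\<close>)
    qed
    define c where "c = \<eta> 0"
    obtain k0 where k0: "k0 < p" "P c k0 \<subseteq> T c" using sub by blast
    have Pk0: "P c k0 = T c" using card_subset_eq[OF fin(2) k0(2)] cardP eqc by metis
    have "0 \<in> P c 0" using p0 by (simp add: P_def c_def)
    then have "card (P c 0) > 0" using fin card_gt_0_iff by blast
    then have Pne: "P c k \<noteq> {}" for k using cardP by (metis card.empty less_irrefl)
    have Tnf: "T c \<noteq> {..<p}"
    proof
      assume "T c = {..<p}"
      then have "P c 0 = {..<p}"
        using eqc[of c] card_subset_eq[of "{..<p}" "P c 0"] by (auto simp: P_def)
      then have "\<theta> i = \<eta> ((i + 0) mod p)" if "i < p" for i
      proof -
        have "i \<in> P c 0" "i \<in> T c" using \<open>P c 0 = {..<p}\<close> \<open>T c = {..<p}\<close> that by simp_all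
        then show ?thesis using that by (simp add: P_def T_def)
      qed
      then show False using ne[OF p0] by blast
    qed
    have Pnf: "P c k \<noteq> {..<p}" for k
    proof
      assume "P c k = {..<p}"
      then have "card (T c) = card {..<p}" using cardP eqc by metis
      then have "T c = {..<p}" by (intro card_subset_eq) (auto simp: T_def)
      then show False using Tnf by simp
    qed
    \<comment> \<open>Equal sets for two shifts would be invariant under rotation by
      \<open>k' - k\<close>, impossible for a proper nonempty set. So \<open>k0\<close> is the only
      shift whose set lies inside \<open>T c\<close>.\<close>
    have inj_less: False if kk: "k < k'" "k' < p" "P c k = P c k'" for k k'
    proof -
      have "P c k = {..<p}"
      proof (rule shift_invariant_full[OF p, of "k' - k"])
        fix i assume "i \<in> P c k"
        then have "i < p" "\<eta> ((i + k') mod p) = c" using kk by (auto simp: P_def)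
        moreover have "((i + (k' - k)) mod p + k) mod p = (i + k') mod p"
          using kk by (simp add: mod_add_left_eq)
        ultimately show "(i + (k' - k)) mod p \<in> P c k" using p0 by (simp add: P_def)
      qed (use kk Pne in \<open>auto simp: P_def\<close>)
      then show False using Pnf by simp
    qed
    have inj: "k = k'" if "k < p" "k' < p" "P c k = P c k'" for k k'
      using inj_less[of k k'] inj_less[of k' k] that by (metis linorder_neqE_nat)
    obtain i0 where i0: "i0 < p" "\<theta> i0 \<noteq> \<eta> ((i0 + k0) mod p)" using ne[OF k0(1)] by blast
    have i0T: "i0 \<notin> T c"
    proof
      assume "i0 \<in> T c"
      then have "i0 \<in> P c k0" "\<theta> i0 = c" using Pk0 by (auto simp: T_def)
      then show False using i0 by (simp add: P_def)
    qed
    \<comment> \<open>The shifts that value \<open>c\<close> handles at \<open>i0\<close> alone: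
      since sizes agree, \<open>P c k\<close> is \<open>T c\<close> with one \<open>y\<close>
      exchanged for \<open>i0\<close>.\<close>
    define Q where "Q y k \<longleftrightarrow> k < p \<and> P c k = insert i0 (T c - {y})" for y k
    \<comment> \<open>Position \<open>i0\<close> is spent on \<open>k0\<close>. The positions
      \<open>y\<close> in \<open>T c\<close> cannot use the value \<open>c\<close>, so they are free
      for the shifts that relied on \<open>i0\<close>; the remaining positions keep
      \<open>c\<close>.\<close>
    define e where "e i = (if i = i0 then \<eta> ((i0 + k0) mod p)
      else if i \<in> T c \<and> (\<exists>k. Q i k) then \<eta> ((i + (SOME k. Q i k)) mod p) else c)" for i
    show ?thesis
    proof (rule that[of e])
      fix k assume k: "k < p"
      show "\<exists>i<p. e i \<noteq> \<theta> i \<and> \<eta> ((i + k) mod p) = e i"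
      proof (cases "k = k0")
        case True
        then show ?thesis using i0 by (auto simp: e_def intro!: exI[of _ i0])
      next
        case False
        have neq: "P c k \<noteq> T c" using False inj[OF k k0(1)] Pk0 by auto
        show ?thesis
        proof (cases "\<exists>j\<in>P c k. j \<notin> T c \<and> j \<noteq> i0")
          case True
          then obtain j where "j \<in> P c k" "j \<notin> T c" "j \<noteq> i0" by blast
          then show ?thesis by (intro exI[of _ j]) (auto simp: e_def P_def T_def)
        next
          case no: False
          have cards: "card (P c k) = card (T c)" using cardP eqc by metis
          have "\<not> P c k \<subseteq> T c" using card_subset_eq[OF fin(2) _ cards] neq by blast
          then have i0P: "i0 \<in> P c k" using no by blast
          have "\<not> T c \<subseteq> P c k" using card_subset_eq[OF fin(1) _ cards[symmetric]] neq by blast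
          then obtain y where y: "y \<in> T c" "y \<notin> P c k" by blast
          have "P c k \<subseteq> insert i0 (T c - {y})" using no y by blast
          moreover have "card (insert i0 (T c - {y})) = card (P c k)"
          proof -
            have "card (insert i0 (T c - {y})) = Suc (card (T c - {y}))"
              using i0T fin(2)[of c] by (intro card_insert_disjoint) auto
            then show ?thesis using card_Suc_Diff1[OF fin(2) y(1)] cards by simp
          qed
          ultimately have "P c k = insert i0 (T c - {y})"
            using card_subset_eq[of "insert i0 (T c - {y})" "P c k"] fin(2) by simp
          then have Q: "Q y k" using k by (simp add: Q_def)
          then have "Q y (SOME k. Q y k)" by (rule someI)
          \<comment> \<open>\<open>Q y k\<close> fixes the set \<open>P c k\<close>, which in turn
            fixes \<open>k\<close>; no position is claimed by two shifts.\<close>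
          then have "(SOME k. Q y k) = k" using Q inj unfolding Q_def by metis
          then have ey: "e y = \<eta> ((y + k) mod p)" using y i0T Q by (auto simp: e_def)
          have "\<theta> y = c" "y < p" using y by (auto simp: T_def)
          moreover have "\<eta> ((y + k) mod p) \<noteq> c" using y \<open>y < p\<close> by (simp add: P_def)
          ultimately show ?thesis using ey by (intro exI[of _ y]) simp
        qed
      qed
    qed
  qed
qed

section \<open>Twisting by the characters of a quotient of prime order\<close>

lemma sum_roots_of_unity_powers:
  fixes p d :: nat
  assumes p: "p > 0"
  defines "\<omega> \<equiv> cis (2 * pi / real p)"
  shows "\<omega> ^ d = 1 \<longleftrightarrow> p dvd d"
    and "(\<Sum>j<p. \<omega> ^ (j * d)) = (if p dvd d then of_nat p else 0)"
proof -
  have \<omega>p: "\<omega> ^ p = 1" using p by (simp add: \<omega>_def DeMoivre)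
  have "\<omega> ^ d = \<omega> ^ (d mod p)"
  proof -
    have "\<omega> ^ d = \<omega> ^ (p * (d div p) + d mod p)" by simp
    also have "\<dots> = \<omega> ^ (d mod p)" by (simp only: power_add power_mult \<omega>p power_one mult_1)
    finally show ?thesis .
  qed
  moreover have "\<omega> ^ (d mod p) = 1 \<longleftrightarrow> d mod p = 0"
  proof
    assume 1: "\<omega> ^ (d mod p) = 1"
    have "inj_on (\<lambda>k. cis (2 * pi * real k / real p)) {..<p}"
      using bij_betw_roots_unity[OF p] by (rule bij_betw_imp_inj_on)
    moreover have "cis (2 * pi * real (d mod p) / real p) = cis (2 * pi * real 0 / real p)"
      using 1 by (simp add: \<omega>_def DeMoivre mult.commute mult.left_commute)
    ultimately show "d mod p = 0" using p by (simp add: inj_on_def)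
  qed simp
  ultimately show *: "\<omega> ^ d = 1 \<longleftrightarrow> p dvd d" by (simp add: dvd_eq_mod_eq_0)
  show "(\<Sum>j<p. \<omega> ^ (j * d)) = (if p dvd d then of_nat p else 0)"
  proof (cases "p dvd d")
    case True
    then have "\<omega> ^ (j * d) = 1" for j using * by (metis mult.commute power_mult power_one)
    then show ?thesis using True by simp
  next
    case False
    have "(\<Sum>j<p. \<omega> ^ (j * d)) = (\<Sum>j<p. (\<omega> ^ d) ^ j)"
      by (simp add: power_mult[symmetric] mult.commute)
    also have "\<dots> = ((\<omega> ^ d) ^ p - 1) / (\<omega> ^ d - 1)"
      using False * by (intro geometric_sum) simp
    also have "(\<omega> ^ d) ^ p = 1" using \<omega>p by (metis mult.commute power_mult power_one)
    finally show ?thesis using False by simp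
  qed
qed

context Group.group begin

text \<open>Multiplying \<open>\<rho> g\<close> by the nonzero scalar \<open>\<mu> g\<close> leaves
  the invariant subspaces unchanged.\<close>

lemma linear_mult_Irr:
  assumes \<mu>: "\<mu> \<in> linear_characters G" and \<chi>: "\<chi> \<in> Irr G"
  shows "char_mult G \<mu> \<chi> \<in> Irr G"
proof -
  obtain n \<rho> where r: "\<chi> = character_of G \<rho>" "irreducible_representation G n \<rho>" "representation G n \<rho>"
    using \<chi> by (rule Irr_obtain)
  have \<mu>1: "\<mu> \<one> = 1" and \<mu>m: "\<And>g h. g \<in> carrier G \<Longrightarrow> h \<in> carrier G \<Longrightarrow> \<mu> (g \<otimes> h) = \<mu> g * \<mu> h"
    using \<mu> unfolding linear_characters_iff by auto
  define \<sigma> where "\<sigma> g = \<mu> g \<cdot>\<^sub>m \<rho> g" for g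
  have S: "representation G n \<sigma>"
    unfolding representation_iff
  proof (intro conjI ballI)
    fix g h assume g: "g \<in> carrier G" and h: "h \<in> carrier G"
    show "\<sigma> (g \<otimes> h) = \<sigma> g * \<sigma> h"
      using rep_carrier[OF r(3) g] rep_carrier[OF r(3) h] g h
      by (intro eq_matI) (auto simp: \<sigma>_def \<mu>m rep_mult[OF r(3)] scalar_prod_def sum_distrib_left mult_ac)
  next
    show "\<sigma> \<one> = 1\<^sub>m n" by (rule eq_matI) (auto simp: \<sigma>_def \<mu>1 rep_one[OF r(3)])
  qed (use rep_carrier[OF r(3)] rep_dim_pos[OF r(3)] in \<open>auto simp: \<sigma>_def\<close>)
  have "irreducible_representation G n \<sigma>"
    unfolding irreducible_representation_def
  proof (intro conjI S allI impI)
    fix U :: "complex vec set"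
    assume U: "VectorSpace.subspace class_ring U (module_vec TYPE(complex) n)"
      and inv: "\<forall>g\<in>carrier G. \<forall>u\<in>U. \<sigma> g *\<^sub>v u \<in> U"
    have sm: "submodule class_ring U (module_vec TYPE(complex) n)"
      using U by (simp add: VectorSpace.subspace_def)
    have sc: "c \<cdot>\<^sub>v u \<in> U" if "u \<in> U" for c u
      using submodule.smult_closed[OF sm, of c u] that by (simp add: module_vec_simps class_ring_simps)
    have Uc: "U \<subseteq> carrier_vec n" using submodule.subset[OF sm] by (simp add: module_vec_simps)
    have "\<rho> g *\<^sub>v u \<in> U" if g: "g \<in> carrier G" and u: "u \<in> U" for g u
    proof -
      have "\<mu> (inv g) \<cdot>\<^sub>v (\<sigma> g *\<^sub>v u) = (\<mu> (inv g) * \<mu> g) \<cdot>\<^sub>v (\<rho> g *\<^sub>v u)"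
        using u Uc rep_carrier[OF r(3) g]
        by (intro eq_vecI) (auto simp: \<sigma>_def row_smult scalar_prod_def sum_distrib_left mult_ac)
      also have "\<mu> (inv g) * \<mu> g = 1" using linear_character_inv[OF \<mu> g] by (simp add: mult.commute)
      finally have "\<rho> g *\<^sub>v u = \<mu> (inv g) \<cdot>\<^sub>v (\<sigma> g *\<^sub>v u)" by simp
      then show ?thesis using sc inv g u by simp
    qed
    then show "U = {0\<^sub>v n} \<or> U = carrier_vec n"
      using r(2) U by (auto simp: irreducible_representation_def)
  qed
  moreover have "char_mult G \<mu> \<chi> = character_of G \<sigma>"
  proof
    fix g show "char_mult G \<mu> \<chi> g = character_of G \<sigma> g"
    proof (cases "g \<in> carrier G")
      case True
      then show ?thesis using rep_carrier[OF r(3) True]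
        by (simp add: char_mult_def r(1) character_of_eq mtrace_def \<sigma>_def sum_distrib_left)
    qed (simp add: char_mult_def character_of_def)
  qed
  ultimately show ?thesis by (auto simp: Irr_def)
qed

end

text \<open>\<open>\<delta>\<close> encodes a homomorphism to the integers modulo \<open>p\<close>
  with kernel \<open>B\<close> by natural representatives, of which only the residue is meaningful.
  The index of \<open>B\<close> is thus 1 or \<open>p\<close>.\<close>

locale cyclic_extension = fin_group G for G :: "('a, 'm) monoid_scheme" (structure) +
  fixes B :: "'a set" and p :: nat and \<delta> :: "'a \<Rightarrow> nat"
  assumes normal: "B \<lhd> G" and prime: "Factorial_Ring.prime p"
    and \<delta>_mult: "x \<in> carrier G \<Longrightarrow> y \<in> carrier G \<Longrightarrow> \<delta> (x \<otimes> y) mod p = (\<delta> x + \<delta> y) mod p"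
    and B_iff: "x \<in> carrier G \<Longrightarrow> x \<in> B \<longleftrightarrow> p dvd \<delta> x"
begin

definition \<omega> :: complex where "\<omega> = cis (2 * pi / real p)"

text \<open>The inflations of the powers of one linear character of the quotient by
  \<open>B\<close>.\<close>

definition lam :: "nat \<Rightarrow> 'a \<Rightarrow> complex" where
  "lam j = (\<lambda>g\<in>carrier G. \<omega> ^ (j * \<delta> g))"

lemma p_pos: "p > 0" using prime prime_gt_0_nat by blast

lemma \<omega>_power_eq: "a mod p = b mod p \<Longrightarrow> \<omega> ^ (j * a) = \<omega> ^ (j * b)"
proof -
  have \<omega>p: "\<omega> ^ p = 1" using sum_roots_of_unity_powers(1)[OF p_pos, of p] by (simp add: \<omega>_def)
  have m: "\<omega> ^ (j * a) = \<omega> ^ (j * (a mod p))" for a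
  proof -
    have "j * a = p * (j * (a div p)) + j * (a mod p)"
      by (metis distrib_left mult.left_commute mult_div_mod_eq)
    then show ?thesis by (simp only: power_add power_mult[of \<omega> p] \<omega>p power_one mult_1)
  qed
  assume "a mod p = b mod p"
  then show ?thesis using m by metis
qed

lemma B_subgroup: "subgroup B G"
  using normal by (rule normal_imp_subgroup)

lemma lam_mult: "x \<in> carrier G \<Longrightarrow> y \<in> carrier G \<Longrightarrow> lam j (x \<otimes> y) = lam j x * lam j y"
  using \<omega>_power_eq[OF \<delta>_mult, of x y j] by (simp add: lam_def power_add distrib_left)

lemma lam_B: "b \<in> B \<Longrightarrow> lam j b = 1"
  using B_iff[of b] subgroup.mem_carrier[OF B_subgroup, of b] \<omega>_power_eq[of "\<delta> b" 0 j]
  by (simp add: lam_def)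

lemma lam_linear: "lam j \<in> linear_characters G"
  unfolding linear_characters_iff
  using lam_mult lam_B[OF subgroup.one_closed[OF B_subgroup]] by (auto simp: lam_def)

text \<open>By primality \<open>j\<close> is invertible modulo \<open>p\<close>, so the kernel of
  \<open>lam j\<close> is exactly \<open>B\<close>. This is why a character fixed by a twist
  vanishes off \<open>B\<close>.\<close>

lemma lam_eq_1_iff:
  assumes "0 < j" "j < p" "g \<in> carrier G"
  shows "lam j g = 1 \<longleftrightarrow> g \<in> B"
proof -
  have "lam j g = 1 \<longleftrightarrow> p dvd j * \<delta> g"
    using sum_roots_of_unity_powers(1)[OF p_pos] assms(3) by (simp add: lam_def \<omega>_def)
  also have "\<dots> \<longleftrightarrow> p dvd \<delta> g"
    using prime_dvd_mult_iff[OF prime] assms(1,2) by (auto dest: nat_dvd_not_less)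
  finally show ?thesis using B_iff[OF assms(3)] by simp
qed

text \<open>\<open>lam j\<close> is constant on cosets of \<open>B\<close>, so evaluating it at an
  arbitrary representative defines a character of the quotient.\<close>

lemma lam_inflation:
  obtains \<beta> where "\<beta> \<in> characters (G Mod B)" "inflation G B \<beta> = lam j"
proof -
  interpret N: normal B G by (rule normal)
  interpret Q: group "G Mod B" by (rule N.factorgroup_is_group)
  define \<beta> where "\<beta> = (\<lambda>X\<in>carrier (G Mod B). lam j (SOME x. x \<in> X))"
  have \<beta>: "\<beta> (B #> x) = lam j x" if x: "x \<in> carrier G" for x
  proof -
    have "x \<in> B #> x" by (rule rcos_self[OF x B_subgroup])
    then have "(SOME y. y \<in> B #> x) \<in> B #> x" by (rule someI)
    then obtain b where b: "b \<in> B" "(SOME y. y \<in> B #> x) = b \<otimes> x" by (auto simp: r_coset_def)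
    have "B #> x \<in> carrier (G Mod B)" using x by (auto simp: FactGroup_def RCOSETS_def)
    then show ?thesis
      using b x lam_B lam_mult subgroup.mem_carrier[OF B_subgroup b(1)] by (simp add: \<beta>_def)
  qed
  have "\<beta> \<in> linear_characters (G Mod B)"
    unfolding Q.linear_characters_iff
  proof (intro conjI ballI)
    show "\<beta> \<in> extensional (carrier (G Mod B))" by (simp add: \<beta>_def)
    have "\<one>\<^bsub>G Mod B\<^esub> = B #> \<one>" using coset_mult_one[OF N.subset] by (simp add: FactGroup_def)
    then show "\<beta> \<one>\<^bsub>G Mod B\<^esub> = 1"
      using \<beta>[OF one_closed] lam_B[OF subgroup.one_closed[OF B_subgroup]] by simp
    fix X Y assume "X \<in> carrier (G Mod B)" "Y \<in> carrier (G Mod B)"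
    then obtain x y where xy: "x \<in> carrier G" "X = B #> x" "y \<in> carrier G" "Y = B #> y"
      by (auto simp: FactGroup_def RCOSETS_def)
    have "X \<otimes>\<^bsub>G Mod B\<^esub> Y = B #> (x \<otimes> y)"
      using xy N.rcos_sum by (simp add: FactGroup_def)
    then show "\<beta> (X \<otimes>\<^bsub>G Mod B\<^esub> Y) = \<beta> X * \<beta> Y" using xy \<beta> lam_mult by simp
  qed
  then have "\<beta> \<in> characters (G Mod B)" by (simp add: linear_characters_def)
  moreover have "inflation G B \<beta> = lam j"
    using \<beta> by (auto simp: inflation_def fun_eq_iff lam_def)
  ultimately show ?thesis by (rule that)
qed

text \<open>The values \<open>lam j g\<close> sum to \<open>p\<close> on \<open>B\<close> and to 0
  elsewhere, so summing over all twists cuts the form down to \<open>B\<close>.\<close>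

lemma sum_ip_lam:
  "(\<Sum>j<p. ip G (char_mult G (lam j) f) h)
     = of_nat p * of_nat (card B) / of_nat (card (carrier G)) * ip (G\<lparr>carrier := B\<rparr>) f h"
proof -
  have BG: "B \<subseteq> carrier G" by (rule subgroup.subset[OF B_subgroup])
  have cB: "card B > 0"
    using finite_subset[OF BG finite_carrier] subgroup.one_closed[OF B_subgroup] card_gt_0_iff by blast
  have "(\<Sum>j<p. ip G (char_mult G (lam j) f) h)
      = (\<Sum>g\<in>carrier G. \<Sum>j<p. \<omega> ^ (j * \<delta> g) * (f g * h (inv g))) / of_nat (card (carrier G))"
    by (subst sum.swap) (simp add: ip_def sum_divide_distrib char_mult_def lam_def mult.assoc)
  also have "(\<Sum>g\<in>carrier G. \<Sum>j<p. \<omega> ^ (j * \<delta> g) * (f g * h (inv g)))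
      = (\<Sum>g\<in>carrier G. (if g \<in> B then of_nat p else 0) * (f g * h (inv g)))"
    by (rule sum.cong[OF refl])
      (simp add: sum_distrib_right[symmetric] \<omega>_def sum_roots_of_unity_powers(2)[OF p_pos] B_iff)
  also have "\<dots> = (\<Sum>g\<in>B. of_nat p * (f g * h (inv g)))"
    by (rule sum.mono_neutral_cong_right) (use BG finite_carrier in auto)
  also have "\<dots> = of_nat p * (\<Sum>g\<in>B. f g * h (inv\<^bsub>G\<lparr>carrier := B\<rparr>\<^esub> g))"
    by (simp add: sum_distrib_left m_inv_consistent[OF B_subgroup])
  finally show ?thesis using cB by (simp add: ip_def)
qed

text \<open>The quotient is \<open>p\<close> divided by the index of \<open>B\<close>. Applying
  \<open>sum_ip_lam\<close> to the trivial character shows that it counts the \<open>j < p\<close>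
  with \<open>lam j\<close> trivial, and \<open>j = 0\<close> is among them.\<close>

lemma index_quotient_nat:
  obtains m :: nat where "m > 0" "of_nat p * of_nat (card B) / of_nat (card (carrier G)) = (of_nat m :: complex)"
proof -
  interpret GB: fin_group "G\<lparr>carrier := B\<rparr>" by (rule fin_group_subgroup[OF B_subgroup])
  define m where "m = card {j. j < p \<and> lam j = lam 0}"
  have I: "lam j \<in> Irr G" for j using lam_linear linear_characters_Irr by blast
  have BG: "B \<subseteq> carrier G" by (rule subgroup.subset[OF B_subgroup])
  have "ip (G\<lparr>carrier := B\<rparr>) (lam 0) (lam 0) = 1"
    using GB.card_pos by (simp add: ip_def lam_B subgroup.m_inv_closed[OF B_subgroup]
        m_inv_consistent[OF B_subgroup])
  then have "of_nat p * of_nat (card B) / of_nat (card (carrier G))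
      = (\<Sum>j<p. ip G (char_mult G (lam j) (lam 0)) (lam 0))" by (simp add: sum_ip_lam)
  also have "\<dots> = (\<Sum>j<p. if lam j = lam 0 then 1 else 0)"
  proof (rule sum.cong[OF refl])
    fix j
    have "char_mult G (lam j) (lam 0) = lam j" by (auto simp: char_mult_def lam_def fun_eq_iff)
    then show "ip G (char_mult G (lam j) (lam 0)) (lam 0) = (if lam j = lam 0 then 1 else 0)"
      using Irr_orthonormal[OF I I] by simp
  qed
  also have "\<dots> = of_nat m"
    unfolding m_def by (simp add: sum.If_cases Int_def)
  finally have "of_nat p * of_nat (card B) / of_nat (card (carrier G)) = (of_nat m :: complex)" .
  moreover have "m > 0" unfolding m_def using p_pos by (auto simp: card_gt_0_iff)
  ultimately show ?thesis using that by blast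
qed

theorem common_constituent:
  assumes \<chi>: "\<chi> \<in> Irr G" and \<phi>: "\<phi> \<in> Irr G" and ne: "\<chi> \<noteq> \<phi>"
    and com: "ip (G\<lparr>carrier := B\<rparr>) \<chi> \<phi> \<noteq> 0"
  obtains \<beta> where "restrict \<chi> B \<in> Irr (G\<lparr>carrier := B\<rparr>)" "\<beta> \<in> characters (G Mod B)"
    "\<phi> = char_mult G (inflation G B \<beta>) \<chi>"
proof -
  interpret GB: fin_group "G\<lparr>carrier := B\<rparr>" by (rule fin_group_subgroup[OF B_subgroup])
  obtain m :: nat where m: "m > 0"
    "of_nat p * of_nat (card B) / of_nat (card (carrier G)) = (of_nat m :: complex)" by (rule index_quotient_nat)
  have I: "char_mult G (lam j) \<chi> \<in> Irr G" for j by (rule linear_mult_Irr[OF lam_linear \<chi>])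
  have "(\<Sum>j<p. ip G (char_mult G (lam j) \<chi>) \<phi>) \<noteq> 0" using m com by (simp add: sum_ip_lam)
  then obtain j where j: "j < p" "ip G (char_mult G (lam j) \<chi>) \<phi> \<noteq> 0"
    by (metis (no_types, lifting) lessThan_iff sum.neutral)
  then have \<phi>j: "\<phi> = char_mult G (lam j) \<chi>" using Irr_orthonormal[OF I \<phi>] by (auto split: if_splits)
  have "restrict \<chi> B \<in> Irr (G\<lparr>carrier := B\<rparr>)"
  proof (rule ccontr)
    assume nI: "restrict \<chi> B \<notin> Irr (G\<lparr>carrier := B\<rparr>)"
    obtain M where M: "set_mset M \<subseteq> Irr (G\<lparr>carrier := B\<rparr>)" "M \<noteq> {#}"
      "restrict \<chi> B = (\<lambda>b\<in>carrier (G\<lparr>carrier := B\<rparr>). \<Sum>\<psi>\<in>#M. \<psi> b)"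
      using GB.characters_decomposition[OF characters_restrict[OF subsetD[OF Irr_subset_characters \<chi>] B_subgroup]]
      by metis
    have "size M \<noteq> 1"
    proof
      assume "size M = 1"
      then obtain \<psi> where \<psi>: "M = {#\<psi>#}" using size_1_singleton_mset by blast
      then have "\<psi> \<in> Irr (G\<lparr>carrier := B\<rparr>)" using M(1) by simp
      moreover have "restrict \<chi> B = \<psi>"
        using GB.characters_extensional[OF subsetD[OF GB.Irr_subset_characters \<open>\<psi> \<in> _\<close>]]
        unfolding M(3) \<psi> by (auto simp: fun_eq_iff extensional_def)
      ultimately show False using nI by simp
    qed
    then have size: "size M \<ge> 2" using M(2) by (cases "size M") (auto simp: neq_Nil_conv)
    \<comment> \<open>The sum of the squared multiplicities, as each \<psi> is visited
      \<open>count M \<psi>\<close> times; it is the form of \<chi> with itself on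
      \<open>B\<close>.\<close>
    define k where "k = (\<Sum>\<psi>\<in>#M. count M \<psi>)"
    have "ip (G\<lparr>carrier := B\<rparr>) \<chi> \<chi> = ip (G\<lparr>carrier := B\<rparr>) (restrict \<chi> B) (restrict \<chi> B)"
      by (rule GB.ip_cong) (auto simp: GB.inv_closed)
    also have "\<dots> = (\<Sum>\<psi>\<in>#M. ip (G\<lparr>carrier := B\<rparr>) (restrict \<chi> B) \<psi>)"
      by (subst GB.ip_commute, subst M(3), subst GB.ip_restrict_left, subst GB.ip_sum_mset_left)
        (simp add: GB.ip_commute)
    also have "\<dots> = (\<Sum>\<psi>\<in>#M. of_nat (count M \<psi>))"
      by (rule arg_cong[of _ _ sum_mset], rule image_mset_cong)
        (use M(1) GB.ip_sum_mset_Irr[OF M(1)] in \<open>auto simp: M(3)\<close>)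
    also have "\<dots> = of_nat k" by (simp add: k_def multiset.map_comp comp_def)
    finally have ipk: "ip (G\<lparr>carrier := B\<rparr>) \<chi> \<chi> = of_nat k" .
    have "size M = (\<Sum>\<psi>\<in>#M. 1)" by simp
    also have "\<dots> \<le> k" unfolding k_def by (rule sum_mset_mono) (simp add: Suc_le_eq)
    finally have k2: "k \<ge> 2" using size by simp
    have "\<exists>i<p. 0 < i \<and> char_mult G (lam i) \<chi> = \<chi>"
    proof (rule ccontr)
      assume no: "\<not> ?thesis"
      \<comment> \<open>If no nontrivial twist fixes \<chi>, only \<open>i = 0\<close> contributes
        and the sum is 1, whereas \<open>sum_ip_lam\<close> gives \<open>m * k\<close> with
        \<open>k\<close> at least 2.\<close>
      have "(\<Sum>i<p. ip G (char_mult G (lam i) \<chi>) \<chi>) = (\<Sum>i<p. if i = 0 then 1 else 0)"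
      proof (rule sum.cong[OF refl])
        fix i assume i: "i \<in> {..<p}"
        have "char_mult G (lam 0) \<chi> = \<chi>"
          using characters_extensional[OF subsetD[OF Irr_subset_characters \<chi>]]
          by (auto simp: char_mult_def lam_def fun_eq_iff extensional_def)
        then have "char_mult G (lam i) \<chi> = \<chi> \<longleftrightarrow> i = 0" using no i by auto
        then show "ip G (char_mult G (lam i) \<chi>) \<chi> = (if i = 0 then 1 else 0)"
          using Irr_orthonormal[OF I \<chi>] by simp
      qed
      also have "\<dots> = 1" using p_pos by simp
      finally have "(of_nat (m * k) :: complex) = of_nat 1" by (simp add: sum_ip_lam m(2) ipk)
      then have "m * k = 1" by (simp only: of_nat_eq_iff)
      then show False using k2 by simp
    qed
    then obtain i where i: "i < p" "0 < i" "char_mult G (lam i) \<chi> = \<chi>" by blast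
    \<comment> \<open>Where \<chi> is nonzero, the fixed twist forces \<open>lam i g = 1\<close>,
      hence \<open>g\<close> lies in \<open>B\<close>, where \<open>lam j\<close> is trivial
      too.\<close>
    have "char_mult G (lam j) \<chi> = \<chi>"
    proof
      fix g show "char_mult G (lam j) \<chi> g = \<chi> g"
      proof (cases "g \<in> carrier G")
        case g: True
        show ?thesis
        proof (cases "\<chi> g = 0")
          case False
          have "lam i g * \<chi> g = \<chi> g" using fun_cong[OF i(3), of g] g by (simp add: char_mult_def)
          then have "g \<in> B" using False lam_eq_1_iff[OF i(2,1) g] by simp
          then show ?thesis using g lam_B by (simp add: char_mult_def)
        qed (simp add: char_mult_def g)
      next
        case False
        then show ?thesis using characters_extensional[OF subsetD[OF Irr_subset_characters \<chi>]]
          by (auto simp: char_mult_def extensional_def)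
      qed
    qed
    then show False using ne \<phi>j by simp
  qed
  moreover obtain \<beta> where "\<beta> \<in> characters (G Mod B)" "inflation G B \<beta> = lam j" by (rule lam_inflation)
  ultimately show ?thesis using that \<phi>j by metis
qed

end

section \<open>Wreath products with a group of prime order\<close>

text \<open>The index runs forward: a shift by 1 moves entries one place down, opposite to
  \<open>cyclic_shift\<close>.\<close>

definition shift :: "nat \<Rightarrow> nat \<Rightarrow> (nat \<Rightarrow> 'a) \<Rightarrow> nat \<Rightarrow> 'a" where
  "shift p k b = (\<lambda>i\<in>{..<p}. b ((i + k) mod p))"

lemma shift_PiE: "p > 0 \<Longrightarrow> b \<in> PiE {..<p} (\<lambda>_. X) \<Longrightarrow> shift p k b \<in> PiE {..<p} (\<lambda>_. X)"
  by (simp add: shift_def PiE_iff)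

text \<open>Moves a shift from the arguments to the factors, which inverts its direction; hence the
  offset \<open>p - k mod p\<close>.\<close>

lemma prod_shift:
  fixes f :: "nat \<Rightarrow> 'a \<Rightarrow> complex"
  assumes p: "p > 0"
  shows "(\<Prod>i<p. f i (shift p k b i)) = (\<Prod>i<p. f ((i + (p - k mod p)) mod p) (b i))"
proof -
  let ?m = "p - k mod p"
  have m: "((i + ?m) mod p + k) mod p = i" if "i < p" for i
  proof -
    have "?m + k = p + p * (k div p)"
      using p mod_less_divisor[of p k] mult_div_mod_eq[of p k] by linarith
    then have "i + ?m + k = i + (1 + k div p) * p" by (simp add: algebra_simps)
    then have "(i + ?m + k) mod p = i mod p" by (metis mod_mult_self1)
    then show ?thesis using that by (simp only: mod_add_left_eq mod_less)
  qed
  have "(\<Prod>i<p. f i (shift p k b i)) = (\<Prod>i<p. f ((i + ?m) mod p) (shift p k b ((i + ?m) mod p)))"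
    by (rule prod.reindex_bij_betw[OF shift_bij[OF p], symmetric])
  also have "\<dots> = (\<Prod>i<p. f ((i + ?m) mod p) (b i))"
    by (rule prod.cong) (use m p in \<open>auto simp: shift_def\<close>)
  finally show ?thesis .
qed

text \<open>Isolates what the character theory uses of the wreath product: \<open>e\<close>
  identifies the direct power with \<open>B\<close>, and up to inner automorphisms of
  \<open>B\<close>, invisible to its characters, conjugation in \<open>W\<close> acts by shifts, all
  of which occur.\<close>

locale cyclic_wreath = cyclic_extension W B p \<delta>
  for W :: "('w, 'n) monoid_scheme" (structure) and B p \<delta> +
  fixes A :: "('a, 'm) monoid_scheme" and e :: "(nat \<Rightarrow> 'a) \<Rightarrow> 'w"
  assumes A: "fin_group A"
    and e_hom: "e \<in> hom (direct_power A p) W"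
    and e_inj: "inj_on e (carrier (direct_power A p))"
    and e_img: "e ` carrier (direct_power A p) = B"
    and conj: "w \<in> carrier W \<Longrightarrow> \<exists>k<p. \<exists>c\<in>carrier (direct_power A p). \<forall>b\<in>carrier (direct_power A p).
      w \<otimes> e b \<otimes> inv w = e c \<otimes> e (shift p k b) \<otimes> inv (e c)"
    and conj_ex: "k < p \<Longrightarrow> \<exists>w\<in>carrier W. \<forall>b\<in>carrier (direct_power A p).
      w \<otimes> e b \<otimes> inv w = e (shift p k b)"
begin

interpretation A: fin_group A by (rule A)

abbreviation D where "D \<equiv> direct_power A p"
abbreviation WB where "WB \<equiv> W\<lparr>carrier := B\<rparr>"

lemma D_carrier: "carrier D = PiE {..<p} (\<lambda>_. carrier A)"
  and D_mult: "x \<otimes>\<^bsub>D\<^esub> y = (\<lambda>i\<in>{..<p}. x i \<otimes>\<^bsub>A\<^esub> y i)"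
  and D_one: "\<one>\<^bsub>D\<^esub> = (\<lambda>i\<in>{..<p}. \<one>\<^bsub>A\<^esub>)"
  by (simp_all add: direct_power_def)

lemma D_group: "Group.group D"
  by (simp add: direct_power_def A.is_group)

lemma D_inv: "b \<in> carrier D \<Longrightarrow> inv\<^bsub>D\<^esub> b = (\<lambda>i\<in>{..<p}. inv\<^bsub>A\<^esub> b i)"
  by (simp add: direct_power_def A.is_group)

interpretation e: group_hom D W e
  using e_hom D_group is_group by (simp add: group_hom_def group_hom_axioms_def)

lemma WB_fin_group: "fin_group WB"
  by (rule fin_group_subgroup[OF B_subgroup])

interpretation WB: fin_group WB by (rule WB_fin_group)

lemma e_B: "b \<in> carrier D \<Longrightarrow> e b \<in> B"
  using e_img by blast

lemma product_subgroup:
  assumes K: "\<And>i. i < p \<Longrightarrow> subgroup (K i) A"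
  shows "subgroup (e ` PiE {..<p} K) W" "PiE {..<p} K \<subseteq> carrier D" "e ` PiE {..<p} K \<subseteq> B"
proof -
  have "subgroup (PiE {..<p} K) D"
    unfolding direct_power_def by (subst PiE_subgroup_product_group) (use K A.is_group in auto)
  then show "subgroup (e ` PiE {..<p} K) W" "PiE {..<p} K \<subseteq> carrier D"
    using e.subgroup_img_is_subgroup subgroup.subset by blast+
  then show "e ` PiE {..<p} K \<subseteq> B" using e_B by blast
qed

text \<open>A sum over the product set of products of one-coordinate terms factors by
  distributivity. The scalars accommodate characters of \<open>B\<close> that are known as products
  only up to a constant.\<close>

lemma ip_product:
  assumes K: "\<And>i. i < p \<Longrightarrow> subgroup (K i) A"
    and f: "\<And>b. b \<in> PiE {..<p} K \<Longrightarrow> f (e b) = c * (\<Prod>i<p. f' i (b i))"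
    and h: "\<And>b. b \<in> PiE {..<p} K \<Longrightarrow> h (e b) = d * (\<Prod>i<p. h' i (b i))"
  shows "ip (W\<lparr>carrier := e ` PiE {..<p} K\<rparr>) f h
    = c * d * (\<Prod>i<p. ip (A\<lparr>carrier := K i\<rparr>) (f' i) (h' i))"
proof -
  note S = product_subgroup[of K, OF K]
  have fin: "finite (K i)" if "i < p" for i
    using finite_subset[OF subgroup.subset[OF K[OF that]] A.finite_carrier] .
  have inj: "inj_on e (PiE {..<p} K)" using inj_on_subset[OF e_inj S(2)] .
  have inv: "f (e b) * h (inv\<^bsub>W\<lparr>carrier := e ` PiE {..<p} K\<rparr>\<^esub> (e b))
      = c * d * (\<Prod>i<p. f' i (b i) * h' i (inv\<^bsub>A\<lparr>carrier := K i\<rparr>\<^esub> b i))" if b: "b \<in> PiE {..<p} K" for b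
  proof -
    have bD: "b \<in> carrier D" using b S(2) by blast
    have "inv\<^bsub>W\<lparr>carrier := e ` PiE {..<p} K\<rparr>\<^esub> (e b) = inv (e b)"
      using m_inv_consistent[OF S(1)] b by blast
    also have "\<dots> = e (\<lambda>i\<in>{..<p}. inv\<^bsub>A\<^esub> b i)" using bD by (simp add: D_inv[symmetric])
    finally have "h (inv\<^bsub>W\<lparr>carrier := e ` PiE {..<p} K\<rparr>\<^esub> (e b)) = h (e (\<lambda>i\<in>{..<p}. inv\<^bsub>A\<^esub> b i))"
      by simp
    also have "\<dots> = d * (\<Prod>i<p. h' i ((\<lambda>i\<in>{..<p}. inv\<^bsub>A\<^esub> b i) i))"
    proof (rule h)
      show "(\<lambda>i\<in>{..<p}. inv\<^bsub>A\<^esub> b i) \<in> PiE {..<p} K"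
        using b subgroup.m_inv_closed[OF K] by (simp add: PiE_iff)
    qed
    also have "(\<Prod>i<p. h' i ((\<lambda>i\<in>{..<p}. inv\<^bsub>A\<^esub> b i) i)) = (\<Prod>i<p. h' i (inv\<^bsub>A\<^esub> b i))"
      by (rule prod.cong) auto
    also have "(\<Prod>i<p. h' i (inv\<^bsub>A\<^esub> b i)) = (\<Prod>i<p. h' i (inv\<^bsub>A\<lparr>carrier := K i\<rparr>\<^esub> b i))"
      using b A.m_inv_consistent[OF K] by (intro prod.cong) (auto simp: PiE_iff)
    finally show ?thesis using f[OF b] by (simp add: prod.distrib)
  qed
  have "(\<Sum>w\<in>e ` PiE {..<p} K. f w * h (inv\<^bsub>W\<lparr>carrier := e ` PiE {..<p} K\<rparr>\<^esub> w))
      = (\<Sum>b\<in>PiE {..<p} K. c * d * (\<Prod>i<p. f' i (b i) * h' i (inv\<^bsub>A\<lparr>carrier := K i\<rparr>\<^esub> b i)))"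
    by (subst sum.reindex[OF inj]) (simp add: inv)
  also have "\<dots> = c * d * (\<Prod>i<p. \<Sum>a\<in>K i. f' i a * h' i (inv\<^bsub>A\<lparr>carrier := K i\<rparr>\<^esub> a))"
    unfolding sum_distrib_left[symmetric]
    by (subst prod_sum_PiE) (use fin in auto)
  finally show ?thesis
    using fin by (simp add: ip_def card_image[OF inj] card_PiE prod_dividef of_nat_prod)
qed

section \<open>Factorization of the irreducible characters of the base group\<close>

definition single :: "nat \<Rightarrow> 'a \<Rightarrow> nat \<Rightarrow> 'a" where
  "single i a = (\<lambda>j\<in>{..<p}. if j = i then a else \<one>\<^bsub>A\<^esub>)"

lemma single_carrier: "a \<in> carrier A \<Longrightarrow> single i a \<in> carrier D"
  by (auto simp: single_def D_carrier)

lemma single_commute: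
  assumes "c \<in> carrier D" "c i = \<one>\<^bsub>A\<^esub>" "a \<in> carrier A"
  shows "single i a \<otimes>\<^bsub>D\<^esub> c = c \<otimes>\<^bsub>D\<^esub> single i a"
  using assms by (auto simp: single_def D_mult D_carrier fun_eq_iff PiE_iff)

lemma single_hom: "(\<lambda>a. e (single i a)) \<in> hom A WB"
proof (rule homI)
  fix a a' assume a: "a \<in> carrier A" "a' \<in> carrier A"
  have "single i (a \<otimes>\<^bsub>A\<^esub> a') = single i a \<otimes>\<^bsub>D\<^esub> single i a'"
    using a by (auto simp: single_def D_mult fun_eq_iff)
  then show "e (single i (a \<otimes>\<^bsub>A\<^esub> a')) = e (single i a) \<otimes>\<^bsub>WB\<^esub> e (single i a')"
    using a single_carrier by simp
qed (simp add: e_B single_carrier)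

text \<open>Each coordinate copy of \<open>A\<close> is centralized by the elements that are trivial
  in that coordinate, and together they give all of \<open>B\<close>. So
  \<open>central_factor\<close> strips off one coordinate at a time, leaving the value at the
  identity.\<close>

theorem base_Irr_product:
  assumes \<theta>: "\<theta> \<in> Irr WB"
  obtains c \<nu> where "c \<noteq> 0" "\<And>i. i < p \<Longrightarrow> \<nu> i \<in> Irr A"
    "\<And>b. b \<in> carrier D \<Longrightarrow> \<theta> (e b) = c * (\<Prod>i<p. \<nu> i (b i))"
proof -
  have "\<exists>\<nu>. \<nu> \<in> Irr A \<and> (\<forall>a\<in>carrier A. \<forall>c\<in>carrier D. c i = \<one>\<^bsub>A\<^esub> \<longrightarrow>
      \<theta> (e (single i a) \<otimes> e c) = \<nu> a / \<nu> \<one>\<^bsub>A\<^esub> * \<theta> (e c))" if i: "i < p" for i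
  proof -
    have "\<exists>a\<in>carrier A. \<exists>c\<in>carrier WB. g = e (single i a) \<otimes>\<^bsub>WB\<^esub> c \<and>
        (\<forall>x\<in>carrier A. e (single i x) \<otimes>\<^bsub>WB\<^esub> c = c \<otimes>\<^bsub>WB\<^esub> e (single i x))" if g: "g \<in> carrier WB" for g
    proof -
      obtain b where b: "b \<in> carrier D" "g = e b" using g e_img by auto
      \<comment> \<open>Clearing coordinate \<open>i\<close> leaves the part of \<open>b\<close>
        that commutes with the copy of \<open>A\<close> in that coordinate.\<close>
      define c where "c = b(i := \<one>\<^bsub>A\<^esub>)"
      have c: "c \<in> carrier D" "c i = \<one>\<^bsub>A\<^esub>" using b i by (auto simp: c_def D_carrier PiE_iff extensional_def)
      have bi: "b i \<in> carrier A" using b i by (auto simp: D_carrier)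
      have "single i (b i) \<otimes>\<^bsub>D\<^esub> c = b"
        using b i by (auto simp: single_def c_def D_mult D_carrier fun_eq_iff PiE_iff extensional_def)
      then have "g = e (single i (b i)) \<otimes> e c" using b(2) e.hom_mult[OF single_carrier[OF bi, of i] c(1)] by simp
      moreover have "e (single i x) \<otimes> e c = e c \<otimes> e (single i x)" if "x \<in> carrier A" for x
        using single_commute[OF c that] e.hom_mult[OF single_carrier[OF that, of i] c(1)]
          e.hom_mult[OF c(1) single_carrier[OF that, of i]] by simp
      ultimately show ?thesis using bi e_B[OF c(1)] by (intro bexI[of _ "b i"] bexI[of _ "e c"]) auto
    qed
    then obtain \<nu> where \<nu>: "\<nu> \<in> Irr A"
      "\<And>a c. a \<in> carrier A \<Longrightarrow> c \<in> carrier WB \<Longrightarrow>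
        (\<And>x. x \<in> carrier A \<Longrightarrow> e (single i x) \<otimes>\<^bsub>WB\<^esub> c = c \<otimes>\<^bsub>WB\<^esub> e (single i x)) \<Longrightarrow>
        \<theta> (e (single i a) \<otimes>\<^bsub>WB\<^esub> c) = \<nu> a / \<nu> \<one>\<^bsub>A\<^esub> * \<theta> c"
      by (rule WB.central_factor[OF \<theta> A single_hom[of i]]) auto
    have "\<theta> (e (single i a) \<otimes> e c) = \<nu> a / \<nu> \<one>\<^bsub>A\<^esub> * \<theta> (e c)"
      if a: "a \<in> carrier A" and c: "c \<in> carrier D" "c i = \<one>\<^bsub>A\<^esub>" for a c
    proof -
      have "e (single i x) \<otimes>\<^bsub>WB\<^esub> e c = e c \<otimes>\<^bsub>WB\<^esub> e (single i x)" if "x \<in> carrier A" for x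
        using single_commute[OF c that] single_carrier[OF that] c(1) by (simp flip: e.hom_mult)
      then show ?thesis using \<nu>(2)[OF a, of "e c"] e_B[OF c(1)] by simp
    qed
    then show ?thesis using \<nu>(1) by blast
  qed
  then obtain \<nu> where \<nu>: "\<And>i. i < p \<Longrightarrow> \<nu> i \<in> Irr A"
    "\<And>i a c. i < p \<Longrightarrow> a \<in> carrier A \<Longrightarrow> c \<in> carrier D \<Longrightarrow> c i = \<one>\<^bsub>A\<^esub> \<Longrightarrow>
      \<theta> (e (single i a) \<otimes> e c) = \<nu> i a / \<nu> i \<one>\<^bsub>A\<^esub> * \<theta> (e c)"
    by metis
  \<comment> \<open>Truncation to the first \<open>k\<close> coordinates, which interpolates between
    the identity at \<open>k = 0\<close> and \<open>b\<close> at \<open>k = p\<close>.\<close>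
  define tr where "tr k b = (\<lambda>j\<in>{..<p}. if j < k then b j else \<one>\<^bsub>A\<^esub>)" for k and b :: "nat \<Rightarrow> 'a"
  have tr: "\<theta> (e (tr k b)) = (\<Prod>i<k. \<nu> i (b i) / \<nu> i \<one>\<^bsub>A\<^esub>) * \<theta> \<one>"
    if b: "b \<in> carrier D" and "k \<le> p" for k b
    using \<open>k \<le> p\<close>
  proof (induction k)
    case 0
    have "tr 0 b = \<one>\<^bsub>D\<^esub>" by (auto simp: tr_def D_one)
    then show ?case by simp
  next
    case (Suc k)
    have trc: "tr k b \<in> carrier D" "tr k b k = \<one>\<^bsub>A\<^esub>"
      using b Suc.prems by (simp_all add: tr_def D_carrier PiE_iff)
    have bk: "b k \<in> carrier A" using b Suc.prems by (simp add: D_carrier PiE_iff)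
    have "tr (Suc k) b = single k (b k) \<otimes>\<^bsub>D\<^esub> tr k b"
      using b Suc.prems by (auto simp: tr_def single_def D_mult D_carrier fun_eq_iff less_Suc_eq PiE_iff)
    then have "\<theta> (e (tr (Suc k) b)) = \<theta> (e (single k (b k)) \<otimes> e (tr k b))"
      using single_carrier[OF bk] trc(1) by simp
    also have "\<dots> = \<nu> k (b k) / \<nu> k \<one>\<^bsub>A\<^esub> * \<theta> (e (tr k b))"
      using \<nu>(2) Suc.prems bk trc by simp
    finally show ?case using Suc by simp
  qed
  have nz: "\<nu> i \<one>\<^bsub>A\<^esub> \<noteq> 0" if "i < p" for i
    using A.characters_one_nonzero A.Irr_subset_characters \<nu>(1)[OF that] by blast
  have \<theta>1: "\<theta> \<one> \<noteq> 0" using WB.characters_one_nonzero[of \<theta>] WB.Irr_subset_characters \<theta> by auto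
  show ?thesis
  proof (rule that[of "\<theta> \<one> / (\<Prod>i<p. \<nu> i \<one>\<^bsub>A\<^esub>)" \<nu>])
    show "\<theta> \<one> / (\<Prod>i<p. \<nu> i \<one>\<^bsub>A\<^esub>) \<noteq> 0" using nz \<theta>1 by simp
    show "\<theta> (e b) = \<theta> \<one> / (\<Prod>i<p. \<nu> i \<one>\<^bsub>A\<^esub>) * (\<Prod>i<p. \<nu> i (b i))" if b: "b \<in> carrier D" for b
    proof -
      have "tr p b = b" using b by (auto simp: tr_def D_carrier fun_eq_iff PiE_iff extensional_def)
      then show ?thesis using tr[OF b order_refl] by (simp add: prod_dividef)
    qed
  qed (rule \<nu>(1))
qed

lemma ip_base_product:
  assumes \<theta>: "\<And>b. b \<in> carrier D \<Longrightarrow> \<theta> (e b) = c * (\<Prod>i<p. \<nu> i (b i))"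
    and \<eta>: "\<And>b. b \<in> carrier D \<Longrightarrow> \<eta> (e b) = d * (\<Prod>i<p. \<nu>' i (b i))"
  shows "ip WB \<theta> \<eta> = c * d * (\<Prod>i<p. ip A (\<nu> i) (\<nu>' i))"
proof -
  have "ip (W\<lparr>carrier := e ` PiE {..<p} (\<lambda>_. carrier A)\<rparr>) \<theta> \<eta>
      = c * d * (\<Prod>i<p. ip (A\<lparr>carrier := carrier A\<rparr>) (\<nu> i) (\<nu>' i))"
    by (rule ip_product[OF A.subgroup_self]) (use \<theta> \<eta> in \<open>simp_all add: D_carrier\<close>)
  then show ?thesis using e_img by (simp add: D_carrier ip_def)
qed

text \<open>The inner part of a conjugation does not change \<eta>, so only the rotation of its
  factors remains; conversely each rotation is realized.\<close>

lemma conj_character: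
  assumes \<eta>: "\<eta> \<in> Irr WB" "\<And>b. b \<in> carrier D \<Longrightarrow> \<eta> (e b) = c * (\<Prod>i<p. \<nu> i (b i))"
  shows "w \<in> carrier W \<Longrightarrow> \<exists>k<p. \<forall>b\<in>carrier D.
      \<eta> (w \<otimes> e b \<otimes> inv w) = c * (\<Prod>i<p. \<nu> ((i + k) mod p) (b i))"
    and "k < p \<Longrightarrow> \<exists>w\<in>carrier W. \<forall>b\<in>carrier D.
      \<eta> (w \<otimes> e b \<otimes> inv w) = c * (\<Prod>i<p. \<nu> ((i + k) mod p) (b i))"
proof -
  have sh: "shift p k b \<in> carrier D" if "b \<in> carrier D" for k b
    using that shift_PiE[OF p_pos] by (simp add: D_carrier)
  have \<eta>sh: "\<eta> (e (shift p k b)) = c * (\<Prod>i<p. \<nu> ((i + (p - k mod p)) mod p) (b i))"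
    if "b \<in> carrier D" for k b
    unfolding \<eta>(2)[OF sh[OF that]] prod_shift[OF p_pos] ..
  assume "w \<in> carrier W"
  then obtain k a where k: "k < p" "a \<in> carrier D"
    "\<And>b. b \<in> carrier D \<Longrightarrow> w \<otimes> e b \<otimes> inv w = e a \<otimes> e (shift p k b) \<otimes> inv (e a)"
    using conj by blast
  have "\<eta> (w \<otimes> e b \<otimes> inv w) = c * (\<Prod>i<p. \<nu> ((i + (p - k) mod p) mod p) (b i))" if b: "b \<in> carrier D" for b
  proof -
    have "\<eta> (e a \<otimes>\<^bsub>WB\<^esub> e (shift p k b) \<otimes>\<^bsub>WB\<^esub> inv\<^bsub>WB\<^esub> (e a)) = \<eta> (e (shift p k b))"
      by (rule WB.characters_conj) (use \<eta>(1) WB.Irr_subset_characters e_B k sh[OF b] in auto)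
    then have "\<eta> (w \<otimes> e b \<otimes> inv w) = \<eta> (e (shift p k b))"
      using k(3)[OF b] m_inv_consistent[OF B_subgroup e_B[OF k(2)]] by simp
    then show ?thesis using \<eta>sh[OF b] k(1) by (simp add: mod_add_right_eq)
  qed
  then show "\<exists>k<p. \<forall>b\<in>carrier D. \<eta> (w \<otimes> e b \<otimes> inv w) = c * (\<Prod>i<p. \<nu> ((i + k) mod p) (b i))"
    using p_pos by (intro exI[of _ "(p - k) mod p"]) simp
next
  have sh: "shift p k b \<in> carrier D" if "b \<in> carrier D" for k b
    using that shift_PiE[OF p_pos] by (simp add: D_carrier)
  assume k: "k < p"
  \<comment> \<open>Rotating the factors by \<open>k\<close> means shifting the arguments by
    \<open>-k\<close>; the outer \<open>mod p\<close> takes care of \<open>k = 0\<close>.\<close>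
  have "(p - k) mod p < p" using p_pos by simp
  from conj_ex[OF this] obtain w where w: "w \<in> carrier W"
    "\<And>b. b \<in> carrier D \<Longrightarrow> w \<otimes> e b \<otimes> inv w = e (shift p ((p - k) mod p) b)" by blast
  have *: "(i + (p - (p - k) mod p mod p)) mod p = (i + k) mod p" for i
    using k by (cases "k = 0") simp_all
  have "\<eta> (w \<otimes> e b \<otimes> inv w) = c * (\<Prod>i<p. \<nu> ((i + k) mod p) (b i))" if b: "b \<in> carrier D" for b
    unfolding w(2)[OF b] \<eta>(2)[OF sh[OF b]] prod_shift[OF p_pos] * ..
  then show "\<exists>w\<in>carrier W. \<forall>b\<in>carrier D.
      \<eta> (w \<otimes> e b \<otimes> inv w) = c * (\<Prod>i<p. \<nu> ((i + k) mod p) (b i))" using w(1) by blast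
qed

text \<open>\<phi> is a class function on \<open>W\<close>, so the conjugation can be substituted
  away: all conjugates of \<eta> have the same form with \<phi> on \<open>B\<close>.\<close>

lemma ip_base_conj:
  assumes \<phi>: "\<phi> \<in> Irr W" and w: "w \<in> carrier W"
  shows "ip WB \<phi> (\<lambda>b. \<eta> (w \<otimes> b \<otimes> inv w)) = ip WB \<phi> \<eta>"
proof -
  interpret N: normal B W by (rule normal)
  have BG: "B \<subseteq> carrier W" by (rule N.subset)
  have "(\<Sum>b\<in>B. \<phi> b * \<eta> (w \<otimes> inv b \<otimes> inv w)) = (\<Sum>b\<in>B. \<phi> b * \<eta> (inv b))"
  proof (rule sum.reindex_bij_witness[of _ "\<lambda>b. inv w \<otimes> b \<otimes> w" "\<lambda>b. w \<otimes> b \<otimes> inv w"])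
    fix b assume b: "b \<in> B"
    then have bW: "b \<in> carrier W" using BG by blast
    show "inv w \<otimes> (w \<otimes> b \<otimes> inv w) \<otimes> w = b" "w \<otimes> (inv w \<otimes> b \<otimes> w) \<otimes> inv w = b"
      using bW w by (simp_all add: m_assoc inv_mult_cancel)
    show "w \<otimes> b \<otimes> inv w \<in> B" "inv w \<otimes> b \<otimes> w \<in> B"
      using N.inv_op_closed1[OF w b] N.inv_op_closed2[OF w b] by auto
    have "inv (w \<otimes> b \<otimes> inv w) = w \<otimes> inv b \<otimes> inv w" using w bW by (simp add: inv_mult_group m_assoc)
    then show "\<phi> (w \<otimes> b \<otimes> inv w) * \<eta> (inv (w \<otimes> b \<otimes> inv w)) = \<phi> b * \<eta> (w \<otimes> inv b \<otimes> inv w)"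
      using characters_conj[OF subsetD[OF Irr_subset_characters \<phi>] bW w] by simp
  qed
  then show ?thesis by (simp add: ip_def m_inv_consistent[OF B_subgroup])
qed

text \<open>Total version of almost monomiality, usable in every coordinate: when there is nothing
  to separate, it still supplies a linear character meeting \<alpha>.\<close>

lemma separating_linear_character:
  assumes am: "almost_monomial A" and \<alpha>: "\<alpha> \<in> Irr A"
  obtains H \<mu> where "subgroup H A" "\<mu> \<in> linear_characters (A\<lparr>carrier := H\<rparr>)"
    "ip (A\<lparr>carrier := H\<rparr>) \<mu> \<alpha> \<noteq> 0"
    "\<psi> \<in> Irr A \<Longrightarrow> \<psi> \<noteq> \<alpha> \<Longrightarrow> ip (A\<lparr>carrier := H\<rparr>) \<mu> \<psi> = 0"
proof (cases "\<psi> \<in> Irr A \<and> \<psi> \<noteq> \<alpha>")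
  case True
  then obtain H \<mu> where H: "subgroup H A" "\<mu> \<in> linear_characters (A\<lparr>carrier := H\<rparr>)"
    "\<alpha> \<in> constituents A (induced A H \<mu>)" "\<psi> \<notin> constituents A (induced A H \<mu>)"
    using am \<alpha> unfolding almost_monomial_def by metis
  then show ?thesis using that[OF H(1,2)] True A.constituents_induced_iff[OF H(1,2)] by blast
next
  case False
  \<comment> \<open>On the trivial subgroup the form with \<alpha> is the degree of \<alpha>, which
    is nonzero.\<close>
  have S: "subgroup {\<one>\<^bsub>A\<^esub>} A" by (rule A.triv_subgroup)
  interpret T: group "A\<lparr>carrier := {\<one>\<^bsub>A\<^esub>}\<rparr>" by (rule A.subgroup_imp_group[OF S])
  define \<mu> :: "'a \<Rightarrow> complex" where "\<mu> = (\<lambda>a\<in>{\<one>\<^bsub>A\<^esub>}. 1)"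
  have "\<mu> \<in> linear_characters (A\<lparr>carrier := {\<one>\<^bsub>A\<^esub>}\<rparr>)"
    unfolding T.linear_characters_iff by (simp add: \<mu>_def)
  moreover have "ip (A\<lparr>carrier := {\<one>\<^bsub>A\<^esub>}\<rparr>) \<mu> \<alpha> \<noteq> 0"
    using A.characters_one_nonzero[OF subsetD[OF A.Irr_subset_characters \<alpha>]]
    by (simp add: ip_def \<mu>_def A.m_inv_consistent[OF S])
  ultimately show ?thesis using that[OF S] False by blast
qed

text \<open>The subgroup is chosen inside \<open>B\<close>, so by Frobenius reciprocity only the
  restrictions to \<open>B\<close> matter; on it every form with a constituent is a product over the
  coordinates.\<close>

lemma disjoint_constituents:
  assumes am: "almost_monomial A" and \<chi>: "\<chi> \<in> Irr W" and \<phi>: "\<phi> \<in> Irr W"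
    and dis: "ip WB \<chi> \<phi> = 0"
  shows "\<exists>H \<mu>. subgroup H W \<and> \<mu> \<in> linear_characters (W\<lparr>carrier := H\<rparr>) \<and>
    \<chi> \<in> constituents W (induced W H \<mu>) \<and> \<phi> \<notin> constituents W (induced W H \<mu>)"
proof -
  obtain M where M: "set_mset M \<subseteq> Irr WB" "M \<noteq> {#}" "restrict \<chi> B = (\<lambda>b\<in>B. \<Sum>\<psi>\<in>#M. \<psi> b)"
    by (rule clifford[OF \<chi> normal]) blast
  obtain M' where M': "set_mset M' \<subseteq> Irr WB" "M' \<noteq> {#}" "restrict \<phi> B = (\<lambda>b\<in>B. \<Sum>\<psi>\<in>#M'. \<psi> b)"
    "\<And>\<eta> \<psi>. \<eta> \<in># M' \<Longrightarrow> \<psi> \<in># M' \<Longrightarrow>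
       \<exists>w\<in>carrier W. ip WB \<psi> (\<lambda>b. \<eta> (w \<otimes> b \<otimes> inv w)) \<noteq> 0"
    by (rule clifford[OF \<phi> normal]) blast
  obtain \<theta> where \<theta>: "\<theta> \<in># M" using M(2) by blast
  obtain \<eta> where \<eta>: "\<eta> \<in># M'" using M'(2) by blast
  have \<theta>I: "\<theta> \<in> Irr WB" and \<eta>I: "\<eta> \<in> Irr WB" using \<theta> \<eta> M(1) M'(1) by auto
  have ip\<phi>: "ip WB \<phi> \<psi> = of_nat (count M' \<psi>)" if "\<psi> \<in> Irr WB" for \<psi>
  proof -
    have "ip WB \<phi> \<psi> = ip WB (restrict \<phi> B) \<psi>" by (rule WB.ip_cong) auto
    then show ?thesis using WB.ip_sum_mset_Irr[OF M'(1) that] by (simp add: M'(3))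
  qed
  obtain c \<theta>' where c: "c \<noteq> 0" "\<And>i. i < p \<Longrightarrow> \<theta>' i \<in> Irr A"
    "\<And>b. b \<in> carrier D \<Longrightarrow> \<theta> (e b) = c * (\<Prod>i<p. \<theta>' i (b i))" using base_Irr_product[OF \<theta>I] by metis
  obtain d \<eta>' where d: "d \<noteq> 0" "\<And>i. i < p \<Longrightarrow> \<eta>' i \<in> Irr A"
    "\<And>b. b \<in> carrier D \<Longrightarrow> \<eta> (e b) = d * (\<Prod>i<p. \<eta>' i (b i))" using base_Irr_product[OF \<eta>I] by metis
  \<comment> \<open>If the factors of \<theta> were a rotation of those of \<eta>, then \<theta>
    would be a multiple of a conjugate of \<eta> and so would occur in \<phi>. As it also occurs in
    \<chi>, the form of \<chi> and \<phi> on \<open>B\<close> could not be zero.\<close>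
  have "\<exists>i<p. \<theta>' i \<noteq> \<eta>' ((i + k) mod p)" if k: "k < p" for k
  proof (rule ccontr)
    assume "\<not> ?thesis"
    then have eq: "\<theta>' i = \<eta>' ((i + k) mod p)" if "i < p" for i using that by blast
    obtain w where w: "w \<in> carrier W"
      "\<forall>b\<in>carrier D. \<eta> (w \<otimes> e b \<otimes> inv w) = d * (\<Prod>i<p. \<eta>' ((i + k) mod p) (b i))"
      by (rule bexE[OF conj_character(2)[where \<eta>=\<eta> and c=d and \<nu>=\<eta>', OF \<eta>I d(3) k]])
    have "\<theta> x = c / d * \<eta> (w \<otimes> x \<otimes> inv w)" if x: "x \<in> B" for x
    proof -
      have "x \<in> e ` carrier D" using x by (simp only: e_img)
      then obtain b where b: "b \<in> carrier D" "x = e b" by (rule imageE)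
      have "(\<Prod>i<p. \<eta>' ((i + k) mod p) (b i)) = (\<Prod>i<p. \<theta>' i (b i))"
        by (rule prod.cong) (simp_all add: eq)
      then show ?thesis using bspec[OF w(2) b(1)] c(3)[OF b(1)] d(1) by (simp add: b(2))
    qed
    then have "ip WB \<phi> \<theta> = ip WB \<phi> (\<lambda>x. c / d * \<eta> (w \<otimes> x \<otimes> inv w))"
      by (intro WB.ip_cong) auto
    also have "\<dots> = c / d * ip WB \<phi> \<eta>"
      by (simp only: WB.ip_scale_right ip_base_conj[OF \<phi> w(1)])
    finally have "ip WB \<phi> \<theta> \<noteq> 0" using c(1) d(1) \<eta> by (simp add: ip\<phi>[OF \<eta>I] count_eq_zero_iff)
    then have \<theta>M': "count M' \<theta> \<noteq> 0" using ip\<phi>[OF \<theta>I] by auto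
    have "ip WB \<chi> \<phi> = ip WB (restrict \<chi> B) \<phi>" by (rule WB.ip_cong) auto
    also have "\<dots> = (\<Sum>\<psi>\<in>#M. ip WB \<psi> \<phi>)"
      using WB.ip_restrict_left[of "\<lambda>b. \<Sum>\<psi>\<in>#M. \<psi> b"] by (simp add: M(3) WB.ip_sum_mset_left)
    also have "\<dots> = (\<Sum>\<psi>\<in>#M. of_nat (count M' \<psi>))"
      by (rule arg_cong[of _ _ sum_mset], rule image_mset_cong)
        (use M(1) ip\<phi> in \<open>auto simp: WB.ip_commute[of _ \<phi>]\<close>)
    also have "\<dots> = of_nat (\<Sum>\<psi>\<in>#M. count M' \<psi>)" by (simp add: multiset.map_comp comp_def)
    finally have "(\<Sum>\<psi>\<in>#M. count M' \<psi>) = 0" using dis by (metis of_nat_eq_0_iff)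
    then show False using \<theta> \<theta>M' by (simp add: sum_mset_0_iff)
  qed
  then obtain \<epsilon> where \<epsilon>: "\<And>k. k < p \<Longrightarrow> \<exists>i<p. \<epsilon> i \<noteq> \<theta>' i \<and> \<eta>' ((i + k) mod p) = \<epsilon> i"
    using separating_choice[OF prime, of \<theta>' \<eta>'] by blast
  \<comment> \<open>Where \<open>\<epsilon> i\<close> equals \<open>\<theta>' i\<close> or is not an
    irreducible character, the only demand is a nonzero form with
    \<open>\<theta>' i\<close>.\<close>
  have "\<exists>H \<mu>. subgroup H A \<and> \<mu> \<in> linear_characters (A\<lparr>carrier := H\<rparr>) \<and>
      ip (A\<lparr>carrier := H\<rparr>) \<mu> (\<theta>' i) \<noteq> 0 \<and>
      (\<epsilon> i \<in> Irr A \<longrightarrow> \<epsilon> i \<noteq> \<theta>' i \<longrightarrow> ip (A\<lparr>carrier := H\<rparr>) \<mu> (\<epsilon> i) = 0)" if "i < p" for i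
    using separating_linear_character[OF am c(2)[OF that], of "\<epsilon> i"] by metis
  then obtain K \<mu> where K: "\<And>i. i < p \<Longrightarrow> subgroup (K i) A"
    and \<mu>: "\<And>i. i < p \<Longrightarrow> \<mu> i \<in> linear_characters (A\<lparr>carrier := K i\<rparr>)"
    and \<mu>\<theta>: "\<And>i. i < p \<Longrightarrow> ip (A\<lparr>carrier := K i\<rparr>) (\<mu> i) (\<theta>' i) \<noteq> 0"
    and \<mu>\<epsilon>: "\<And>i. i < p \<Longrightarrow> \<epsilon> i \<in> Irr A \<Longrightarrow> \<epsilon> i \<noteq> \<theta>' i \<Longrightarrow> ip (A\<lparr>carrier := K i\<rparr>) (\<mu> i) (\<epsilon> i) = 0"
    by metis
  define H where "H = e ` PiE {..<p} K"
  note S = product_subgroup[of K, OF K, folded H_def]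
  interpret WH: fin_group "W\<lparr>carrier := H\<rparr>" by (rule fin_group_subgroup[OF S(1)])
  define \<Lambda> where "\<Lambda> = (\<lambda>w\<in>H. \<Prod>i<p. \<mu> i (inv_into (carrier D) e w i))"
  have \<Lambda>: "\<Lambda> (e b) = 1 * (\<Prod>i<p. \<mu> i (b i))" if "b \<in> PiE {..<p} K" for b
  proof -
    have "b \<in> carrier D" "e b \<in> H" using that S(2) by (auto simp: H_def)
    then show ?thesis by (simp add: \<Lambda>_def inv_into_f_f[OF e_inj])
  qed
  have \<mu>1: "\<mu> i \<one>\<^bsub>A\<^esub> = 1" and \<mu>m: "\<And>x y. x \<in> K i \<Longrightarrow> y \<in> K i \<Longrightarrow> \<mu> i (x \<otimes>\<^bsub>A\<^esub> y) = \<mu> i x * \<mu> i y"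
    if "i < p" for i
  proof -
    interpret G: group "A\<lparr>carrier := K i\<rparr>" by (rule A.subgroup_imp_group[OF K[OF that]])
    show "\<mu> i \<one>\<^bsub>A\<^esub> = 1" "\<And>x y. x \<in> K i \<Longrightarrow> y \<in> K i \<Longrightarrow> \<mu> i (x \<otimes>\<^bsub>A\<^esub> y) = \<mu> i x * \<mu> i y"
      using \<mu>[OF that] unfolding G.linear_characters_iff by auto
  qed
  have \<Lambda>_lin: "\<Lambda> \<in> linear_characters (W\<lparr>carrier := H\<rparr>)"
    unfolding WH.linear_characters_iff
  proof (intro conjI ballI)
    show "\<Lambda> \<in> extensional (carrier (W\<lparr>carrier := H\<rparr>))" by (simp add: \<Lambda>_def)
    have "\<one>\<^bsub>D\<^esub> \<in> PiE {..<p} K" using subgroup.one_closed[OF K] by (simp add: D_one PiE_iff)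
    then have "\<Lambda> (e \<one>\<^bsub>D\<^esub>) = (\<Prod>i<p. \<mu> i (\<one>\<^bsub>D\<^esub> i))" by (simp only: \<Lambda> mult_1)
    also have "\<dots> = 1" by (rule prod.neutral) (simp add: D_one \<mu>1)
    finally show "\<Lambda> \<one>\<^bsub>W\<lparr>carrier := H\<rparr>\<^esub> = 1" by simp
    fix g h assume "g \<in> carrier (W\<lparr>carrier := H\<rparr>)" "h \<in> carrier (W\<lparr>carrier := H\<rparr>)"
    then obtain x y where xy: "x \<in> PiE {..<p} K" "g = e x" "y \<in> PiE {..<p} K" "h = e y"
      by (auto simp: H_def)
    have xyK: "x \<otimes>\<^bsub>D\<^esub> y \<in> PiE {..<p} K"
      using xy subgroup.m_closed[OF K] by (simp add: D_mult PiE_iff)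
    have "g \<otimes> h = e (x \<otimes>\<^bsub>D\<^esub> y)" using xy S(2) by (simp add: subset_iff)
    then have "\<Lambda> (g \<otimes> h) = (\<Prod>i<p. \<mu> i ((x \<otimes>\<^bsub>D\<^esub> y) i))" using \<Lambda>[OF xyK] by simp
    also have "\<dots> = (\<Prod>i<p. \<mu> i (x i) * \<mu> i (y i))"
      by (rule prod.cong) (use xy \<mu>m in \<open>auto simp: D_mult PiE_iff\<close>)
    also have "\<dots> = \<Lambda> g * \<Lambda> h" using \<Lambda> xy by (simp add: prod.distrib)
    finally show "\<Lambda> (g \<otimes>\<^bsub>W\<lparr>carrier := H\<rparr>\<^esub> h) = \<Lambda> g * \<Lambda> h" by simp
  qed
  have ip_res: "ip (W\<lparr>carrier := H\<rparr>) \<Lambda> \<xi> = (\<Sum>\<psi>\<in>#N. ip (W\<lparr>carrier := H\<rparr>) \<psi> \<Lambda>)"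
    if "restrict \<xi> B = (\<lambda>b\<in>B. \<Sum>\<psi>\<in>#N. \<psi> b)" for \<xi> N
  proof -
    have "\<xi> h = (\<Sum>\<psi>\<in>#N. \<psi> h)" if "h \<in> H" for h
    proof -
      have "h \<in> B" using that S(3) by blast
      then show ?thesis using fun_cong[OF \<open>restrict \<xi> B = _\<close>, of h] by simp
    qed
    then have "ip (W\<lparr>carrier := H\<rparr>) \<xi> \<Lambda> = ip (W\<lparr>carrier := H\<rparr>) (\<lambda>h. \<Sum>\<psi>\<in>#N. \<psi> h) \<Lambda>"
      by (intro WH.ip_cong) auto
    then show ?thesis by (simp add: WH.ip_sum_mset_left WH.ip_commute[of \<Lambda>])
  qed
  have "\<phi> \<notin> constituents W (induced W H \<Lambda>)"
  proof -
    \<comment> \<open>A nonzero form with a conjugate of \<eta> identifies the factors of \<psi>,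
      coordinate by coordinate, with a rotation of \<open>\<eta>'\<close>. The choice of \<epsilon>
      makes one coordinate form vanish, and with it the product.\<close>
    have "ip (W\<lparr>carrier := H\<rparr>) \<psi> \<Lambda> = 0" if \<psi>: "\<psi> \<in># M'" for \<psi>
    proof -
      have \<psi>I: "\<psi> \<in> Irr WB" using \<psi> M'(1) by auto
      obtain f \<psi>' where f: "f \<noteq> 0" "\<And>i. i < p \<Longrightarrow> \<psi>' i \<in> Irr A"
        "\<And>b. b \<in> carrier D \<Longrightarrow> \<psi> (e b) = f * (\<Prod>i<p. \<psi>' i (b i))" using base_Irr_product[OF \<psi>I] by metis
      obtain w where w: "w \<in> carrier W" "ip WB \<psi> (\<lambda>b. \<eta> (w \<otimes> b \<otimes> inv w)) \<noteq> 0"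
        using M'(4)[OF \<eta> \<psi>] by blast
      obtain k where k: "k < p"
        "\<And>b. b \<in> carrier D \<Longrightarrow> \<eta> (w \<otimes> e b \<otimes> inv w) = d * (\<Prod>i<p. \<eta>' ((i + k) mod p) (b i))"
        using conj_character(1)[OF \<eta>I d(3) w(1)] by blast
      have "(\<Prod>i<p. ip A (\<psi>' i) (\<eta>' ((i + k) mod p))) \<noteq> 0"
        using w(2) ip_base_product[of \<psi> f \<psi>' "\<lambda>b. \<eta> (w \<otimes> b \<otimes> inv w)" d "\<lambda>i. \<eta>' ((i + k) mod p)", OF f(3) k(2)]
        by auto
      then have eq: "\<psi>' i = \<eta>' ((i + k) mod p)" if "i < p" for i
        using A.Irr_orthonormal[OF f(2)[OF that] d(2)[of "(i + k) mod p"]] that p_pos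
        by (auto split: if_splits)
      obtain i where i: "i < p" "\<epsilon> i \<noteq> \<theta>' i" "\<eta>' ((i + k) mod p) = \<epsilon> i" using \<epsilon>[OF k(1)] by blast
      have "\<epsilon> i = \<psi>' i" using eq i by simp
      then have "ip (A\<lparr>carrier := K i\<rparr>) (\<mu> i) (\<psi>' i) = 0" using \<mu>\<epsilon>[OF i(1)] f(2) i by simp
      then have "(\<Prod>i<p. ip (A\<lparr>carrier := K i\<rparr>) (\<mu> i) (\<psi>' i)) = 0" using i(1) by auto
      moreover have "ip (W\<lparr>carrier := H\<rparr>) \<Lambda> \<psi> = 1 * f * (\<Prod>i<p. ip (A\<lparr>carrier := K i\<rparr>) (\<mu> i) (\<psi>' i))"
        unfolding H_def
        by (rule ip_product[where K=K and f=\<Lambda> and c=1 and f'=\<mu> and h=\<psi> and d=f and h'=\<psi>'])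
          (use K \<Lambda> f(3) S(2) in blast)+
      ultimately show ?thesis by (simp add: WH.ip_commute[of \<psi>])
    qed
    then have "ip (W\<lparr>carrier := H\<rparr>) \<Lambda> \<phi> = 0" by (simp add: ip_res[OF M'(3)] sum_mset.neutral)
    then show ?thesis using constituents_induced_iff[OF S(1) \<Lambda>_lin] by simp
  qed
  moreover have "\<chi> \<in> constituents W (induced W H \<Lambda>)"
  proof -
    have "ip (W\<lparr>carrier := H\<rparr>) \<Lambda> \<theta> = 1 * c * (\<Prod>i<p. ip (A\<lparr>carrier := K i\<rparr>) (\<mu> i) (\<theta>' i))"
      unfolding H_def
      by (rule ip_product[where K=K and f=\<Lambda> and c=1 and f'=\<mu> and h=\<theta> and d=c and h'=\<theta>'])
        (use K \<Lambda> c(3) S(2) in blast)+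
    then have nz: "ip (W\<lparr>carrier := H\<rparr>) \<theta> \<Lambda> \<noteq> 0"
      using c(1) \<mu>\<theta> by (simp add: WH.ip_commute[of \<theta>])
    \<comment> \<open>\<Lambda> is irreducible on \<open>H\<close>, so each constituent of \<chi>
      contributes a natural number and the nonzero term of \<theta> survives in the sum.\<close>
    have "\<exists>n. ip (W\<lparr>carrier := H\<rparr>) \<psi> \<Lambda> = of_nat n" if \<psi>: "\<psi> \<in># M" for \<psi>
    proof -
      have HB: "subgroup H WB" using subgroup_incl[OF S(1) B_subgroup S(3)] .
      have "\<psi> \<in> characters WB" using \<psi> M(1) WB.Irr_subset_characters by blast
      then have "restrict \<psi> H \<in> characters (W\<lparr>carrier := H\<rparr>)"
        using WB.characters_restrict[OF _ HB] by simp
      then have "ip (W\<lparr>carrier := H\<rparr>) (restrict \<psi> H) \<Lambda> \<in> \<nat>"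
        using WH.ip_characters_Nats WH.linear_characters_Irr \<Lambda>_lin by blast
      moreover have "ip (W\<lparr>carrier := H\<rparr>) (restrict \<psi> H) \<Lambda> = ip (W\<lparr>carrier := H\<rparr>) \<psi> \<Lambda>"
        by (rule WH.ip_cong) auto
      ultimately show ?thesis by (auto simp: Nats_def)
    qed
    then obtain n where n: "\<And>\<psi>. \<psi> \<in># M \<Longrightarrow> ip (W\<lparr>carrier := H\<rparr>) \<psi> \<Lambda> = of_nat (n \<psi>)" by metis
    have "ip (W\<lparr>carrier := H\<rparr>) \<Lambda> \<chi> = (\<Sum>\<psi>\<in>#M. of_nat (n \<psi>))"
      unfolding ip_res[OF M(3)] by (rule arg_cong[of _ _ sum_mset], rule image_mset_cong) (rule n)
    also have "\<dots> = of_nat (\<Sum>\<psi>\<in>#M. n \<psi>)" by (simp add: multiset.map_comp comp_def)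
    finally have 1: "ip (W\<lparr>carrier := H\<rparr>) \<Lambda> \<chi> = of_nat (\<Sum>\<psi>\<in>#M. n \<psi>)" .
    have "n \<theta> \<noteq> 0" using nz n[OF \<theta>] by auto
    then have "(\<Sum>\<psi>\<in>#M. n \<psi>) \<noteq> 0" using \<theta> by (auto simp: sum_mset_0_iff)
    then have "ip (W\<lparr>carrier := H\<rparr>) \<Lambda> \<chi> \<noteq> 0" unfolding 1 by (simp only: of_nat_eq_0_iff not_False_eq_True)
    then show ?thesis using constituents_induced_iff[OF S(1) \<Lambda>_lin] \<chi> by simp
  qed
  ultimately show ?thesis using S(1) \<Lambda>_lin by blast
qed

theorem almost_monomial_wreath:
  assumes am: "almost_monomial A"
    and ext: "\<And>\<chi> \<beta>. \<lbrakk>\<chi> \<in> Irr W; restrict \<chi> B \<in> Irr WB;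
                  \<beta> \<in> characters (W Mod B); \<beta> \<noteq> principal_character (W Mod B)\<rbrakk> \<Longrightarrow>
           \<exists>H \<mu>. subgroup H W \<and> \<mu> \<in> linear_characters (W\<lparr>carrier := H\<rparr>) \<and>
                 \<chi> \<in> constituents W (induced W H \<mu>) \<and>
                 char_mult W (inflation W B \<beta>) \<chi> \<notin> constituents W (induced W H \<mu>)"
  shows "almost_monomial W"
  unfolding almost_monomial_def
proof (intro conjI is_group finite_carrier ballI impI)
  fix \<chi> \<phi> assume \<chi>: "\<chi> \<in> Irr W" and \<phi>: "\<phi> \<in> Irr W" and ne: "\<chi> \<noteq> \<phi>"
  show "\<exists>H \<mu>. subgroup H W \<and> \<mu> \<in> linear_characters (W\<lparr>carrier := H\<rparr>) \<and>
      \<chi> \<in> constituents W (induced W H \<mu>) \<and> \<phi> \<notin> constituents W (induced W H \<mu>)"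
  proof (cases "ip WB \<chi> \<phi> = 0")
    case True
    then show ?thesis by (rule disjoint_constituents[OF am \<chi> \<phi>])
  next
    case False
    obtain \<beta> where \<beta>: "restrict \<chi> B \<in> Irr WB" "\<beta> \<in> characters (W Mod B)"
      "\<phi> = char_mult W (inflation W B \<beta>) \<chi>"
      by (rule common_constituent[OF \<chi> \<phi> ne False])
    have "\<beta> \<noteq> principal_character (W Mod B)"
    proof
      assume \<beta>1: "\<beta> = principal_character (W Mod B)"
      have "\<phi> g = \<chi> g" for g
      proof (cases "g \<in> carrier W")
        case True
        then have "B #> g \<in> carrier (W Mod B)" by (auto simp: FactGroup_def RCOSETS_def)
        then show ?thesis using True
          by (simp add: \<beta>(3) \<beta>1 char_mult_def inflation_def principal_character_def)
      next
        case False
        then show ?thesis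
          using characters_extensional[OF subsetD[OF Irr_subset_characters \<chi>]]
            characters_extensional[OF subsetD[OF Irr_subset_characters \<phi>]]
          by (simp add: extensional_def)
      qed
      then show False using ne by auto
    qed
    then show ?thesis using ext[OF \<chi> \<beta>(1,2)] \<beta>(3) by simp
  qed
qed

end

section \<open>The concrete wreath product\<close>

lemma AutoGroup_simps:
  "carrier (AutoGroup G) = auto G"
  "\<one>\<^bsub>AutoGroup G\<^esub> = (\<lambda>x\<in>carrier G. x)"
  "s \<in> auto G \<Longrightarrow> t \<in> auto G \<Longrightarrow> s \<otimes>\<^bsub>AutoGroup G\<^esub> t = compose (carrier G) s t"
  by (simp_all add: AutoGroup_def BijGroup_def auto_def)

lemma semidirect_Aut_simps:
  "carrier (semidirect_Aut G T) = carrier G \<times> T"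
  "(b, s) \<otimes>\<^bsub>semidirect_Aut G T\<^esub> (c, t) = (b \<otimes>\<^bsub>G\<^esub> s c, s \<otimes>\<^bsub>AutoGroup G\<^esub> t)"
  "\<one>\<^bsub>semidirect_Aut G T\<^esub> = (\<one>\<^bsub>G\<^esub>, \<one>\<^bsub>AutoGroup G\<^esub>)"
  by (simp_all add: semidirect_Aut_def)

lemma (in Group.group) semidirect_Aut_group:
  assumes T: "subgroup T (AutoGroup G)"
  shows "Group.group (semidirect_Aut G T)"
proof (rule groupI)
  interpret Au: group "AutoGroup G" by (rule AutoGroup)
  have Ta: "t \<in> auto G" if "t \<in> T" for t
    using subgroup.mem_carrier[OF T that] by (simp add: AutoGroup_simps)
  have th: "t \<in> hom G G" if "t \<in> T" for t using Ta[OF that] by (simp add: auto_def)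
  have tc: "t x \<in> carrier G" if "t \<in> T" "x \<in> carrier G" for t x
    using th[OF that(1)] that(2) by (auto simp: hom_def)
  have tm: "t (x \<otimes> y) = t x \<otimes> t y" if "t \<in> T" "x \<in> carrier G" "y \<in> carrier G" for t x y
    using th[OF that(1)] that(2,3) by (auto simp: hom_def)
  have app: "(s \<otimes>\<^bsub>AutoGroup G\<^esub> t) x = s (t x)" if "s \<in> T" "t \<in> T" "x \<in> carrier G" for s t x
    using that Ta by (simp add: AutoGroup_simps compose_def)
  let ?S = "semidirect_Aut G T"
  fix x assume "x \<in> carrier ?S"
  then obtain b s where x: "x = (b, s)" "b \<in> carrier G" "s \<in> T" by (auto simp: semidirect_Aut_simps)
  show "\<one>\<^bsub>?S\<^esub> \<otimes>\<^bsub>?S\<^esub> x = x"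
    using x Ta[OF x(3)] subgroup.mem_carrier[OF T x(3)] Au.l_one[of s]
    by (simp add: semidirect_Aut_simps AutoGroup_simps(2))
  let ?t = "inv\<^bsub>AutoGroup G\<^esub> s"
  have t: "?t \<in> T" by (rule subgroup.m_inv_closed[OF T x(3)])
  \<comment> \<open>In this product the left automorphism acts on the right component, so the left
    inverse of \<open>(b, s)\<close> carries \<open>?t\<close> applied to
    \<open>inv b\<close>.\<close>
  have "(?t (inv b), ?t) \<otimes>\<^bsub>?S\<^esub> x = \<one>\<^bsub>?S\<^esub>"
  proof -
    have "?t (inv b) \<otimes> ?t b = ?t (inv b \<otimes> b)" using tm[OF t, of "inv b" b] x by simp
    also have "\<dots> = \<one>" using th[OF t] x by (simp add: hom_one is_group)
    finally show ?thesis
      using x subgroup.mem_carrier[OF T x(3)] by (simp add: semidirect_Aut_simps)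
  qed
  moreover have "(?t (inv b), ?t) \<in> carrier ?S" using t tc x by (simp add: semidirect_Aut_simps)
  ultimately show "\<exists>y\<in>carrier ?S. y \<otimes>\<^bsub>?S\<^esub> x = \<one>\<^bsub>?S\<^esub>" by blast
  fix y assume "y \<in> carrier ?S"
  then obtain c t where y: "y = (c, t)" "c \<in> carrier G" "t \<in> T" by (auto simp: semidirect_Aut_simps)
  show "x \<otimes>\<^bsub>?S\<^esub> y \<in> carrier ?S"
    using x y tc subgroup.m_closed[OF T] by (simp add: semidirect_Aut_simps)
  fix z assume "z \<in> carrier ?S"
  then obtain d u where z: "z = (d, u)" "d \<in> carrier G" "u \<in> T" by (auto simp: semidirect_Aut_simps)
  show "x \<otimes>\<^bsub>?S\<^esub> y \<otimes>\<^bsub>?S\<^esub> z = x \<otimes>\<^bsub>?S\<^esub> (y \<otimes>\<^bsub>?S\<^esub> z)"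
    using x y z tc tm app subgroup.mem_carrier[OF T] Au.m_assoc
    by (simp add: semidirect_Aut_simps m_assoc)
next
  show "\<one>\<^bsub>semidirect_Aut G T\<^esub> \<in> carrier (semidirect_Aut G T)"
    using subgroup.one_closed[OF T] by (simp add: semidirect_Aut_simps)
qed

section \<open>Shifts as automorphisms of the direct power\<close>

context fin_group begin

context
  fixes p :: nat and D :: "(nat \<Rightarrow> 'a) monoid" and sh :: "nat \<Rightarrow> (nat \<Rightarrow> 'a) \<Rightarrow> nat \<Rightarrow> 'a"
    and T :: "((nat \<Rightarrow> 'a) \<Rightarrow> nat \<Rightarrow> 'a) set"
  defines "D \<equiv> direct_power G p"
    and "sh \<equiv> \<lambda>k. \<lambda>b\<in>carrier (direct_power G p). shift p k b"
    and "T \<equiv> generate (AutoGroup (direct_power G p)) {cyclic_shift G p}"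
  assumes p: "Factorial_Ring.prime p" and nontrivial: "carrier G \<noteq> {\<one>}"
begin

lemma p_gt_0: "p > 0" using p prime_gt_0_nat by blast

lemma carrier_D: "carrier D = PiE {..<p} (\<lambda>_. carrier G)"
  and mult_D: "x \<otimes>\<^bsub>D\<^esub> y = (\<lambda>i\<in>{..<p}. x i \<otimes> y i)"
  by (simp_all add: D_def direct_power_def)

lemma group_D: "Group.group D"
  by (simp add: D_def direct_power_def is_group)

interpretation D: group D by (rule group_D)

interpretation Au: group "AutoGroup D" by (rule D.AutoGroup)

lemma sh_apply: "b \<in> carrier D \<Longrightarrow> sh k b = shift p k b"
  by (simp add: sh_def D_def)

lemma shift_carrier: "b \<in> carrier D \<Longrightarrow> shift p k b \<in> carrier D"
  using shift_PiE[OF p_gt_0] by (simp add: carrier_D)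

lemma shift_shift: "shift p k (shift p l b) = shift p (k + l) b"
  using p_gt_0 by (auto simp: shift_def mod_add_left_eq add.assoc)

lemma shift_mod: "shift p (k mod p) b = shift p k b"
  by (auto simp: shift_def mod_add_right_eq)

lemma shift_multiple: "b \<in> carrier D \<Longrightarrow> p dvd k \<Longrightarrow> shift p k b = b"
  by (auto simp: shift_def carrier_D fun_eq_iff PiE_iff extensional_def mod_add_right_eq elim!: dvdE)

lemma sh_mod: "sh (k mod p) = sh k"
  by (rule ext) (simp add: sh_def restrict_def shift_mod)

lemma sh_auto: "sh k \<in> auto D"
proof -
  have inv: "shift p (p - k mod p) (shift p k b) = b" "shift p k (shift p (p - k mod p) b) = b"
    if "b \<in> carrier D" for b
  proof -
    have "k + (p - k mod p) = p * (1 + k div p)"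
      using p_gt_0 mod_less_divisor[of p k] mult_div_mod_eq[of p k]
      unfolding distrib_left mult_1_right by linarith
    then have "p dvd k + (p - k mod p)" by simp
    then show "shift p (p - k mod p) (shift p k b) = b" "shift p k (shift p (p - k mod p) b) = b"
      using shift_multiple[OF that] by (simp_all only: shift_shift add.commute[of _ k])
  qed
  have "bij_betw (shift p k) (carrier D) (carrier D)"
    by (rule bij_betw_byWitness[of _ "shift p (p - k mod p)"]) (use inv shift_carrier in auto)
  then have "bij_betw (sh k) (carrier D) (carrier D)"
    by (rule bij_betw_cong[THEN iffD1, rotated]) (simp add: sh_apply)
  moreover have "sh k \<in> extensional (carrier D)" by (simp add: sh_def D_def)
  moreover have "sh k \<in> hom D D"
  proof (rule homI)
    fix x y assume xy: "x \<in> carrier D" "y \<in> carrier D"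
    then have "x \<otimes>\<^bsub>D\<^esub> y \<in> carrier D" by simp
    then show "sh k (x \<otimes>\<^bsub>D\<^esub> y) = sh k x \<otimes>\<^bsub>D\<^esub> sh k y"
      using xy p_gt_0 by (auto simp: sh_apply mult_D shift_def)
  qed (simp add: sh_apply shift_carrier)
  ultimately show ?thesis by (simp add: auto_def Bij_def)
qed

lemma sh_mult: "sh k \<otimes>\<^bsub>AutoGroup D\<^esub> sh l = sh (k + l)"
proof -
  have "compose (carrier D) (sh k) (sh l) = sh (k + l)"
    by (auto simp: compose_def sh_def D_def shift_shift shift_carrier[unfolded D_def])
  then show ?thesis by (simp add: AutoGroup_simps sh_auto)
qed

lemma sh_0: "sh 0 = \<one>\<^bsub>AutoGroup D\<^esub>"
  using shift_multiple[of _ 0] by (auto simp: AutoGroup_simps sh_def D_def)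

text \<open>The prescribed generator moves entries one place up, so it is the inverse of
  \<open>sh 1\<close>.\<close>

lemma cyclic_shift_sh: "cyclic_shift G p = sh (p - 1)"
  using p_gt_0 by (auto simp: cyclic_shift_def sh_def shift_def)

text \<open>Nontriviality of the group enters here: a vector with a single nonidentity entry, at
  position \<open>k mod p\<close>, tells the shifts apart. Thus residues modulo \<open>p\<close> can
  be read off from automorphisms.\<close>

lemma sh_eq_iff: "sh k = sh l \<longleftrightarrow> k mod p = l mod p"
proof
  obtain a where a: "a \<in> carrier G" "a \<noteq> \<one>" using nontrivial one_closed by blast
  define b where "b = (\<lambda>i\<in>{..<p}. if i = k mod p then a else \<one>)"
  have b: "b \<in> carrier D" using a by (auto simp: b_def carrier_D)
  assume "sh k = sh l"
  then have "shift p k b 0 = shift p l b 0" using sh_apply[OF b] by metis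
  then have "b (k mod p) = b (l mod p)" using p_gt_0 by (simp add: shift_def)
  then show "k mod p = l mod p" using a p_gt_0 by (auto simp: b_def split: if_splits)
qed (metis sh_mod)

lemma T_eq: "T = range sh"
proof
  have sub: "subgroup (range sh) (AutoGroup D)"
  proof (rule Au.subgroupI)
    show "range sh \<subseteq> carrier (AutoGroup D)" using sh_auto by (auto simp: AutoGroup_simps)
    fix s t assume "s \<in> range sh" "t \<in> range sh"
    then show "s \<otimes>\<^bsub>AutoGroup D\<^esub> t \<in> range sh" using sh_mult by auto
  next
    fix s assume "s \<in> range sh"
    then obtain k where k: "s = sh k" by blast
    have "sh (p - k mod p) \<otimes>\<^bsub>AutoGroup D\<^esub> sh k = sh 0"
    proof -
      have "p - k mod p + k = p * (1 + k div p)"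
        using p_gt_0 mod_less_divisor[of p k] mult_div_mod_eq[of p k]
      unfolding distrib_left mult_1_right by linarith
      then have "(p - k mod p + k) mod p = 0 mod p" by simp
      then show ?thesis by (simp only: sh_mult sh_eq_iff)
    qed
    then have "inv\<^bsub>AutoGroup D\<^esub> s = sh (p - k mod p)"
      using k sh_auto by (intro Au.inv_equality) (simp_all add: sh_0 AutoGroup_simps(1))
    then show "inv\<^bsub>AutoGroup D\<^esub> s \<in> range sh" by simp
  qed auto
  show "T \<subseteq> range sh"
    unfolding T_def D_def[symmetric]
    by (rule Au.generate_subgroup_incl[OF _ sub]) (simp add: cyclic_shift_sh)
  have gen: "sh (m * (p - 1)) \<in> T" for m
  proof (induction m)
    case 0
    have "\<one>\<^bsub>AutoGroup D\<^esub> \<in> T" unfolding T_def D_def by (rule generate.one)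
    then show ?case by (simp add: sh_0)
  next
    case (Suc m)
    have "sh (p - 1) \<in> T" unfolding T_def D_def by (rule generate.incl) (simp add: cyclic_shift_sh)
    then have "sh (p - 1) \<otimes>\<^bsub>AutoGroup D\<^esub> sh (m * (p - 1)) \<in> T"
      using Suc unfolding T_def D_def by (rule generate.eng)
    then show ?case by (simp add: sh_mult)
  qed
  show "range sh \<subseteq> T"
  proof
    fix s assume "s \<in> range sh"
    then obtain k where k: "s = sh k" by blast
    \<comment> \<open>The generator is a shift by -1 modulo \<open>p\<close>, so its power with
      exponent \<open>-k\<close> is the shift by \<open>k\<close>.\<close>
    let ?m = "p - k mod p"
    have "(?m * (p - 1)) mod p = k mod p"
    proof -
      have "(p - x) * (p - 1) + x * p = x + p * (p - 1)" if xp: "x < p" for x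
      proof -
        obtain r where "p = Suc (x + r)" using less_imp_Suc_add[OF xp] by blast
        then show ?thesis by (simp add: algebra_simps)
      qed
      from this[of "k mod p"] have "?m * (p - 1) + (k mod p) * p = k mod p + p * (p - 1)"
        using p_gt_0 by simp
      then have "(?m * (p - 1) + (k mod p) * p) mod p = (k mod p + p * (p - 1)) mod p" by simp
      then show ?thesis by (simp only: mod_mult_self1 mod_mult_self2 mod_mod_trivial mult.commute[of p])
    qed
    then have "s = sh (?m * (p - 1))" using k by (simp only: sh_eq_iff)
    then show "s \<in> T" using gen by simp
  qed
qed

lemma T_subgroup: "subgroup T (AutoGroup D)"
  unfolding T_def D_def[symmetric]
  by (rule Au.generate_is_subgroup) (simp add: cyclic_shift_sh AutoGroup_simps sh_auto)

text \<open>The projection to the automorphism component has kernel \<open>B\<close>. An arbitrary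
  shift amount representing that component serves as the residue map, being unique modulo
  \<open>p\<close> by \<open>sh_eq_iff\<close>.\<close>

lemma cyclic_wreath_semidirect:
  defines "W \<equiv> semidirect_Aut D T"
  defines "B \<equiv> carrier D \<times> {\<one>\<^bsub>AutoGroup D\<^esub>}"
  shows "cyclic_wreath W B p (\<lambda>w. SOME k. snd w = sh k) G (\<lambda>b. (b, \<one>\<^bsub>AutoGroup D\<^esub>))"
proof -
  interpret W: group W unfolding W_def by (rule D.semidirect_Aut_group[OF T_subgroup])
  have carrierW: "carrier W = carrier D \<times> range sh" by (simp add: W_def semidirect_Aut_simps T_eq)
  have finT: "finite (range sh)"
  proof -
    have "range sh \<subseteq> sh ` {..<p}" using p_gt_0 sh_mod by (metis image_subsetI imageI lessThan_iff mod_less_divisor)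
    then show ?thesis by (rule finite_subset) simp
  qed
  have finD: "finite (carrier D)" by (simp add: carrier_D finite_PiE finite_carrier)
  have fin: "fin_group W"
    using W.is_group finT finD by (simp add: fin_group_def fin_group_axioms_def carrierW)
  define \<delta> where "\<delta> w = (SOME k. snd w = sh k)" for w :: "(nat \<Rightarrow> 'a) \<times> ((nat \<Rightarrow> 'a) \<Rightarrow> nat \<Rightarrow> 'a)"
  have \<delta>: "snd w = sh (\<delta> w)" if "w \<in> carrier W" for w
  proof -
    have "\<exists>k. snd w = sh k" using that carrierW by auto
    then show ?thesis unfolding \<delta>_def by (rule someI_ex)
  qed
  have multW: "(b, s) \<otimes>\<^bsub>W\<^esub> (c, t) = (b \<otimes>\<^bsub>D\<^esub> s c, s \<otimes>\<^bsub>AutoGroup D\<^esub> t)" for b s c t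
    by (simp add: W_def semidirect_Aut_simps)
  have oneD: "\<one>\<^bsub>AutoGroup D\<^esub> c = c" if "c \<in> carrier D" for c
    using that by (simp add: AutoGroup_simps)
  have snd_mult: "snd (x \<otimes>\<^bsub>W\<^esub> y) = snd x \<otimes>\<^bsub>AutoGroup D\<^esub> snd y" for x y
    by (cases x; cases y) (simp add: multW)
  have "snd \<in> hom W (AutoGroup D)"
    by (rule homI) (auto simp: carrierW AutoGroup_simps(1) sh_auto snd_mult)
  then interpret S: group_hom W "AutoGroup D" snd
    by (simp add: group_hom_def group_hom_axioms_def W.is_group Au.is_group)
  have one_sh: "\<one>\<^bsub>AutoGroup D\<^esub> \<in> range sh" using sh_0 by (metis rangeI)
  have B_kernel: "B = kernel W (AutoGroup D) snd"
    using one_sh by (auto simp: B_def kernel_def carrierW)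
  have normal: "B \<lhd> W" unfolding B_kernel by (rule S.normal_kernel)
  let ?e = "\<lambda>b. (b, \<one>\<^bsub>AutoGroup D\<^esub>)"
  have eW: "?e b \<in> carrier W" if "b \<in> carrier D" for b using that one_sh by (simp add: carrierW)
  have conj: "w \<otimes>\<^bsub>W\<^esub> ?e b \<otimes>\<^bsub>W\<^esub> inv\<^bsub>W\<^esub> w = ?e c \<otimes>\<^bsub>W\<^esub> ?e (shift p k b) \<otimes>\<^bsub>W\<^esub> inv\<^bsub>W\<^esub> (?e c)"
    if w: "w = (c, sh k)" and c: "c \<in> carrier D" and b: "b \<in> carrier D" for w c k b
  proof -
    \<comment> \<open>Splits \<open>w\<close> into its base part and a pure shift: conjugation by
      \<open>v\<close> shifts \<open>b\<close>, and the base part accounts for the inner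
      automorphism.\<close>
    define v where "v = (\<one>\<^bsub>D\<^esub>, sh k)"
    have v: "v \<in> carrier W" by (simp add: v_def carrierW)
    have sb: "?e (shift p k b) \<in> carrier W" by (rule eW[OF shift_carrier[OF b]])
    have wv: "w = ?e c \<otimes>\<^bsub>W\<^esub> v"
      using c sh_auto by (simp add: w v_def multW oneD AutoGroup_simps(1))
    have "v \<otimes>\<^bsub>W\<^esub> ?e b = ?e (shift p k b) \<otimes>\<^bsub>W\<^esub> v"
      using b shift_carrier[OF b] sh_auto by (simp add: v_def multW oneD sh_apply AutoGroup_simps(1))
    then have "w \<otimes>\<^bsub>W\<^esub> ?e b = ?e c \<otimes>\<^bsub>W\<^esub> ?e (shift p k b) \<otimes>\<^bsub>W\<^esub> v"
      using wv v eW[OF b] eW[OF c] sb by (simp add: W.m_assoc)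
    then show ?thesis
      using wv v eW[OF b] eW[OF c] sb by (simp add: W.inv_mult_group W.m_assoc fin_group.inv_mult_cancel[OF fin])
  qed
  have "cyclic_wreath W B p \<delta> G ?e"
  proof (intro cyclic_wreath.intro cyclic_extension.intro cyclic_extension_axioms.intro
      cyclic_wreath_axioms.intro fin normal p fin_group_axioms)
    fix x y assume xy: "x \<in> carrier W" "y \<in> carrier W"
    have "sh (\<delta> (x \<otimes>\<^bsub>W\<^esub> y)) = sh (\<delta> x + \<delta> y)"
      using \<delta>[OF xy(1)] \<delta>[OF xy(2)] \<delta>[OF W.m_closed[OF xy]] by (simp add: snd_mult sh_mult)
    then show "\<delta> (x \<otimes>\<^bsub>W\<^esub> y) mod p = (\<delta> x + \<delta> y) mod p" by (simp only: sh_eq_iff)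
  next
    fix x assume x: "x \<in> carrier W"
    have "x \<in> B \<longleftrightarrow> snd x = sh 0" using x by (auto simp: B_kernel kernel_def sh_0)
    also have "\<dots> \<longleftrightarrow> sh (\<delta> x) = sh 0" using \<delta>[OF x] by simp
    also have "\<dots> \<longleftrightarrow> p dvd \<delta> x" by (simp only: sh_eq_iff mod_0 dvd_eq_mod_eq_0)
    finally show "x \<in> B \<longleftrightarrow> p dvd \<delta> x" .
  next
    have "?e \<in> hom D W"
      by (rule homI) (simp_all add: eW multW oneD)
    then show "?e \<in> hom (direct_power G p) W" by (simp add: D_def)
    show "inj_on ?e (carrier (direct_power G p))" by (simp add: inj_on_def)
    show "?e ` carrier (direct_power G p) = B" by (auto simp: B_def D_def)
  next
    fix w assume "w \<in> carrier W"
    then obtain c k where w: "w = (c, sh k)" "c \<in> carrier D" by (auto simp: carrierW)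
    then have "w = (c, sh (k mod p))" by (simp add: sh_mod)
    from conj[OF this w(2)] show "\<exists>k<p. \<exists>c\<in>carrier (direct_power G p). \<forall>b\<in>carrier (direct_power G p).
        w \<otimes>\<^bsub>W\<^esub> ?e b \<otimes>\<^bsub>W\<^esub> inv\<^bsub>W\<^esub> w = ?e c \<otimes>\<^bsub>W\<^esub> ?e (shift p k b) \<otimes>\<^bsub>W\<^esub> inv\<^bsub>W\<^esub> (?e c)"
      unfolding D_def[symmetric] using w(2) p_gt_0
      by (intro exI[of _ "k mod p"] conjI bexI[of _ c] ballI) simp_all
  next
    fix k assume "k < p"
    have one: "?e \<one>\<^bsub>D\<^esub> = \<one>\<^bsub>W\<^esub>" by (simp add: W_def semidirect_Aut_simps)
    have "(\<one>\<^bsub>D\<^esub>, sh k) \<otimes>\<^bsub>W\<^esub> ?e b \<otimes>\<^bsub>W\<^esub> inv\<^bsub>W\<^esub> (\<one>\<^bsub>D\<^esub>, sh k) = ?e (shift p k b)"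
      if b: "b \<in> carrier D" for b
      using conj[OF refl D.one_closed b, of k] eW[OF shift_carrier[OF b]] by (simp add: one)
    then show "\<exists>w\<in>carrier W. \<forall>b\<in>carrier (direct_power G p).
        w \<otimes>\<^bsub>W\<^esub> ?e b \<otimes>\<^bsub>W\<^esub> inv\<^bsub>W\<^esub> w = ?e (shift p k b)"
      unfolding D_def[symmetric] by (intro bexI[of _ "(\<one>\<^bsub>D\<^esub>, sh k)"]) (simp_all add: carrierW)
  qed
  then show ?thesis unfolding \<delta>_def .
qed

end

end

theorem theorem2p7:
  fixes A :: "('a, 'm) monoid_scheme"
    and C :: "('c, 'k) monoid_scheme"
    and p :: nat
    and W :: "((nat \<Rightarrow> 'a) \<times> ((nat \<Rightarrow> 'a) \<Rightarrow> (nat \<Rightarrow> 'a))) monoid"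
    and B :: "((nat \<Rightarrow> 'a) \<times> ((nat \<Rightarrow> 'a) \<Rightarrow> (nat \<Rightarrow> 'a))) set"
  assumes "Group.group A" and "finite (carrier A)" and "carrier A \<noteq> {\<one>\<^bsub>A\<^esub>}"
    and "almost_monomial A"
    and "Group.group C" and "cyclic_group C" and "Coset.order C = p" and "Factorial_Ring.prime p"
    and "W = wreath_product A C"
    and "B = base_group A C"
    and "\<And>\<chi> \<beta>. \<lbrakk>\<chi> \<in> Irr W; restrict \<chi> B \<in> Irr (W\<lparr>carrier := B\<rparr>);
                  \<beta> \<in> characters (W Mod B); \<beta> \<noteq> principal_character (W Mod B)\<rbrakk> \<Longrightarrow>
           \<exists>H \<mu>. subgroup H W \<and> \<mu> \<in> linear_characters (W\<lparr>carrier := H\<rparr>) \<and>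
                 \<chi> \<in> constituents W (induced W H \<mu>) \<and>
                 char_mult W (inflation W B \<beta>) \<chi> \<notin> constituents W (induced W H \<mu>)"
  shows "almost_monomial W"
proof -
  have A: "fin_group A" using assms(1,2) by (simp add: fin_group_def fin_group_axioms_def)
  have W: "W = semidirect_Aut (direct_power A p)
      (generate (AutoGroup (direct_power A p)) {cyclic_shift A p})"
    unfolding assms(9) wreath_product_def assms(7) Let_def ..
  have B: "B = carrier (direct_power A p) \<times> {\<one>\<^bsub>AutoGroup (direct_power A p)\<^esub>}"
    unfolding assms(10) base_group_def assms(7) Let_def ..
  note loc = fin_group.cyclic_wreath_semidirect[OF A assms(8,3), folded W B]
  show ?thesis
    by (rule cyclic_wreath.almost_monomial_wreath[OF loc assms(4,11)])
qed

end
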